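(* Let $G$ be a group with neutral element $\varepsilon$, let $R$ be a graded Artinian $G$-graded ring, and let $\sigma\in G$. The following are equivalent. (1) $R$ is a $\sigma$-graded Frobenius ring. (2) $R$ is $\sigma$-faithful to the left and to the right, $\mathrm{soc}({}_{R_\varepsilon}R_\sigma)\simeq R_\varepsilon/J(R_\varepsilon)$ as left $R_\varepsilon$-modules, and $\mathrm{soc}((R_\sigma)_{R_\varepsilon})\simeq R_\varepsilon/J(R_\varepsilon)$ as right $R_\varepsilon$-modules.
   Context: Rings are associative with identity; a $G$-graded ring is $R=\bigoplus_{g\in G}R_g$ with $R_gR_h\subset R_{gh}$. $R-gr$ is the category of graded left $R$-modules $M=\bigoplus_gM_g$ ($R_gM_h\subset M_{gh}$) with degree-preserving $R$-linear maps; $M(\sigma)$ is $M$ with grading $M(\sigma)_g=M_{g\sigma}$. $R$ is graded Artinian if it satisfies DCC on graded left ideals and on graded right ideals. $J^{\rm gr}(R)$ is the intersection of all maximal graded left ideals of $R$; $J(R_\varepsilon)$ is the usual Jacobson radical; $\mathrm{soc}$ is the usual socle of a module. $R$ is graded quasi-Frobenius if it is graded left Noetherian (ACC on graded left ideals) and injective in $R-gr$; in this case the left graded socle (sum of the minimal graded left ideals) and the right graded socle (sum of the minimal graded right ideals) of $R$ coincide and are denoted $\mathrm{soc}^{\rm gr}(R)$. A graded Artinian ring $R$ is a $\sigma$-graded Frobenius ring if it is graded quasi-Frobenius and $\mathrm{soc}^{\rm gr}(R)(\sigma)\simeq R/J^{\rm gr}(R)$ in $R-gr$. $R$ is $\sigma$-faithful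 to the left (right) if $X_\sigma\neq 0$ for every nonzero graded left (right) ideal $X=\bigoplus_gX_g$ of $R$. *)

theory Defs
  imports "HOL-Algebra.Algebra"
begin

section \<open>Modules over rings that need not be commutative\<close>

text \<open>The locale \<^locale>\<open>module\<close> of the library requires a commutative ring of scalars.
  The following one has the same axioms over an arbitrary ring.  As there, the multiplication
  and unit fields of the record \<open>M\<close> play no role.\<close>

locale left_module = R?: ring R + M?: abelian_group M
  for R :: "('a, 'b) ring_scheme" (structure) and M :: "('a, 'm, 'c) module_scheme" (structure) +
  assumes smult_closed:
      "\<lbrakk>a \<in> carrier R; x \<in> carrier M\<rbrakk> \<Longrightarrow> a \<odot>\<^bsub>M\<^esub> x \<in> carrier M"
    and smult_l_distr:
      "\<lbrakk>a \<in> carrier R; b \<in> carrier R; x \<in> carrier M\<rbrakk> \<Longrightarrow>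
        (a \<oplus>\<^bsub>R\<^esub> b) \<odot>\<^bsub>M\<^esub> x = a \<odot>\<^bsub>M\<^esub> x \<oplus>\<^bsub>M\<^esub> b \<odot>\<^bsub>M\<^esub> x"
    and smult_r_distr:
      "\<lbrakk>a \<in> carrier R; x \<in> carrier M; y \<in> carrier M\<rbrakk> \<Longrightarrow>
        a \<odot>\<^bsub>M\<^esub> (x \<oplus>\<^bsub>M\<^esub> y) = a \<odot>\<^bsub>M\<^esub> x \<oplus>\<^bsub>M\<^esub> a \<odot>\<^bsub>M\<^esub> y"
    and smult_assoc:
      "\<lbrakk>a \<in> carrier R; b \<in> carrier R; x \<in> carrier M\<rbrakk> \<Longrightarrow>
        (a \<otimes>\<^bsub>R\<^esub> b) \<odot>\<^bsub>M\<^esub> x = a \<odot>\<^bsub>M\<^esub> (b \<odot>\<^bsub>M\<^esub> x)"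
    and smult_one:
      "x \<in> carrier M \<Longrightarrow> \<one>\<^bsub>R\<^esub> \<odot>\<^bsub>M\<^esub> x = x"

text \<open>Right modules over \<open>R\<close> are treated as left modules over the opposite ring.\<close>

definition opp_ring :: "('a, 'b) ring_scheme \<Rightarrow> ('a, 'b) ring_scheme" where
  "opp_ring R = R\<lparr>monoid.mult := \<lambda>x y. y \<otimes>\<^bsub>R\<^esub> x\<rparr>"

definition left_reg :: "('a, 'b) ring_scheme \<Rightarrow> ('a, 'a) module" where
  "left_reg R = \<lparr>carrier = carrier R, monoid.mult = monoid.mult R, one = one R,
     ring.zero = ring.zero R, add = add R, smult = monoid.mult R\<rparr>"

definition right_reg :: "('a, 'b) ring_scheme \<Rightarrow> ('a, 'a) module" where
  "right_reg R = left_reg (opp_ring R)"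

definition quot_module :: "('a, 'm, 'c) module_scheme \<Rightarrow> 'm set \<Rightarrow> ('a, 'm set) module" where
  "quot_module M N = \<lparr>carrier = a_rcosets\<^bsub>M\<^esub> N, monoid.mult = undefined, one = undefined,
     ring.zero = N, add = set_add M,
     smult = (\<lambda>r A. (\<Union>x\<in>A. N +>\<^bsub>M\<^esub> (r \<odot>\<^bsub>M\<^esub> x)))\<rparr>"

definition module_hom ::
  "('a, 'b) ring_scheme \<Rightarrow> ('a, 'm, 'c) module_scheme \<Rightarrow> ('a, 'n, 'd) module_scheme
    \<Rightarrow> ('m \<Rightarrow> 'n) set" where
  "module_hom R M N = {f. f \<in> carrier M \<rightarrow> carrier N
     \<and> (\<forall>x\<in>carrier M. \<forall>y\<in>carrier M. f (x \<oplus>\<^bsub>M\<^esub> y) = f x \<oplus>\<^bsub>N\<^esub> f y)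
     \<and> (\<forall>r\<in>carrier R. \<forall>x\<in>carrier M. f (r \<odot>\<^bsub>M\<^esub> x) = r \<odot>\<^bsub>N\<^esub> f x)}"

definition module_isomorphic ::
  "('a, 'b) ring_scheme \<Rightarrow> ('a, 'm, 'c) module_scheme \<Rightarrow> ('a, 'n, 'd) module_scheme \<Rightarrow> bool" where
  "module_isomorphic R M N \<longleftrightarrow>
     (\<exists>f\<in>module_hom R M N. bij_betw f (carrier M) (carrier N))"

definition simple_submodule ::
  "'m set \<Rightarrow> ('a, 'b) ring_scheme \<Rightarrow> ('a, 'm, 'c) module_scheme \<Rightarrow> bool" where
  "simple_submodule S R M \<longleftrightarrow> submodule S R M \<and> S \<noteq> {\<zero>\<^bsub>M\<^esub>}
     \<and> (\<forall>T. submodule T R M \<and> T \<subseteq> S \<longrightarrow> T = {\<zero>\<^bsub>M\<^esub>} \<or> T = S)"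

text \<open>A sum of submodules is the additive subgroup generated by their union.\<close>

definition socle :: "('a, 'b) ring_scheme \<Rightarrow> ('a, 'm, 'c) module_scheme \<Rightarrow> 'm set" where
  "socle R M = generate (add_monoid M) (\<Union>{S. simple_submodule S R M})"

definition maximal_left_ideal :: "'a set \<Rightarrow> ('a, 'b) ring_scheme \<Rightarrow> bool" where
  "maximal_left_ideal I R \<longleftrightarrow> submodule I R (left_reg R) \<and> I \<noteq> carrier R
     \<and> (\<forall>K. submodule K R (left_reg R) \<and> I \<subseteq> K \<longrightarrow> K = I \<or> K = carrier R)"

text \<open>The Jacobson radical is two-sided, so it may be used as a submodule of the left and of the
  right regular module.\<close>

definition jacobson_radical :: "('a, 'b) ring_scheme \<Rightarrow> 'a set" where
  "jacobson_radical R = carrier R \<inter> \<Inter>{I. maximal_left_ideal I R}"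


section \<open>Graded rings and graded modules\<close>

definition internal_direct_sum ::
  "('m, 'c) ring_scheme \<Rightarrow> 'g set \<Rightarrow> ('g \<Rightarrow> 'm set) \<Rightarrow> bool" where
  "internal_direct_sum M I A \<longleftrightarrow>
     (\<forall>g\<in>I. subgroup (A g) (add_monoid M)) \<and>
     (\<forall>x\<in>carrier M. \<exists>!f. f \<in> Pi\<^sub>E I A \<and> finite {g\<in>I. f g \<noteq> \<zero>\<^bsub>M\<^esub>} \<and>
        x = finsum M f {g\<in>I. f g \<noteq> \<zero>\<^bsub>M\<^esub>})"

locale graded_ring = G?: group G + R?: ring R
  for G :: "('g, 'e) monoid_scheme" (structure) and R :: "('a, 'b) ring_scheme" (structure)
    and Rg :: "'g \<Rightarrow> 'a set" +
  assumes ring_direct_sum: "internal_direct_sum R (carrier G) Rg"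
    and ring_mult_degree:
      "\<lbrakk>g \<in> carrier G; h \<in> carrier G; a \<in> Rg g; b \<in> Rg h\<rbrakk> \<Longrightarrow> a \<otimes>\<^bsub>R\<^esub> b \<in> Rg (g \<otimes>\<^bsub>G\<^esub> h)"

locale graded_module = graded_ring G R Rg + left_module R M
  for G :: "('g, 'e) monoid_scheme" (structure) and R :: "('a, 'b) ring_scheme" (structure)
    and Rg :: "'g \<Rightarrow> 'a set" and M :: "('a, 'm, 'c) module_scheme" (structure)
    and Mg :: "'g \<Rightarrow> 'm set" +
  assumes module_direct_sum: "internal_direct_sum M (carrier G) Mg"
    and smult_degree:
      "\<lbrakk>g \<in> carrier G; h \<in> carrier G; a \<in> Rg g; x \<in> Mg h\<rbrakk> \<Longrightarrow> a \<odot>\<^bsub>M\<^esub> x \<in> Mg (g \<otimes>\<^bsub>G\<^esub> h)"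

definition shift :: "('g, 'e) monoid_scheme \<Rightarrow> 'g \<Rightarrow> ('g \<Rightarrow> 'm set) \<Rightarrow> 'g \<Rightarrow> 'm set" where
  "shift G \<sigma> Mg = (\<lambda>g. Mg (g \<otimes>\<^bsub>G\<^esub> \<sigma>))"

definition quot_grading ::
  "('a, 'm, 'c) module_scheme \<Rightarrow> ('g \<Rightarrow> 'm set) \<Rightarrow> 'm set \<Rightarrow> 'g \<Rightarrow> 'm set set" where
  "quot_grading M Mg N = (\<lambda>g. (\<lambda>x. N +>\<^bsub>M\<^esub> x) ` Mg g)"

definition graded_hom ::
  "('g, 'e) monoid_scheme \<Rightarrow> ('a, 'b) ring_scheme \<Rightarrow>
   ('a, 'm, 'c) module_scheme \<Rightarrow> ('g \<Rightarrow> 'm set) \<Rightarrow>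
   ('a, 'n, 'd) module_scheme \<Rightarrow> ('g \<Rightarrow> 'n set) \<Rightarrow> ('m \<Rightarrow> 'n) set" where
  "graded_hom G R M Mg N Ng = {f \<in> module_hom R M N. \<forall>g\<in>carrier G. f ` Mg g \<subseteq> Ng g}"

text \<open>A bijective graded homomorphism has a graded inverse, because of the direct sum
  decompositions on both sides.\<close>

definition graded_isomorphic ::
  "('g, 'e) monoid_scheme \<Rightarrow> ('a, 'b) ring_scheme \<Rightarrow>
   ('a, 'm, 'c) module_scheme \<Rightarrow> ('g \<Rightarrow> 'm set) \<Rightarrow>
   ('a, 'n, 'd) module_scheme \<Rightarrow> ('g \<Rightarrow> 'n set) \<Rightarrow> bool" where
  "graded_isomorphic G R M Mg N Ng \<longleftrightarrow>
     (\<exists>f\<in>graded_hom G R M Mg N Ng. bij_betw f (carrier M) (carrier N))"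

definition graded_submodule ::
  "('g, 'e) monoid_scheme \<Rightarrow> 'm set \<Rightarrow> ('a, 'b) ring_scheme \<Rightarrow>
   ('a, 'm, 'c) module_scheme \<Rightarrow> ('g \<Rightarrow> 'm set) \<Rightarrow> bool" where
  "graded_submodule G N R M Mg \<longleftrightarrow> submodule N R M \<and>
     internal_direct_sum (M\<lparr>carrier := N\<rparr>) (carrier G) (\<lambda>g. N \<inter> Mg g)"

definition graded_left_ideal ::
  "('g, 'e) monoid_scheme \<Rightarrow> 'a set \<Rightarrow> ('a, 'b) ring_scheme \<Rightarrow> ('g \<Rightarrow> 'a set) \<Rightarrow> bool" where
  "graded_left_ideal G I R Rg \<longleftrightarrow> graded_submodule G I R (left_reg R) Rg"

definition graded_right_ideal ::
  "('g, 'e) monoid_scheme \<Rightarrow> 'a set \<Rightarrow> ('a, 'b) ring_scheme \<Rightarrow> ('g \<Rightarrow> 'a set) \<Rightarrow> bool" where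
  "graded_right_ideal G I R Rg \<longleftrightarrow> graded_submodule G I (opp_ring R) (right_reg R) Rg"


section \<open>Chain conditions, radical, socle and injectivity\<close>

definition ascending_chain_condition :: "('a set \<Rightarrow> bool) \<Rightarrow> bool" where
  "ascending_chain_condition P \<longleftrightarrow> (\<forall>I :: nat \<Rightarrow> 'a set. (\<forall>n. P (I n) \<and> I n \<subseteq> I (Suc n)) \<longrightarrow>
     (\<exists>k. \<forall>n\<ge>k. I n = I k))"

definition descending_chain_condition :: "('a set \<Rightarrow> bool) \<Rightarrow> bool" where
  "descending_chain_condition P \<longleftrightarrow> (\<forall>I :: nat \<Rightarrow> 'a set. (\<forall>n. P (I n) \<and> I (Suc n) \<subseteq> I n) \<longrightarrow>
     (\<exists>k. \<forall>n\<ge>k. I n = I k))"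

definition graded_left_noetherian ::
  "('g, 'e) monoid_scheme \<Rightarrow> ('a, 'b) ring_scheme \<Rightarrow> ('g \<Rightarrow> 'a set) \<Rightarrow> bool" where
  "graded_left_noetherian G R Rg \<longleftrightarrow> ascending_chain_condition (\<lambda>I. graded_left_ideal G I R Rg)"

definition graded_artinian ::
  "('g, 'e) monoid_scheme \<Rightarrow> ('a, 'b) ring_scheme \<Rightarrow> ('g \<Rightarrow> 'a set) \<Rightarrow> bool" where
  "graded_artinian G R Rg \<longleftrightarrow>
     descending_chain_condition (\<lambda>I. graded_left_ideal G I R Rg) \<and>
     descending_chain_condition (\<lambda>I. graded_right_ideal G I R Rg)"

definition maximal_graded_left_ideal ::
  "('g, 'e) monoid_scheme \<Rightarrow> 'a set \<Rightarrow> ('a, 'b) ring_scheme \<Rightarrow> ('g \<Rightarrow> 'a set) \<Rightarrow> bool" where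
  "maximal_graded_left_ideal G I R Rg \<longleftrightarrow> graded_left_ideal G I R Rg \<and> I \<noteq> carrier R
     \<and> (\<forall>K. graded_left_ideal G K R Rg \<and> I \<subseteq> K \<longrightarrow> K = I \<or> K = carrier R)"

definition minimal_graded_left_ideal ::
  "('g, 'e) monoid_scheme \<Rightarrow> 'a set \<Rightarrow> ('a, 'b) ring_scheme \<Rightarrow> ('g \<Rightarrow> 'a set) \<Rightarrow> bool" where
  "minimal_graded_left_ideal G I R Rg \<longleftrightarrow> graded_left_ideal G I R Rg \<and> I \<noteq> {\<zero>\<^bsub>R\<^esub>}
     \<and> (\<forall>K. graded_left_ideal G K R Rg \<and> K \<subseteq> I \<longrightarrow> K = {\<zero>\<^bsub>R\<^esub>} \<or> K = I)"

definition graded_jacobson_radical ::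
  "('g, 'e) monoid_scheme \<Rightarrow> ('a, 'b) ring_scheme \<Rightarrow> ('g \<Rightarrow> 'a set) \<Rightarrow> 'a set" where
  "graded_jacobson_radical G R Rg =
     carrier R \<inter> \<Inter>{I. maximal_graded_left_ideal G I R Rg}"

text \<open>This is the left graded socle; for graded quasi-Frobenius rings, the only ones for which
  it is used below, it coincides with the right one.\<close>

definition graded_socle ::
  "('g, 'e) monoid_scheme \<Rightarrow> ('a, 'b) ring_scheme \<Rightarrow> ('g \<Rightarrow> 'a set) \<Rightarrow> 'a set" where
  "graded_socle G R Rg =
     generate (add_monoid R) (\<Union>{I. minimal_graded_left_ideal G I R Rg})"

text \<open>Injectivity of \<open>Q\<close> in the category of graded left \<open>R\<close>-modules.  HOL cannot quantify over
  types inside a formula, so the test modules range over all graded modules with elements in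
  a type \<open>'m\<close>, which serves as the universe.  By the graded Baer criterion, the notion is
  independent of \<open>'m\<close> as soon as \<open>R\<close> embeds into \<open>'m\<close>, because the inclusions of
  graded left ideals in the shifts of \<open>R\<close> suffice as test morphisms.\<close>

definition graded_injective ::
  "'m itself \<Rightarrow> ('g, 'e) monoid_scheme \<Rightarrow> ('a, 'b) ring_scheme \<Rightarrow> ('g \<Rightarrow> 'a set) \<Rightarrow>
   ('a, 'n, 'd) module_scheme \<Rightarrow> ('g \<Rightarrow> 'n set) \<Rightarrow> bool" where
  "graded_injective (_ :: 'm itself) G R Rg Q Qg \<longleftrightarrow> graded_module G R Rg Q Qg \<and>
     (\<forall>(M :: ('a, 'm) module) Mg (N :: ('a, 'm) module) Ng. \<forall>i f.
        graded_module G R Rg M Mg \<and> graded_module G R Rg N Ng \<and>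
        i \<in> graded_hom G R N Ng M Mg \<and> inj_on i (carrier N) \<and>
        f \<in> graded_hom G R N Ng Q Qg \<longrightarrow>
        (\<exists>h\<in>graded_hom G R M Mg Q Qg. \<forall>x\<in>carrier N. h (i x) = f x))"


section \<open>Graded quasi-Frobenius and Frobenius rings, faithfulness\<close>

definition graded_quasi_frobenius ::
  "'m itself \<Rightarrow> ('g, 'e) monoid_scheme \<Rightarrow> ('a, 'b) ring_scheme \<Rightarrow> ('g \<Rightarrow> 'a set) \<Rightarrow> bool" where
  "graded_quasi_frobenius U G R Rg \<longleftrightarrow>
     graded_left_noetherian G R Rg \<and> graded_injective U G R Rg (left_reg R) Rg"

definition graded_frobenius ::
  "'m itself \<Rightarrow> ('g, 'e) monoid_scheme \<Rightarrow> ('a, 'b) ring_scheme \<Rightarrow> ('g \<Rightarrow> 'a set) \<Rightarrow>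
   'g \<Rightarrow> bool" where
  "graded_frobenius U G R Rg \<sigma> \<longleftrightarrow>
     graded_artinian G R Rg \<and> graded_quasi_frobenius U G R Rg \<and>
     graded_isomorphic G R
       ((left_reg R)\<lparr>carrier := graded_socle G R Rg\<rparr>)
       (shift G \<sigma> (\<lambda>g. graded_socle G R Rg \<inter> Rg g))
       (quot_module (left_reg R) (graded_jacobson_radical G R Rg))
       (quot_grading (left_reg R) Rg (graded_jacobson_radical G R Rg))"

definition left_faithful_at ::
  "('g, 'e) monoid_scheme \<Rightarrow> ('a, 'b) ring_scheme \<Rightarrow> ('g \<Rightarrow> 'a set) \<Rightarrow> 'g \<Rightarrow> bool" where
  "left_faithful_at G R Rg \<sigma> \<longleftrightarrow>
     (\<forall>I. graded_left_ideal G I R Rg \<and> I \<noteq> {\<zero>\<^bsub>R\<^esub>} \<longrightarrow> I \<inter> Rg \<sigma> \<noteq> {\<zero>\<^bsub>R\<^esub>})"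

definition right_faithful_at ::
  "('g, 'e) monoid_scheme \<Rightarrow> ('a, 'b) ring_scheme \<Rightarrow> ('g \<Rightarrow> 'a set) \<Rightarrow> 'g \<Rightarrow> bool" where
  "right_faithful_at G R Rg \<sigma> \<longleftrightarrow>
     (\<forall>I. graded_right_ideal G I R Rg \<and> I \<noteq> {\<zero>\<^bsub>R\<^esub>} \<longrightarrow> I \<inter> Rg \<sigma> \<noteq> {\<zero>\<^bsub>R\<^esub>})"

definition neutral_component ::
  "('g, 'e) monoid_scheme \<Rightarrow> ('a, 'b) ring_scheme \<Rightarrow> ('g \<Rightarrow> 'a set) \<Rightarrow> ('a, 'b) ring_scheme" where
  "neutral_component G R Rg = R\<lparr>carrier := Rg \<one>\<^bsub>G\<^esub>\<rparr>"

definition left_component :: "('a, 'b) ring_scheme \<Rightarrow> ('g \<Rightarrow> 'a set) \<Rightarrow> 'g \<Rightarrow> ('a, 'a) module" where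
  "left_component R Rg \<sigma> = (left_reg R)\<lparr>carrier := Rg \<sigma>\<rparr>"

definition right_component :: "('a, 'b) ring_scheme \<Rightarrow> ('g \<Rightarrow> 'a set) \<Rightarrow> 'g \<Rightarrow> ('a, 'a) module" where
  "right_component R Rg \<sigma> = (right_reg R)\<lparr>carrier := Rg \<sigma>\<rparr>"

end

theory Submission
  imports Defs
begin

text \<open>Write \<open>J\<close> for the radical of \<open>R\<^sub>\<epsilon>\<close> and \<open>L\<close>, \<open>L'\<close> for the left and right socles of
  \<open>R\<^sub>\<sigma>\<close>; they are the annihilators of \<open>J\<close> in \<open>R\<^sub>\<sigma>\<close> because \<open>R\<^sub>\<epsilon>\<close> is Artinian. The two socle
  isomorphisms say that \<open>L = R\<^sub>\<epsilon> s\<close> and \<open>L' = s' R\<^sub>\<epsilon>\<close>, where \<open>s\<close> and \<open>s'\<close> have annihilator \<open>J\<close>.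

  From (2) to (1): mapping a left ideal \<open>I \<supseteq> J\<close> to the annihilator of \<open>I\<close> in \<open>L \<inter> L' \<subseteq> s' R\<^sub>\<epsilon>\<close>, and
  symmetrically on the right, yields a strictly monotone self-map of the left ideals above \<open>J\<close>.
  By the descending chain condition it fixes \<open>R\<^sub>\<epsilon>\<close>, which forces \<open>L = L'\<close>. Together with
  faithfulness on both sides it follows that the right annihilator of a maximal graded left ideal
  has no proper nonzero graded right subideal, and dually. Therefore taking annihilators turns
  covers into covers or equalities, so every graded left ideal is a left annihilator. The ascending
  chain condition on the left then follows from the descending one on the right, and homomorphisms
  extend from graded left ideals one cover at a time, which is Baer's criterion.

  From (1) to (2): injectivity gives \<open>L = s R\<^sub>\<epsilon>\<close> and lets right multiplications separate homogeneous
  elements from graded left ideals, which yields right faithfulness and \<open>L = L'\<close>.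

  Right-handed facts are obtained from left-handed ones by passing to the opposite ring, graded by
  the opposite group.\<close>

section \<open>Left ideals and the Jacobson radical\<close>

text \<open>Composition length would be the natural measure for the self-map and for the covers, but
  only chain conditions are at hand; so counting is replaced by a minimal counterexample or by the
  stabilisation of a chain. The semisimple ring \<open>R\<^sub>\<epsilon> / J\<close> is likewise
  never formed: its properties are stated in \<open>R\<^sub>\<epsilon>\<close>, with equations
  replaced by differences in \<open>J\<close>. Three of them are used: a left ideal above
  \<open>J\<close> is split off by an idempotent, the ring is von Neumann regular, and one-sided
  inverses are two-sided. The obstacle in (2) is that the socle hypotheses concern degree \<sigma>
  only. An element of another degree reaches \<sigma> by a homogeneous factor on the left or on the
  right, and faithfulness keeps the product nonzero; doing this twice on the right yields a factor
  of neutral degree, to which the structure of \<open>R\<^sub>\<epsilon>\<close> applies.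
  Throughout, a maximal left ideal \<open>n\<close> of \<open>R\<^sub>\<epsilon>\<close> corresponds
  to the largest graded left ideal with neutral component in \<open>n\<close>, and these are all the
  maximal graded left ideals.\<close>

lemma dcc_minimal:
  assumes "descending_chain_condition P" and "F I" and "\<And>I. F I \<Longrightarrow> P I"
  obtains D where "F D" and "\<And>E. F E \<Longrightarrow> E \<subseteq> D \<Longrightarrow> E = D"
proof (rule ccontr)
  assume "\<not> thesis"
  with that have "\<forall>D. F D \<longrightarrow> (\<exists>E. F E \<and> E \<subset> D)" by blast
  then obtain h where h: "\<And>D. F D \<Longrightarrow> F (h D) \<and> h D \<subset> D" by metis
  define C where "C = (\<lambda>n. (h ^^ n) I)"
  have F: "F (C n)" for n by (induction n) (auto simp: C_def assms(2) h)
  have lt: "C (Suc n) \<subset> C n" for n using h[OF F[of n]] by (simp add: C_def)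
  have "\<exists>k. \<forall>n\<ge>k. C n = C k"
    using assms(1,3) F lt unfolding descending_chain_condition_def by (meson psubsetE)
  then show False using lt by (metis le_SucI order_refl psubsetE)
qed

lemma acc_maximal:
  assumes "ascending_chain_condition P" and "F I" and "\<And>I. F I \<Longrightarrow> P I"
  obtains D where "F D" and "\<And>E. F E \<Longrightarrow> D \<subseteq> E \<Longrightarrow> E = D"
proof (rule ccontr)
  assume "\<not> thesis"
  with that have "\<forall>D. F D \<longrightarrow> (\<exists>E. F E \<and> D \<subset> E)" by blast
  then obtain h where h: "\<And>D. F D \<Longrightarrow> F (h D) \<and> D \<subset> h D" by metis
  define C where "C = (\<lambda>n. (h ^^ n) I)"
  have F: "F (C n)" for n by (induction n) (auto simp: C_def assms(2) h)
  have lt: "C n \<subset> C (Suc n)" for n using h[OF F[of n]] by (simp add: C_def)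
  have "\<exists>k. \<forall>n\<ge>k. C n = C k"
    using assms(1,3) F lt unfolding ascending_chain_condition_def by (meson psubsetE)
  then show False using lt by (metis le_SucI order_refl psubsetE)
qed

lemma (in abelian_group) minus_eq_zero_iff:
  assumes "x \<in> carrier G" "y \<in> carrier G"
  shows "x \<ominus> y = \<zero> \<longleftrightarrow> x = y"
  using assms by (metis a_minus_def a_inv_closed minus_equality minus_minus r_neg)

text \<open>Negatives come from multiplication by \<open>\<ominus> \<one>\<close>. Right ideals are
  this predicate over \<open>opp_ring R\<close>, and since it refers to the ring record alone it
  also applies to \<open>neutral_component\<close>.\<close>

definition left_ideal :: "('a, 'b) ring_scheme \<Rightarrow> 'a set \<Rightarrow> bool" where
  "left_ideal R I \<longleftrightarrow> I \<subseteq> carrier R \<and> \<zero>\<^bsub>R\<^esub> \<in> I \<and> (\<forall>x\<in>I. \<forall>y\<in>I. x \<oplus>\<^bsub>R\<^esub> y \<in> I)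
     \<and> (\<forall>r\<in>carrier R. \<forall>x\<in>I. r \<otimes>\<^bsub>R\<^esub> x \<in> I)"

lemma left_idealI:
  assumes "I \<subseteq> carrier R" "\<zero>\<^bsub>R\<^esub> \<in> I" "\<And>x y. x \<in> I \<Longrightarrow> y \<in> I \<Longrightarrow> x \<oplus>\<^bsub>R\<^esub> y \<in> I"
    "\<And>r x. r \<in> carrier R \<Longrightarrow> x \<in> I \<Longrightarrow> r \<otimes>\<^bsub>R\<^esub> x \<in> I"
  shows "left_ideal R I"
  using assms unfolding left_ideal_def by blast

lemma left_idealD:
  assumes "left_ideal R I"
  shows "I \<subseteq> carrier R" "\<zero>\<^bsub>R\<^esub> \<in> I" "\<And>x y. x \<in> I \<Longrightarrow> y \<in> I \<Longrightarrow> x \<oplus>\<^bsub>R\<^esub> y \<in> I"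
    "\<And>r x. r \<in> carrier R \<Longrightarrow> x \<in> I \<Longrightarrow> r \<otimes>\<^bsub>R\<^esub> x \<in> I" "\<And>x. x \<in> I \<Longrightarrow> x \<in> carrier R"
  using assms unfolding left_ideal_def by blast+

lemma left_ideal_Int: "left_ideal R I \<Longrightarrow> left_ideal R K \<Longrightarrow> left_ideal R (I \<inter> K)"
  unfolding left_ideal_def by blast

context left_module
begin

lemma smult_l_null: assumes "x \<in> carrier M" shows "\<zero>\<^bsub>R\<^esub> \<odot>\<^bsub>M\<^esub> x = \<zero>\<^bsub>M\<^esub>"
proof -
  have "\<zero>\<^bsub>R\<^esub> \<odot>\<^bsub>M\<^esub> x \<oplus>\<^bsub>M\<^esub> \<zero>\<^bsub>R\<^esub> \<odot>\<^bsub>M\<^esub> x = \<zero>\<^bsub>R\<^esub> \<odot>\<^bsub>M\<^esub> x"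
    using smult_l_distr[of "\<zero>\<^bsub>R\<^esub>" "\<zero>\<^bsub>R\<^esub>" x] assms by simp
  then show ?thesis using smult_closed[OF R.zero_closed assms]
    by (metis M.add.r_cancel_one)
qed

lemma smult_r_null: assumes "a \<in> carrier R" shows "a \<odot>\<^bsub>M\<^esub> \<zero>\<^bsub>M\<^esub> = \<zero>\<^bsub>M\<^esub>"
proof -
  have "a \<odot>\<^bsub>M\<^esub> \<zero>\<^bsub>M\<^esub> \<oplus>\<^bsub>M\<^esub> a \<odot>\<^bsub>M\<^esub> \<zero>\<^bsub>M\<^esub> = a \<odot>\<^bsub>M\<^esub> \<zero>\<^bsub>M\<^esub>"
    using smult_r_distr[of a "\<zero>\<^bsub>M\<^esub>" "\<zero>\<^bsub>M\<^esub>"] assms by simp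
  then show ?thesis using smult_closed[OF assms M.zero_closed]
    by (metis M.add.r_cancel_one)
qed

lemma smult_l_minus:
  assumes "a \<in> carrier R" "x \<in> carrier M" shows "(\<ominus>\<^bsub>R\<^esub> a) \<odot>\<^bsub>M\<^esub> x = \<ominus>\<^bsub>M\<^esub> (a \<odot>\<^bsub>M\<^esub> x)"
proof -
  have "(\<ominus>\<^bsub>R\<^esub> a) \<odot>\<^bsub>M\<^esub> x \<oplus>\<^bsub>M\<^esub> a \<odot>\<^bsub>M\<^esub> x = \<zero>\<^bsub>M\<^esub>"
    using smult_l_distr[of "\<ominus>\<^bsub>R\<^esub> a" a x] assms by (simp add: R.l_neg smult_l_null)
  then show ?thesis using assms by (simp add: M.minus_equality smult_closed)
qed

lemma uminus_conv_smult: "x \<in> carrier M \<Longrightarrow> \<ominus>\<^bsub>M\<^esub> x = (\<ominus>\<^bsub>R\<^esub> \<one>\<^bsub>R\<^esub>) \<odot>\<^bsub>M\<^esub> x"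
  by (simp add: smult_l_minus smult_one)

lemma submodule_iff:
  "submodule H R M \<longleftrightarrow> H \<subseteq> carrier M \<and> \<zero>\<^bsub>M\<^esub> \<in> H \<and> (\<forall>x\<in>H. \<forall>y\<in>H. x \<oplus>\<^bsub>M\<^esub> y \<in> H)
     \<and> (\<forall>r\<in>carrier R. \<forall>x\<in>H. r \<odot>\<^bsub>M\<^esub> x \<in> H)" (is "?l \<longleftrightarrow> ?r")
proof
  assume ?l
  then interpret submodule H R M .
  show ?r using subset m_closed one_closed smult_closed by auto
next
  assume r: ?r
  show ?l
  proof (intro submodule.intro subgroup.intro submodule_axioms.intro)
    fix x assume "x \<in> H"
    then show "inv\<^bsub>add_monoid M\<^esub> x \<in> H"
      using r uminus_conv_smult[of x] by (auto simp: a_inv_def[symmetric])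
  qed (use r in auto)
qed

lemma smult_eq_iff:
  assumes "a \<in> carrier R" "b \<in> carrier R" "x \<in> carrier M"
  shows "a \<odot>\<^bsub>M\<^esub> x = b \<odot>\<^bsub>M\<^esub> x \<longleftrightarrow> (a \<ominus>\<^bsub>R\<^esub> b) \<odot>\<^bsub>M\<^esub> x = \<zero>\<^bsub>M\<^esub>"
proof -
  have "(a \<ominus>\<^bsub>R\<^esub> b) \<odot>\<^bsub>M\<^esub> x = a \<odot>\<^bsub>M\<^esub> x \<ominus>\<^bsub>M\<^esub> b \<odot>\<^bsub>M\<^esub> x"
    using assms by (simp add: R.minus_eq M.minus_eq smult_l_distr smult_l_minus)
  then show ?thesis using assms by (simp add: smult_closed M.minus_eq_zero_iff)
qed

end

section \<open>Maximal left ideals and the elementwise description of the radical\<close>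

context ring
begin

lemma left_reg_module: "left_module R (left_reg R)"
proof -
  have "abelian_group (left_reg R)"
    by (rule abelian_groupI) (auto simp: left_reg_def a_ac intro: l_neg a_inv_closed)
  then show ?thesis
    by (intro left_module.intro left_module_axioms.intro ring_axioms)
       (auto simp: left_reg_def m_assoc l_distr r_distr)
qed

lemma submodule_left_reg: "submodule I R (left_reg R) \<longleftrightarrow> left_ideal R I"
  unfolding left_module.submodule_iff[OF left_reg_module] left_ideal_def by (simp add: left_reg_def)

lemma left_ideal_uminus: assumes "left_ideal R I" "x \<in> I" shows "\<ominus> x \<in> I"
proof -
  have "(\<ominus> \<one>) \<otimes> x \<in> I" using left_idealD(4)[OF assms(1) _ assms(2)] by simp
  then show ?thesis using left_idealD(5)[OF assms] by (simp add: l_minus)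
qed

lemma left_ideal_minus: "left_ideal R I \<Longrightarrow> x \<in> I \<Longrightarrow> y \<in> I \<Longrightarrow> x \<ominus> y \<in> I"
  unfolding minus_eq by (meson left_ideal_uminus left_idealD(3))

lemma left_ideal_carrier: "left_ideal R (carrier R)"
  by (auto intro: left_idealI)

lemma left_ideal_one: "left_ideal R I \<Longrightarrow> \<one> \<in> I \<Longrightarrow> I = carrier R"
  using left_idealD(1,4)[of R I] by (metis r_one subsetI subset_antisym)

lemma left_ideal_sum:
  assumes "left_ideal R I" "left_ideal R K"
  shows "left_ideal R {x \<oplus> y | x y. x \<in> I \<and> y \<in> K}"
proof -
  note I = left_idealD[OF assms(1)] and K = left_idealD[OF assms(2)]
  show ?thesis
  proof (rule left_idealI; safe?)

    fix x y assume "x \<in> I" "y \<in> K"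
    then show "x \<oplus> y \<in> carrier R" using I(5) K(5) by simp
  next
    show "\<exists>x y. \<zero> = x \<oplus> y \<and> x \<in> I \<and> y \<in> K"
      using I(2) K(2) by (metis l_zero zero_closed)
  next
    fix x y x' y' assume *: "x \<in> I" "y \<in> K" "x' \<in> I" "y' \<in> K"
    then have c: "x \<in> carrier R" "y \<in> carrier R" "x' \<in> carrier R" "y' \<in> carrier R"
      using I(5) K(5) by blast+
    show "\<exists>a b. x \<oplus> y \<oplus> (x' \<oplus> y') = a \<oplus> b \<and> a \<in> I \<and> b \<in> K"
      apply (rule exI[of _ "x \<oplus> x'"], rule exI[of _ "y \<oplus> y'"])
      using c * I(3) K(3) by (simp add: a_ac)
  next
    fix r x y assume *: "r \<in> carrier R" "x \<in> I" "y \<in> K"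
    then have c: "x \<in> carrier R" "y \<in> carrier R" using I(5) K(5) by blast+
    show "\<exists>a b. r \<otimes> (x \<oplus> y) = a \<oplus> b \<and> a \<in> I \<and> b \<in> K"
      apply (rule exI[of _ "r \<otimes> x"], rule exI[of _ "r \<otimes> y"])
      using c * I(4) K(4) by (simp add: r_distr)
  qed
qed

lemma left_ideal_principal:
  assumes "a \<in> carrier R" shows "left_ideal R {r \<otimes> a | r. r \<in> carrier R}"
proof (rule left_idealI; safe?)
  show "\<exists>r. \<zero> = r \<otimes> a \<and> r \<in> carrier R" using assms by (metis l_null zero_closed)
next
  fix r t assume "r \<in> carrier R" "t \<in> carrier R"
  then show "\<exists>q. r \<otimes> a \<oplus> t \<otimes> a = q \<otimes> a \<and> q \<in> carrier R" "\<exists>q. r \<otimes> (t \<otimes> a) = q \<otimes> a \<and> q \<in> carrier R"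
    using assms by (metis l_distr a_closed, metis m_assoc m_closed)
qed (use assms in auto)

text \<open>For \<open>a\<close> outside \<open>m\<close> the sum of \<open>R a\<close> and
  \<open>m\<close> must be all of \<open>R\<close>, which is witnessed by a decomposition of
  \<open>\<one>\<close>. Later arguments work with the witnesses \<open>r\<close> and
  \<open>y\<close> instead of comparing ideals.\<close>

lemma maximal_left_ideal_iff:
  "maximal_left_ideal m R \<longleftrightarrow> left_ideal R m \<and> \<one> \<notin> m
     \<and> (\<forall>a\<in>carrier R - m. \<exists>r\<in>carrier R. \<exists>y\<in>m. \<one> = r \<otimes> a \<oplus> y)" (is "?l \<longleftrightarrow> ?r")
proof
  assume l: ?l
  then have m: "left_ideal R m" "m \<noteq> carrier R"
    and mx: "\<And>K. left_ideal R K \<Longrightarrow> m \<subseteq> K \<Longrightarrow> K = m \<or> K = carrier R"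
    unfolding maximal_left_ideal_def submodule_left_reg by auto
  have "\<exists>r\<in>carrier R. \<exists>y\<in>m. \<one> = r \<otimes> a \<oplus> y" if a: "a \<in> carrier R" "a \<notin> m" for a
  proof -
    let ?K = "{x \<oplus> y | x y. x \<in> {r \<otimes> a | r. r \<in> carrier R} \<and> y \<in> m}"
    have K: "left_ideal R ?K" using left_ideal_sum left_ideal_principal a(1) m(1) by blast
    have "m \<subseteq> ?K"
    proof
      fix y assume "y \<in> m"
      moreover then have "y = \<zero> \<otimes> a \<oplus> y" using a(1) left_idealD(5)[OF m(1)] by simp
      ultimately show "y \<in> ?K" using zero_closed by blast
    qed
    moreover have "a = \<one> \<otimes> a \<oplus> \<zero>" using a by simp
    then have "a \<in> ?K" using left_idealD(2)[OF m(1)] by blast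
    ultimately have "?K = carrier R" using mx[OF K] a by blast
    then have "\<one> \<in> ?K" by simp
    then show ?thesis by blast
  qed
  then show ?r using m left_ideal_one by blast
next
  assume r: ?r
  have "K = m \<or> K = carrier R" if K: "left_ideal R K" "m \<subseteq> K" for K
  proof (rule disjCI)
    assume "K \<noteq> carrier R"
    have "a \<in> m" if a: "a \<in> K" for a
    proof (rule ccontr)
      assume "a \<notin> m"
      then obtain r y where "r \<in> carrier R" "y \<in> m" "\<one> = r \<otimes> a \<oplus> y"
        using r a left_idealD(5)[OF K(1)] by blast
      then have "\<one> \<in> K" using K(2) a left_idealD(3,4)[OF K(1)] by auto
      then show False using left_ideal_one[OF K(1)] \<open>K \<noteq> carrier R\<close> by blast
    qed
    then show "K = m" using K by blast
  qed
  then show ?l using r unfolding maximal_left_ideal_def submodule_left_reg by auto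
qed

lemma maximal_left_idealD:
  assumes "maximal_left_ideal m R"
  shows "left_ideal R m" "\<one> \<notin> m"
    "\<And>a. a \<in> carrier R \<Longrightarrow> a \<notin> m \<Longrightarrow> \<exists>r\<in>carrier R. \<exists>y\<in>m. \<one> = r \<otimes> a \<oplus> y"
  using assms unfolding maximal_left_ideal_iff by blast+

lemma exists_maximal_left_ideal:
  assumes "left_ideal R I" "\<one> \<notin> I"
  obtains m where "maximal_left_ideal m R" "I \<subseteq> m"
proof -
  let ?A = "{K. left_ideal R K \<and> \<one> \<notin> K \<and> I \<subseteq> K}"
  have "\<exists>m\<in>?A. \<forall>K\<in>?A. m \<subseteq> K \<longrightarrow> K = m"
  proof (rule subset_Zorn_nonempty)
    fix C assume C: "C \<noteq> {}" "subset.chain ?A C"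
    then have CA: "C \<subseteq> ?A" and tot: "\<And>S T. S \<in> C \<Longrightarrow> T \<in> C \<Longrightarrow> S \<subseteq> T \<or> T \<subseteq> S"
      unfolding subset_chain_def by auto
    have "left_ideal R (\<Union>C)"
    proof (rule left_idealI)
      fix x y assume "x \<in> \<Union>C" "y \<in> \<Union>C"
      then obtain S T where "S \<in> C" "T \<in> C" "x \<in> S" "y \<in> T" by blast
      then show "x \<oplus> y \<in> \<Union>C" using tot[of S T] CA left_idealD(3)[of R S x y] left_idealD(3)[of R T x y] by blast
    qed (use C CA in \<open>auto dest: left_idealD\<close>)
    then show "\<Union>C \<in> ?A" using C CA by blast
  qed (use assms in auto)
  then obtain m where m: "left_ideal R m" "\<one> \<notin> m" "I \<subseteq> m"
    and mx: "\<And>K. left_ideal R K \<Longrightarrow> \<one> \<notin> K \<Longrightarrow> m \<subseteq> K \<Longrightarrow> K = m" by auto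
  have "maximal_left_ideal m R"
    unfolding maximal_left_ideal_def submodule_left_reg
    using m mx left_ideal_one by (metis one_closed order_trans)
  then show ?thesis using that m(3) by blast
qed

abbreviation "J \<equiv> jacobson_radical R"

lemma left_ideal_jacobson: "left_ideal R J"
  unfolding jacobson_radical_def
  by (rule left_idealI) (auto dest: maximal_left_idealD(1) left_idealD)

lemma jacobson_maximal: "x \<in> J \<Longrightarrow> maximal_left_ideal m R \<Longrightarrow> x \<in> m"
  unfolding jacobson_radical_def by blast

lemma jacobson_subset_maximal: "maximal_left_ideal m R \<Longrightarrow> J \<subseteq> m"
  unfolding jacobson_radical_def by blast

lemma not_jacobsonE:
  assumes "x \<in> carrier R" "x \<notin> J"
  obtains m where "maximal_left_ideal m R" "x \<notin> m"
  using assms unfolding jacobson_radical_def by blast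

text \<open>If \<open>c\<close> inverts \<open>\<one> \<ominus> a \<otimes> b\<close>, the formal
  geometric series suggests \<open>\<one> \<oplus> b \<otimes> (c \<otimes> a)\<close> as inverse of
  \<open>\<one> \<ominus> b \<otimes> a\<close>. This exchange is what makes the Jacobson radical
  left-right symmetric.\<close>

lemma one_minus_swap:
  assumes [simp]: "a \<in> carrier R" "b \<in> carrier R" and u: "\<one> \<ominus> a \<otimes> b \<in> Units R"
  shows "\<one> \<ominus> b \<otimes> a \<in> Units R"
proof -
  obtain c where [simp]: "c \<in> carrier R" and c: "c \<otimes> (\<one> \<ominus> a \<otimes> b) = \<one>" "(\<one> \<ominus> a \<otimes> b) \<otimes> c = \<one>"
    using u unfolding Units_def by blast
  have c1: "c = \<one> \<oplus> c \<otimes> (a \<otimes> b)"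
    using c(1) by (simp add: minus_eq r_distr r_minus) (metis (no_types) \<open>c \<in> carrier R\<close> a_assoc a_closed assms(1) assms(2) l_neg m_closed r_zero a_inv_closed)
  have c2: "c = \<one> \<oplus> (a \<otimes> b) \<otimes> c"
    using c(2) by (simp add: minus_eq l_distr l_minus) (metis (no_types) \<open>c \<in> carrier R\<close> a_assoc a_closed assms(1) assms(2) l_neg m_closed r_zero a_inv_closed)
  let ?d = "\<one> \<oplus> b \<otimes> (c \<otimes> a)"
  have "?d \<otimes> (\<one> \<ominus> b \<otimes> a) = \<one> \<oplus> b \<otimes> (c \<otimes> a) \<ominus> b \<otimes> ((\<one> \<oplus> c \<otimes> (a \<otimes> b)) \<otimes> a)"
    by (simp add: m_assoc l_distr r_distr minus_eq l_minus r_minus minus_add a_ac)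
  also have "\<dots> = \<one> \<oplus> b \<otimes> (c \<otimes> a) \<ominus> b \<otimes> (c \<otimes> a)" by (simp flip: c1)
  finally have 1: "?d \<otimes> (\<one> \<ominus> b \<otimes> a) = \<one>" by (simp add: minus_eq a_assoc r_neg)
  have "(\<one> \<ominus> b \<otimes> a) \<otimes> ?d = \<one> \<oplus> b \<otimes> (c \<otimes> a) \<ominus> b \<otimes> ((\<one> \<oplus> (a \<otimes> b) \<otimes> c) \<otimes> a)"
    by (simp add: m_assoc l_distr r_distr minus_eq l_minus r_minus minus_add a_ac)
  also have "\<dots> = \<one> \<oplus> b \<otimes> (c \<otimes> a) \<ominus> b \<otimes> (c \<otimes> a)" by (simp flip: c2)
  finally have 2: "(\<one> \<ominus> b \<otimes> a) \<otimes> ?d = \<one>" by (simp add: minus_eq a_assoc r_neg)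
  show ?thesis unfolding Units_def using 1 2 by (auto intro!: bexI[of _ ?d])
qed

text \<open>If the left ideal generated by \<open>\<one> \<ominus> x\<close> were proper, some
  maximal left ideal would contain both it and \<open>x\<close>, hence
  \<open>\<one>\<close>.\<close>

lemma jacobson_left_inverse:
  assumes "x \<in> J" shows "\<exists>u\<in>carrier R. u \<otimes> (\<one> \<ominus> x) = \<one>"
proof (rule ccontr)
  have x: "x \<in> carrier R" using assms left_idealD(5)[OF left_ideal_jacobson] by blast
  let ?I = "{r \<otimes> (\<one> \<ominus> x) | r. r \<in> carrier R}"
  assume "\<not> ?thesis"
  then have "\<one> \<notin> ?I" by (auto dest: sym)
  then obtain m where m: "maximal_left_ideal m R" "?I \<subseteq> m"
    using exists_maximal_left_ideal[of ?I] left_ideal_principal[of "\<one> \<ominus> x"] x by (metis (no_types, lifting) minus_closed one_closed)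
  have "\<one> \<otimes> (\<one> \<ominus> x) \<in> m" using m(2) by blast
  then have "(\<one> \<ominus> x) \<oplus> x \<in> m"
    using jacobson_maximal[OF assms m(1)] left_idealD(3)[OF maximal_left_idealD(1)[OF m(1)]] x by simp
  then show False using maximal_left_idealD(2)[OF m(1)] x by (simp add: minus_eq a_assoc l_neg)
qed

text \<open>A left inverse \<open>u\<close> of \<open>\<one> \<ominus> x\<close> equals
  \<open>\<one> \<oplus> u \<otimes> x\<close>, again one minus an element of \<open>J\<close>. It
  therefore has a left inverse itself, and so is a two-sided inverse.\<close>

lemma jacobson_unit:
  assumes "x \<in> J" shows "\<one> \<ominus> x \<in> Units R"
proof -
  have x: "x \<in> carrier R" using assms left_idealD(5)[OF left_ideal_jacobson] by blast
  obtain u where u: "u \<in> carrier R" "u \<otimes> (\<one> \<ominus> x) = \<one>" using jacobson_left_inverse[OF assms] by blast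
  have ux: "\<ominus> (u \<otimes> x) \<in> J"
    by (intro left_ideal_uminus left_idealD(4)[OF left_ideal_jacobson] left_ideal_jacobson assms u(1))
  have eq: "u = \<one> \<ominus> (\<ominus> (u \<otimes> x))"
    using u x by (simp add: minus_eq r_distr r_minus) (metis a_assoc a_inv_closed l_neg m_closed r_zero)
  obtain v where v: "v \<in> carrier R" "v \<otimes> u = \<one>" using jacobson_left_inverse[OF ux] eq by metis
  have "v = \<one> \<ominus> x" using u v x by (metis inv_unique minus_closed one_closed)
  then show ?thesis unfolding Units_def using u v x by auto
qed

text \<open>Units do not distinguish left from right, so together with \<open>one_minus_swap\<close>
  this description transfers to the opposite ring.\<close>

lemma jacobson_iff:
  "x \<in> J \<longleftrightarrow> x \<in> carrier R \<and> (\<forall>r\<in>carrier R. \<one> \<ominus> r \<otimes> x \<in> Units R)"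
proof
  assume "x \<in> J"
  then show "x \<in> carrier R \<and> (\<forall>r\<in>carrier R. \<one> \<ominus> r \<otimes> x \<in> Units R)"
    using left_idealD(4,5)[OF left_ideal_jacobson] jacobson_unit by blast
next
  assume r: "x \<in> carrier R \<and> (\<forall>r\<in>carrier R. \<one> \<ominus> r \<otimes> x \<in> Units R)"
  have "x \<in> m" if m: "maximal_left_ideal m R" for m
  proof (rule ccontr)
    assume "x \<notin> m"
    then obtain a y where a: "a \<in> carrier R" "y \<in> m" "\<one> = a \<otimes> x \<oplus> y"
      using maximal_left_idealD(3)[OF m] r by blast
    have y: "y \<in> carrier R" using a(2) left_idealD(5)[OF maximal_left_idealD(1)[OF m]] by blast
    have "y = \<one> \<ominus> a \<otimes> x" unfolding a(3) using a(1) y r by (simp add: minus_eq a_ac l_neg r_neg)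
    then have "y \<in> Units R" using r a(1) by blast
    then obtain z where "z \<in> carrier R" "z \<otimes> y = \<one>" unfolding Units_def by blast
    then have "\<one> \<in> m" using a(2) left_idealD(4)[OF maximal_left_idealD(1)[OF m]] by metis
    then show False using m maximal_left_idealD(2) by blast
  qed
  then show "x \<in> J" using r unfolding jacobson_radical_def by blast
qed

end

section \<open>The opposite ring and the symmetry of the radical\<close>

lemma opp_ring_simps [simp]:
  "carrier (opp_ring R) = carrier R" "add (opp_ring R) = add R" "ring.zero (opp_ring R) = ring.zero R"
  "one (opp_ring R) = one R" "x \<otimes>\<^bsub>opp_ring R\<^esub> y = y \<otimes>\<^bsub>R\<^esub> x" "opp_ring (opp_ring R) = R"
  "a_inv (opp_ring R) x = a_inv R x" "x \<ominus>\<^bsub>opp_ring R\<^esub> y = x \<ominus>\<^bsub>R\<^esub> y"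
  by (simp_all add: opp_ring_def a_inv_def a_minus_def)

context ring
begin

lemma opp_ring_ring: "ring (opp_ring R)"
  by (rule ringI)
     (auto intro!: abelian_groupI monoidI simp: a_ac m_assoc l_distr r_distr intro: l_neg a_inv_closed)

lemma Units_opp: "Units (opp_ring R) = Units R"
  unfolding Units_def by auto

lemma jacobson_opp: "jacobson_radical (opp_ring R) = J"
proof -
  have "x \<in> jacobson_radical (opp_ring R) \<longleftrightarrow> x \<in> J" for x
    unfolding ring.jacobson_iff[OF opp_ring_ring] jacobson_iff Units_opp
    using one_minus_swap by auto
  then show ?thesis by blast
qed

lemma left_ideal_opp_jacobson: "left_ideal (opp_ring R) J"
  using ring.left_ideal_jacobson[OF opp_ring_ring] unfolding jacobson_opp .

lemma jacobson_r_closed: "x \<in> J \<Longrightarrow> r \<in> carrier R \<Longrightarrow> x \<otimes> r \<in> J"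
  using left_idealD(4)[OF left_ideal_opp_jacobson] by simp

lemma jacobson_l_closed: "x \<in> J \<Longrightarrow> r \<in> carrier R \<Longrightarrow> r \<otimes> x \<in> J"
  using left_idealD(4)[OF left_ideal_jacobson] by simp

lemma jacobson_carrier: "x \<in> J \<Longrightarrow> x \<in> carrier R"
  using left_idealD(5)[OF left_ideal_jacobson] .

end

section \<open>Rings and modules over the radical of an Artinian ring\<close>

locale left_artinian_ring = ring R for R (structure) +
  assumes dcc: "descending_chain_condition (left_ideal R)"
begin

text \<open>Modulo \<open>J\<close> the ring is semisimple, so \<open>I\<close> has a complement
  there. The component of \<open>\<one>\<close> in that complement is \<open>e\<close>, an
  idempotent up to \<open>J\<close> whose left annihilator modulo \<open>J\<close> is
  \<open>I\<close>.\<close>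

lemma split_over_jacobson:
  assumes I: "left_ideal R I" "J \<subseteq> I"
  shows "\<exists>e\<in>carrier R. \<one> \<ominus> e \<in> I \<and> (\<forall>y\<in>I. y \<otimes> e \<in> J) \<and> e \<ominus> e \<otimes> e \<in> J"
proof -
  note Ic = left_idealD[OF I(1)]
  \<comment> \<open>A left ideal \<open>D\<close> minimal with \<open>D + I = R\<close> is a complement of \<open>I\<close> modulo the radical.\<close>
  let ?F = "\<lambda>D. left_ideal R D \<and> J \<subseteq> D \<and> (\<exists>d\<in>D. \<one> \<ominus> d \<in> I)"
  have "\<one> \<ominus> \<one> \<in> I" using Ic(2) by (simp add: minus_eq r_neg)
  then have F0: "?F (carrier R)" using left_ideal_carrier jacobson_carrier by blast
  obtain D where D: "?F D" and mn: "\<And>E. ?F E \<Longrightarrow> E \<subseteq> D \<Longrightarrow> E = D"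
    using dcc_minimal[where F = ?F, OF dcc F0] by blast
  then obtain e where e: "e \<in> D" "\<one> \<ominus> e \<in> I" and Dl: "left_ideal R D" by blast
  note Dc = left_idealD[OF Dl]
  have ec: "e \<in> carrier R" using e Dc by blast
  \<comment> \<open>An element of \<open>D\<close> and \<open>I\<close> outside \<open>J\<close> is
    missed by some maximal \<open>n\<close>. Subtracting \<open>e \<otimes> r \<otimes> x\<close>
    from \<open>e\<close> gives \<open>e \<otimes> y\<close> in \<open>D \<inter> n\<close>, which
    still supplements \<open>I\<close> and contradicts the minimality of \<open>D\<close>.\<close>
  have DI: "x \<in> J" if x: "x \<in> D" "x \<in> I" for x
  proof (rule ccontr)
    have xc: "x \<in> carrier R" using x Dc by blast
    assume "x \<notin> J"
    then obtain n where n: "maximal_left_ideal n R" "x \<notin> n" using not_jacobsonE xc by blast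
    note nc = left_idealD[OF maximal_left_idealD(1)[OF n(1)]]
    obtain r y where ry: "r \<in> carrier R" "y \<in> n" "\<one> = r \<otimes> x \<oplus> y"
      using maximal_left_idealD(3)[OF n(1) xc n(2)] by blast
    have yc: "y \<in> carrier R" using nc ry by blast
    have "e = e \<otimes> (r \<otimes> x \<oplus> y)" using ec ry(3) by (metis r_one)
    then have eq: "e = e \<otimes> r \<otimes> x \<oplus> e \<otimes> y" using ec ry(1) xc yc by (simp add: r_distr m_assoc)
    have erx: "e \<otimes> r \<otimes> x \<in> D" "e \<otimes> r \<otimes> x \<in> I" using Dc(4) Ic(4) x ec ry(1) by auto
    have ey: "e \<otimes> y = e \<ominus> e \<otimes> r \<otimes> x" by (subst (2) eq) (use ec ry(1) xc yc in algebra)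
    have "e \<otimes> y \<in> D" unfolding ey using left_ideal_minus[OF Dl e(1) erx(1)] .
    moreover have "e \<otimes> y \<in> n" using nc(4) ec ry(2) by blast
    moreover have "\<one> \<ominus> e \<otimes> y = (\<one> \<ominus> e) \<oplus> e \<otimes> r \<otimes> x" unfolding ey using ec ry(1) xc by algebra
    then have "\<one> \<ominus> e \<otimes> y \<in> I" using Ic(3) e(2) erx(2) by simp
    ultimately have "?F (D \<inter> n)"
      using left_ideal_Int[OF Dl maximal_left_idealD(1)[OF n(1)]] D jacobson_subset_maximal[OF n(1)] by blast
    then have "D \<inter> n = D" using mn by blast
    then show False using x n by blast
  qed
  have ye: "y \<otimes> e \<in> J" if y: "y \<in> I" for y
  proof (rule DI)
    have yc: "y \<in> carrier R" using y Ic by blast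
    show "y \<otimes> e \<in> D" using Dc(4) yc e by blast
    have "y \<otimes> e = y \<ominus> y \<otimes> (\<one> \<ominus> e)" using yc ec r_one[of y] by algebra
    then show "y \<otimes> e \<in> I" using left_ideal_minus[OF I(1) y] Ic(4)[OF yc e(2)] by simp
  qed
  have "e \<ominus> e \<otimes> e = (\<one> \<ominus> e) \<otimes> e" using ec by algebra
  then show ?thesis using ec e(2) ye ye[OF e(2)] by (intro bexI[of _ e]) simp_all
qed

text \<open>Split over the sum of \<open>R a\<close> and \<open>J\<close>: the element
  \<open>\<one> \<ominus> e\<close> is \<open>w \<otimes> a\<close> up to \<open>J\<close>, while
  \<open>a \<otimes> e\<close> lies in \<open>J\<close>. Multiplying by \<open>a\<close> shows that
  \<open>a \<otimes> w \<otimes> a\<close> agrees with \<open>a\<close> up to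
  \<open>J\<close>.\<close>

lemma regular_mod_jacobson:
  assumes a: "a \<in> carrier R"
  obtains w where "w \<in> carrier R" "a \<ominus> a \<otimes> w \<otimes> a \<in> J"
proof -
  let ?I = "{x \<oplus> y | x y. x \<in> {r \<otimes> a | r. r \<in> carrier R} \<and> y \<in> J}"
  have I: "left_ideal R ?I" by (intro left_ideal_sum left_ideal_principal left_ideal_jacobson a)
  have JI: "J \<subseteq> ?I"
  proof
    fix x assume "x \<in> J"
    moreover then have "x = \<zero> \<otimes> a \<oplus> x" using a jacobson_carrier by simp
    ultimately show "x \<in> ?I" by blast
  qed
  obtain e where e: "e \<in> carrier R" "\<one> \<ominus> e \<in> ?I" "\<And>y. y \<in> ?I \<Longrightarrow> y \<otimes> e \<in> J"
      "e \<ominus> e \<otimes> e \<in> J"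
    using split_over_jacobson[OF I JI] by blast
  have "a = \<one> \<otimes> a \<oplus> \<zero>" using a by simp
  then have "a \<in> ?I" using left_idealD(2)[OF left_ideal_jacobson] by blast
  then have ae: "a \<otimes> e \<in> J" by (rule e(3))
  from e(2) obtain w j where w: "w \<in> carrier R" "j \<in> J" "\<one> \<ominus> e = w \<otimes> a \<oplus> j" by blast
  have jc: "j \<in> carrier R" using w jacobson_carrier by blast
  have "a \<ominus> a \<otimes> w \<otimes> a = a \<otimes> (\<one> \<ominus> e) \<oplus> a \<otimes> e \<ominus> a \<otimes> w \<otimes> a" unfolding w(3)[symmetric] using a e(1) w(1) r_one[of a] by algebra
  also have "\<dots> = a \<otimes> e \<oplus> a \<otimes> j" unfolding w(3) using a e(1) w(1) jc by algebra
  finally show ?thesis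
    using that[OF w(1)] left_idealD(3)[OF left_ideal_jacobson ae] jacobson_l_closed[OF w(2) a] by simp
qed

text \<open>Among the left ideals \<open>R v + J\<close> with \<open>v\<close> right invertible
  modulo \<open>J\<close>, take a minimal one. Replacing \<open>v\<close> by
  \<open>u \<otimes> v\<close> stays in the family and goes down, so \<open>v\<close> is a multiple
  of \<open>u \<otimes> v\<close> modulo \<open>J\<close>; cancelling \<open>v\<close> on the right
  leaves a left inverse \<open>b\<close> of \<open>u\<close>.\<close>

lemma dedekind_finite_mod_jacobson:
  assumes uw: "u \<in> carrier R" "w \<in> carrier R" "\<one> \<ominus> u \<otimes> w \<in> J"
  shows "\<one> \<ominus> w \<otimes> u \<in> J"
proof -
  note Jm = left_ideal_minus[OF left_ideal_jacobson] and Ja = left_idealD(3)[OF left_ideal_jacobson]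
  let ?K = "\<lambda>v. {x \<in> carrier R. \<exists>b\<in>carrier R. x \<ominus> b \<otimes> v \<in> J}"
  have K: "left_ideal R (?K v)" if v: "v \<in> carrier R" for v
  proof (rule left_idealI; safe?)
    show "\<exists>b\<in>carrier R. \<zero> \<ominus> b \<otimes> v \<in> J"
      using v left_idealD(2)[OF left_ideal_jacobson] by (intro bexI[of _ \<zero>]) (auto simp: minus_eq)
  next
    fix x y a b assume *: "x \<in> carrier R" "y \<in> carrier R" "a \<in> carrier R" "b \<in> carrier R"
      "x \<ominus> a \<otimes> v \<in> J" "y \<ominus> b \<otimes> v \<in> J"
    have "x \<oplus> y \<ominus> (a \<oplus> b) \<otimes> v = (x \<ominus> a \<otimes> v) \<oplus> (y \<ominus> b \<otimes> v)" using * v by algebra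
    then show "\<exists>c\<in>carrier R. x \<oplus> y \<ominus> c \<otimes> v \<in> J" using Ja[OF *(5,6)] * by (metis a_closed)
  next
    fix r x a assume *: "r \<in> carrier R" "x \<in> carrier R" "a \<in> carrier R" "x \<ominus> a \<otimes> v \<in> J"
    have "r \<otimes> x \<ominus> (r \<otimes> a) \<otimes> v = r \<otimes> (x \<ominus> a \<otimes> v)" using * v by algebra
    then show "\<exists>c\<in>carrier R. r \<otimes> x \<ominus> c \<otimes> v \<in> J" using jacobson_l_closed[OF *(4,1)] * by (metis m_closed)
  qed auto
  let ?F = "\<lambda>D. \<exists>v\<in>carrier R. \<exists>z\<in>carrier R. \<one> \<ominus> v \<otimes> z \<in> J \<and> D = ?K v"
  have F0: "?F (?K u)" using uw by blast
  obtain D where D: "?F D" and mn: "\<And>E. ?F E \<Longrightarrow> E \<subseteq> D \<Longrightarrow> E = D"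
    using dcc_minimal[where F = ?F, OF dcc F0] K by blast
  then obtain v z where vz: "v \<in> carrier R" "z \<in> carrier R" "\<one> \<ominus> v \<otimes> z \<in> J" "D = ?K v" by blast
  have uv: "u \<otimes> v \<in> carrier R" "z \<otimes> w \<in> carrier R" using uw vz by auto
  have "\<one> \<ominus> (u \<otimes> v) \<otimes> (z \<otimes> w) = (\<one> \<ominus> u \<otimes> w) \<oplus> u \<otimes> ((\<one> \<ominus> v \<otimes> z) \<otimes> w)" using uw vz by algebra
  then have "\<one> \<ominus> (u \<otimes> v) \<otimes> (z \<otimes> w) \<in> J"
    using Ja uw vz jacobson_l_closed jacobson_r_closed by simp
  then have F: "?F (?K (u \<otimes> v))" using uv by blast
  have "?K (u \<otimes> v) \<subseteq> D"
  proof
    fix x assume "x \<in> ?K (u \<otimes> v)"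
    then obtain b where b: "x \<in> carrier R" "b \<in> carrier R" "x \<ominus> b \<otimes> (u \<otimes> v) \<in> J" by blast
    then have "x \<ominus> (b \<otimes> u) \<otimes> v \<in> J" using uw vz by (simp add: m_assoc)
    then show "x \<in> D" unfolding vz(4) using b uw by blast
  qed
  then have "?K (u \<otimes> v) = ?K v" using mn[OF F] vz(4) by simp
  moreover have "v \<ominus> \<one> \<otimes> v \<in> J" using vz left_idealD(2)[OF left_ideal_jacobson] by (simp add: minus_eq r_neg)
  then have "v \<in> ?K v" using vz by blast
  ultimately obtain b where b: "b \<in> carrier R" "v \<ominus> b \<otimes> (u \<otimes> v) \<in> J" by blast
  have "\<one> \<ominus> b \<otimes> u = (\<one> \<ominus> v \<otimes> z) \<oplus> (v \<ominus> b \<otimes> (u \<otimes> v)) \<otimes> z \<ominus> (b \<otimes> u) \<otimes> (\<one> \<ominus> v \<otimes> z)"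
    using b uw vz r_one[of u] by algebra
  then have bu: "\<one> \<ominus> b \<otimes> u \<in> J"
    using Jm Ja b uw vz jacobson_l_closed jacobson_r_closed by simp
  \<comment> \<open>Modulo \<open>J\<close> this is the usual comparison of the left inverse
    \<open>b\<close> with the right inverse \<open>w\<close>.\<close>
  have "\<one> \<ominus> w \<otimes> u = (\<one> \<ominus> b \<otimes> u) \<ominus> ((\<one> \<ominus> b \<otimes> u) \<otimes> w) \<otimes> u \<oplus> b \<otimes> (\<one> \<ominus> u \<otimes> w) \<otimes> u"
    using b uw by algebra
  then show ?thesis using Jm Ja b bu uw jacobson_l_closed jacobson_r_closed by simp
qed

end

section \<open>Simple submodules, annihilators and the socle\<close>

context left_module
begin

abbreviation J where "J \<equiv> jacobson_radical R"

abbreviation cyc :: "'m \<Rightarrow> 'm set" where "cyc x \<equiv> {r \<odot>\<^bsub>M\<^esub> x | r. r \<in> carrier R}"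
abbreviation ann :: "'m \<Rightarrow> 'a set" where "ann x \<equiv> {r \<in> carrier R. r \<odot>\<^bsub>M\<^esub> x = \<zero>\<^bsub>M\<^esub>}"

lemma ann_left_ideal: "x \<in> carrier M \<Longrightarrow> left_ideal R (ann x)"
  by (rule left_idealI) (auto simp: smult_l_null smult_l_distr smult_assoc smult_r_null)

lemma submodule_cyc: assumes "x \<in> carrier M" shows "submodule (cyc x) R M"
  unfolding submodule_iff
proof (intro conjI ballI; safe?)
  show "\<exists>r. \<zero>\<^bsub>M\<^esub> = r \<odot>\<^bsub>M\<^esub> x \<and> r \<in> carrier R"
    using assms by (metis smult_l_null R.zero_closed)
next
  fix r t assume "r \<in> carrier R" "t \<in> carrier R"
  then show "\<exists>q. r \<odot>\<^bsub>M\<^esub> x \<oplus>\<^bsub>M\<^esub> t \<odot>\<^bsub>M\<^esub> x = q \<odot>\<^bsub>M\<^esub> x \<and> q \<in> carrier R"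
    "\<exists>q. r \<odot>\<^bsub>M\<^esub> (t \<odot>\<^bsub>M\<^esub> x) = q \<odot>\<^bsub>M\<^esub> x \<and> q \<in> carrier R"
    using assms by (metis smult_l_distr R.a_closed, metis smult_assoc R.m_closed)
qed (use assms smult_closed in auto)

lemma mem_cyc: "x \<in> carrier M \<Longrightarrow> x \<in> cyc x"
  using smult_one R.one_closed by (metis (mono_tags, lifting) mem_Collect_eq)

text \<open>The cyclic module of \<open>x\<close> is \<open>R\<close> modulo \<open>ann x\<close>,
  so its submodules correspond to the left ideals above the annihilator. This allows simple
  submodules to be handled through single elements.\<close>

lemma simple_cyc_iff:
  assumes x: "x \<in> carrier M"
  shows "simple_submodule (cyc x) R M \<longleftrightarrow> maximal_left_ideal (ann x) R"
proof
  assume s: "simple_submodule (cyc x) R M"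
  then have "cyc x \<noteq> {\<zero>\<^bsub>M\<^esub>}" and
    T: "\<And>T. submodule T R M \<Longrightarrow> T \<subseteq> cyc x \<Longrightarrow> T = {\<zero>\<^bsub>M\<^esub>} \<or> T = cyc x"
    unfolding simple_submodule_def by blast+
  then have "x \<noteq> \<zero>\<^bsub>M\<^esub>" by (auto simp: smult_r_null) (metis R.zero_closed smult_r_null)
  then have "\<one>\<^bsub>R\<^esub> \<notin> ann x" using x smult_one by simp
  moreover have "\<exists>r\<in>carrier R. \<exists>y\<in>ann x. \<one>\<^bsub>R\<^esub> = r \<otimes>\<^bsub>R\<^esub> a \<oplus>\<^bsub>R\<^esub> y" if a: "a \<in> carrier R" "a \<notin> ann x" for a
  proof -
    have ax: "a \<odot>\<^bsub>M\<^esub> x \<in> carrier M" "a \<odot>\<^bsub>M\<^esub> x \<noteq> \<zero>\<^bsub>M\<^esub>" using a x smult_closed by auto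
    have "cyc (a \<odot>\<^bsub>M\<^esub> x) \<subseteq> cyc x" using a x by (auto simp: smult_assoc[symmetric])
    then have "cyc (a \<odot>\<^bsub>M\<^esub> x) = cyc x" using T[OF submodule_cyc[OF ax(1)]] mem_cyc[OF ax(1)] ax(2) by blast
    then obtain r where r: "r \<in> carrier R" "x = r \<odot>\<^bsub>M\<^esub> (a \<odot>\<^bsub>M\<^esub> x)" using mem_cyc[OF x] by blast
    have "\<one>\<^bsub>R\<^esub> \<odot>\<^bsub>M\<^esub> x = (r \<otimes>\<^bsub>R\<^esub> a) \<odot>\<^bsub>M\<^esub> x" using r a x by (simp add: smult_assoc smult_one)
    then have "\<one>\<^bsub>R\<^esub> \<ominus>\<^bsub>R\<^esub> r \<otimes>\<^bsub>R\<^esub> a \<in> ann x" using r a x by (subst (asm) smult_eq_iff) auto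
    moreover have "\<one>\<^bsub>R\<^esub> = r \<otimes>\<^bsub>R\<^esub> a \<oplus>\<^bsub>R\<^esub> (\<one>\<^bsub>R\<^esub> \<ominus>\<^bsub>R\<^esub> r \<otimes>\<^bsub>R\<^esub> a)"
      using r a by (simp add: R.minus_eq R.a_lcomm R.r_neg)
    ultimately show ?thesis using r(1) by blast
  qed
  ultimately show "maximal_left_ideal (ann x) R"
    unfolding R.maximal_left_ideal_iff using ann_left_ideal[OF x] by blast
next
  assume m: "maximal_left_ideal (ann x) R"
  have "x \<noteq> \<zero>\<^bsub>M\<^esub>" using R.maximal_left_idealD(2)[OF m] by (auto simp: smult_r_null)
  have "T = {\<zero>\<^bsub>M\<^esub>} \<or> T = cyc x" if T: "submodule T R M" "T \<subseteq> cyc x" for T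
  proof (rule disjCI)
    note Tc = T(1)[unfolded submodule_iff]
    assume "T \<noteq> cyc x"
    have "t = \<zero>\<^bsub>M\<^esub>" if t: "t \<in> T" for t
    proof (rule ccontr)
      assume "t \<noteq> \<zero>\<^bsub>M\<^esub>"
      obtain a where a: "a \<in> carrier R" "t = a \<odot>\<^bsub>M\<^esub> x" using t T by blast
      then have "a \<notin> ann x" using \<open>t \<noteq> \<zero>\<^bsub>M\<^esub>\<close> by simp
      then obtain r y where r: "r \<in> carrier R" "y \<in> carrier R" "y \<odot>\<^bsub>M\<^esub> x = \<zero>\<^bsub>M\<^esub>" "\<one>\<^bsub>R\<^esub> = r \<otimes>\<^bsub>R\<^esub> a \<oplus>\<^bsub>R\<^esub> y"
        using R.maximal_left_idealD(3)[OF m a(1)] by blast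
      have "x = (r \<otimes>\<^bsub>R\<^esub> a \<oplus>\<^bsub>R\<^esub> y) \<odot>\<^bsub>M\<^esub> x" using x smult_one by (simp flip: r(4))
      then have "x = r \<odot>\<^bsub>M\<^esub> t" using r a x smult_closed by (simp add: smult_l_distr smult_assoc)
      then have "x \<in> T" using Tc r t by blast
      then have "cyc x \<subseteq> T" using Tc by blast
      then show False using T \<open>T \<noteq> cyc x\<close> by blast
    qed
    then show "T = {\<zero>\<^bsub>M\<^esub>}" using Tc by blast
  qed
  then show "simple_submodule (cyc x) R M"
    unfolding simple_submodule_def using submodule_cyc[OF x] mem_cyc[OF x] \<open>x \<noteq> \<zero>\<^bsub>M\<^esub>\<close> by blast
qed

lemma simple_submodule_cyc:
  assumes "simple_submodule S R M" "x \<in> S" "x \<noteq> \<zero>\<^bsub>M\<^esub>"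
  shows "S = cyc x" "x \<in> carrier M"
proof -
  note S = assms(1)[unfolded simple_submodule_def]
  note Sc = S[THEN conjunct1, unfolded submodule_iff]
  show x: "x \<in> carrier M" using Sc assms by blast
  have "cyc x \<subseteq> S" using Sc assms(2) by blast
  then have "cyc x = {\<zero>\<^bsub>M\<^esub>} \<or> cyc x = S" using S submodule_cyc[OF x] by blast
  then show "S = cyc x" using mem_cyc[OF x] assms(3) by blast
qed

lemma maximal_ann:
  assumes "simple_submodule S R M" "x \<in> S" "x \<noteq> \<zero>\<^bsub>M\<^esub>" shows "maximal_left_ideal (ann x) R"
  using simple_submodule_cyc[OF assms] assms(1) simple_cyc_iff[of x] by simp

text \<open>The chain condition is used in \<open>R\<close>, the module being arbitrary. If
  \<open>D\<close> is minimal among the left ideals not killing \<open>x\<close>, then for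
  \<open>b\<close> in \<open>D\<close> and \<open>a\<close> with \<open>a b x\<close> nonzero the
  left ideal of \<open>a b\<close> is \<open>D\<close> again, so \<open>b\<close> can be recovered
  from \<open>a b\<close>.\<close>

lemma exists_maximal_ann:
  assumes dcc: "descending_chain_condition (left_ideal R)" and x: "x \<in> carrier M" "x \<noteq> \<zero>\<^bsub>M\<^esub>"
  obtains b where "b \<in> carrier R" "maximal_left_ideal (ann (b \<odot>\<^bsub>M\<^esub> x)) R"
proof -
  let ?F = "\<lambda>D. left_ideal R D \<and> (\<exists>d\<in>D. d \<odot>\<^bsub>M\<^esub> x \<noteq> \<zero>\<^bsub>M\<^esub>)"
  have F0: "?F (carrier R)" using R.left_ideal_carrier x smult_one R.one_closed by metis
  obtain D where D: "?F D" and mn: "\<And>E. ?F E \<Longrightarrow> E \<subseteq> D \<Longrightarrow> E = D"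
    using dcc_minimal[where F = ?F, OF dcc F0] by blast
  then obtain b where b: "b \<in> D" "b \<odot>\<^bsub>M\<^esub> x \<noteq> \<zero>\<^bsub>M\<^esub>" by blast
  note Dc = left_idealD[OF D[THEN conjunct1]]
  have bc: "b \<in> carrier R" using b Dc by blast
  have bx: "b \<odot>\<^bsub>M\<^esub> x \<in> carrier M" using bc x smult_closed by blast
  have "maximal_left_ideal (ann (b \<odot>\<^bsub>M\<^esub> x)) R"
    unfolding R.maximal_left_ideal_iff
  proof (intro conjI ballI ann_left_ideal bx)
    show "\<one>\<^bsub>R\<^esub> \<notin> ann (b \<odot>\<^bsub>M\<^esub> x)" using b bx smult_one by simp
    fix a assume a: "a \<in> carrier R - ann (b \<odot>\<^bsub>M\<^esub> x)"
    let ?E = "{r \<otimes>\<^bsub>R\<^esub> (a \<otimes>\<^bsub>R\<^esub> b) | r. r \<in> carrier R}"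
    have ab: "a \<otimes>\<^bsub>R\<^esub> b \<in> carrier R" using a bc by simp
    have "\<one>\<^bsub>R\<^esub> \<otimes>\<^bsub>R\<^esub> (a \<otimes>\<^bsub>R\<^esub> b) \<in> ?E" by blast
    moreover have "(\<one>\<^bsub>R\<^esub> \<otimes>\<^bsub>R\<^esub> (a \<otimes>\<^bsub>R\<^esub> b)) \<odot>\<^bsub>M\<^esub> x \<noteq> \<zero>\<^bsub>M\<^esub>" using a bc ab x by (simp add: smult_assoc)
    ultimately have "?F ?E" using R.left_ideal_principal[OF ab] by blast
    moreover have "?E \<subseteq> D" using Dc(4) a b by blast
    ultimately have "?E = D" by (rule mn)
    then obtain r where r: "r \<in> carrier R" "b = r \<otimes>\<^bsub>R\<^esub> (a \<otimes>\<^bsub>R\<^esub> b)" using b by blast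
    have "(\<one>\<^bsub>R\<^esub> \<ominus>\<^bsub>R\<^esub> r \<otimes>\<^bsub>R\<^esub> a) \<otimes>\<^bsub>R\<^esub> b = b \<ominus>\<^bsub>R\<^esub> r \<otimes>\<^bsub>R\<^esub> (a \<otimes>\<^bsub>R\<^esub> b)" using r(1) DiffD1[OF a] bc by algebra
    also have "\<dots> = \<zero>\<^bsub>R\<^esub>" using r(2) bc by (simp add: R.minus_eq R.r_neg)
    finally have "\<one>\<^bsub>R\<^esub> \<ominus>\<^bsub>R\<^esub> r \<otimes>\<^bsub>R\<^esub> a \<in> ann (b \<odot>\<^bsub>M\<^esub> x)"
      using r(1) a bc x by (simp add: smult_assoc[symmetric] smult_l_null)
    moreover have "\<one>\<^bsub>R\<^esub> = r \<otimes>\<^bsub>R\<^esub> a \<oplus>\<^bsub>R\<^esub> (\<one>\<^bsub>R\<^esub> \<ominus>\<^bsub>R\<^esub> r \<otimes>\<^bsub>R\<^esub> a)"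
      using r a by (simp add: R.minus_eq R.a_lcomm R.r_neg)
    ultimately show "\<exists>r\<in>carrier R. \<exists>y\<in>ann (b \<odot>\<^bsub>M\<^esub> x). \<one>\<^bsub>R\<^esub> = r \<otimes>\<^bsub>R\<^esub> a \<oplus>\<^bsub>R\<^esub> y" using r(1) by blast
  qed
  then show ?thesis using that bc by blast
qed

abbreviation jac_ann :: "'m set" where "jac_ann \<equiv> {x \<in> carrier M. \<forall>j\<in>J. j \<odot>\<^bsub>M\<^esub> x = \<zero>\<^bsub>M\<^esub>}"

lemma maximal_ann_jac_ann:
  "x \<in> carrier M \<Longrightarrow> maximal_left_ideal (ann x) R \<Longrightarrow> x \<in> jac_ann"
  using R.jacobson_maximal by blast

lemma maximal_ann_socle:
  assumes "x \<in> carrier M" "maximal_left_ideal (ann x) R"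
  shows "x \<in> socle R M"
  unfolding socle_def using assms simple_cyc_iff mem_cyc generate.incl
  by (metis (no_types, lifting) UnionI mem_Collect_eq)

lemma submodule_jac_ann: "submodule jac_ann R M"
  unfolding submodule_iff
  by (auto simp: smult_r_null smult_r_distr smult_closed smult_assoc[symmetric] R.jacobson_carrier
      R.jacobson_r_closed)

lemma subgroup_socle: "subgroup (socle R M) (add_monoid M)"
  unfolding socle_def
proof (rule group.generate_is_subgroup[OF M.a_group])
  show "\<Union> {S. simple_submodule S R M} \<subseteq> carrier (add_monoid M)"
    unfolding simple_submodule_def submodule_iff by auto
qed

text \<open>A simple submodule is generated by any of its nonzero elements, so it is enough to test
  elements with maximal annihilator. This serves as the induction principle for the socle.\<close>

lemma socle_subset:
  assumes "submodule H R M" "\<And>x. x \<in> carrier M \<Longrightarrow> x \<noteq> \<zero>\<^bsub>M\<^esub> \<Longrightarrow> maximal_left_ideal (ann x) R \<Longrightarrow> x \<in> H"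
  shows "socle R M \<subseteq> H"
  unfolding socle_def
proof (rule group.generate_subgroup_incl[OF M.a_group])
  show "subgroup H (add_monoid M)" using assms(1) by (rule submodule.axioms)
  show "\<Union> {S. simple_submodule S R M} \<subseteq> H"
  proof
    fix x assume "x \<in> \<Union> {S. simple_submodule S R M}"
    then obtain S where S: "simple_submodule S R M" "x \<in> S" by blast
    show "x \<in> H"
      using assms maximal_ann[OF S] simple_submodule_cyc(2)[OF S] submodule_iff by (cases "x = \<zero>\<^bsub>M\<^esub>") auto
  qed
qed

text \<open>The socle is generated only as an additive group. Its elements all of whose multiples
  stay in it form a submodule, to which \<open>socle_subset\<close> applies.\<close>

lemma submodule_socle: "submodule (socle R M) R M"
proof -
  interpret L: subgroup "socle R M" "add_monoid M" by (rule subgroup_socle)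
  let ?H = "{x \<in> socle R M. \<forall>r\<in>carrier R. r \<odot>\<^bsub>M\<^esub> x \<in> socle R M}"
  have sc: "socle R M \<subseteq> carrier M" using L.subset by simp
  have H: "submodule ?H R M"
    unfolding submodule_iff
    using sc L.m_closed L.one_closed
    by (auto simp: smult_r_null smult_r_distr subset_iff smult_assoc[symmetric])
  have "socle R M \<subseteq> ?H"
  proof (rule socle_subset[OF H])
    fix x assume x: "x \<in> carrier M" "x \<noteq> \<zero>\<^bsub>M\<^esub>" "maximal_left_ideal (ann x) R"
    have s: "simple_submodule (cyc x) R M" using simple_cyc_iff x by blast
    have "r \<odot>\<^bsub>M\<^esub> x \<in> socle R M" if "r \<in> carrier R" for r
      unfolding socle_def using s that by (intro generate.incl) blast
    then show "x \<in> ?H" using maximal_ann_socle x by blast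
  qed
  then show ?thesis using H submodule_iff sc L.m_closed L.one_closed by auto
qed

text \<open>Modulo \<open>J\<close> the ring is semisimple, so a module killed by \<open>J\<close>
  is a sum of simple ones. The module itself is not decomposed: splitting over the left ideal of all
  \<open>b\<close> with \<open>b x\<close> in the socle leaves a remainder \<open>e x\<close> that
  has to vanish.\<close>

lemma socle_eq_jac_ann:
  assumes dcc: "descending_chain_condition (left_ideal R)"
  shows "socle R M = jac_ann"
proof
  show "socle R M \<subseteq> jac_ann"
    by (rule socle_subset[OF submodule_jac_ann]) (use maximal_ann_jac_ann in blast)
  interpret left_artinian_ring R using dcc by unfold_locales
  note L = submodule_socle[unfolded submodule_iff]
  show "jac_ann \<subseteq> socle R M"
  proof
    fix x assume x: "x \<in> jac_ann"
    then have xc: "x \<in> carrier M" and jx: "\<And>j. j \<in> J \<Longrightarrow> j \<odot>\<^bsub>M\<^esub> x = \<zero>\<^bsub>M\<^esub>" by blast+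
    let ?I = "{b \<in> carrier R. b \<odot>\<^bsub>M\<^esub> x \<in> socle R M}"
    have I: "left_ideal R ?I"
      by (rule left_idealI) (use L xc in \<open>auto simp: smult_l_null smult_l_distr smult_assoc\<close>)
    have "J \<subseteq> ?I" using jx L R.jacobson_carrier by auto
    from split_over_jacobson[OF I this]
    obtain e where e: "e \<in> carrier R" "\<one>\<^bsub>R\<^esub> \<ominus>\<^bsub>R\<^esub> e \<in> ?I" "\<And>y. y \<in> ?I \<Longrightarrow> y \<otimes>\<^bsub>R\<^esub> e \<in> J"
      "e \<ominus>\<^bsub>R\<^esub> e \<otimes>\<^bsub>R\<^esub> e \<in> J"
      by blast
    have ex: "e \<odot>\<^bsub>M\<^esub> x \<in> carrier M" using e(1) xc smult_closed by blast
    have "e \<odot>\<^bsub>M\<^esub> x = \<zero>\<^bsub>M\<^esub>"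
    proof (rule ccontr)
      assume "e \<odot>\<^bsub>M\<^esub> x \<noteq> \<zero>\<^bsub>M\<^esub>"
      then obtain b where b: "b \<in> carrier R" "maximal_left_ideal (ann (b \<odot>\<^bsub>M\<^esub> (e \<odot>\<^bsub>M\<^esub> x))) R"
        using exists_maximal_ann[OF dcc ex] by blast
      \<comment> \<open>This simple multiple \<open>b e x\<close> lies in the socle, so
        \<open>b e\<close> belongs to \<open>?I\<close> and \<open>b e e\<close> to
        \<open>J\<close>. As \<open>e\<close> is idempotent up to \<open>J\<close>, already
        \<open>b e\<close> is in \<open>J\<close> and kills \<open>x\<close>.\<close>
      have bex: "b \<odot>\<^bsub>M\<^esub> (e \<odot>\<^bsub>M\<^esub> x) \<in> carrier M" using b ex smult_closed by blast
      have "(b \<otimes>\<^bsub>R\<^esub> e) \<odot>\<^bsub>M\<^esub> x \<in> socle R M"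
        using maximal_ann_socle[OF bex b(2)] b e xc by (simp add: smult_assoc)
      then have "(b \<otimes>\<^bsub>R\<^esub> e) \<otimes>\<^bsub>R\<^esub> e \<in> J" using e(3)[of "b \<otimes>\<^bsub>R\<^esub> e"] b e by simp
      moreover have "b \<otimes>\<^bsub>R\<^esub> e = b \<otimes>\<^bsub>R\<^esub> (e \<ominus>\<^bsub>R\<^esub> e \<otimes>\<^bsub>R\<^esub> e) \<oplus>\<^bsub>R\<^esub> (b \<otimes>\<^bsub>R\<^esub> e) \<otimes>\<^bsub>R\<^esub> e" using b(1) e(1) by algebra
      ultimately have "b \<otimes>\<^bsub>R\<^esub> e \<in> J"
        using left_idealD(3)[OF left_ideal_jacobson jacobson_l_closed[OF e(4) b(1)]] by metis
      then have "b \<odot>\<^bsub>M\<^esub> (e \<odot>\<^bsub>M\<^esub> x) = \<zero>\<^bsub>M\<^esub>" using jx b(1) e(1) xc by (simp flip: smult_assoc)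
      then show False using R.maximal_left_idealD(2)[OF b(2)] smult_r_null by simp
    qed
    moreover have "\<one>\<^bsub>R\<^esub> = (\<one>\<^bsub>R\<^esub> \<ominus>\<^bsub>R\<^esub> e) \<oplus>\<^bsub>R\<^esub> e" using e(1) by algebra
    then have "x = (\<one>\<^bsub>R\<^esub> \<ominus>\<^bsub>R\<^esub> e) \<odot>\<^bsub>M\<^esub> x \<oplus>\<^bsub>M\<^esub> e \<odot>\<^bsub>M\<^esub> x"
      using e(1) xc by (metis R.minus_closed R.one_closed smult_l_distr smult_one)
    ultimately show "x \<in> socle R M" using e L by auto
  qed
qed

end

section \<open>Quotients by left ideals and cyclic modules\<close>

lemma (in ring) coset_left_reg: "K +>\<^bsub>left_reg R\<^esub> b = {k \<oplus> b | k. k \<in> K}"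
  by (auto simp: a_r_coset_def r_coset_def left_reg_def)

context ring
begin

context
  fixes K assumes K: "left_ideal R K"
begin

lemma coset_eq_iff:
  assumes [simp]: "a \<in> carrier R" "b \<in> carrier R"
  shows "K +>\<^bsub>left_reg R\<^esub> a = K +>\<^bsub>left_reg R\<^esub> b \<longleftrightarrow> a \<ominus> b \<in> K"
proof -
  note Kc = left_idealD[OF K]
  have sub: "K +>\<^bsub>left_reg R\<^esub> a \<subseteq> K +>\<^bsub>left_reg R\<^esub> b"
    if a: "a \<in> carrier R" and b: "b \<in> carrier R" and ab: "a \<ominus> b \<in> K" for a b
  proof
    fix x assume "x \<in> K +>\<^bsub>left_reg R\<^esub> a"
    then obtain k where k: "k \<in> K" "x = k \<oplus> a" unfolding coset_left_reg by blast
    have "k \<oplus> a = (k \<oplus> (a \<ominus> b)) \<oplus> b" using a b Kc(5)[OF k(1)] by algebra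
    then show "x \<in> K +>\<^bsub>left_reg R\<^esub> b" unfolding coset_left_reg k using Kc(3)[OF k(1) ab] by blast
  qed
  have "b \<ominus> a \<in> K" if "a \<ominus> b \<in> K"
  proof -
    have "b \<ominus> a = \<ominus> (a \<ominus> b)" using assms by algebra
    then show ?thesis using left_ideal_uminus[OF K that] by simp
  qed
  moreover have "a \<ominus> b \<in> K" if eq: "K +>\<^bsub>left_reg R\<^esub> a = K +>\<^bsub>left_reg R\<^esub> b"
  proof -
    have "\<zero> \<oplus> a \<in> K +>\<^bsub>left_reg R\<^esub> a" unfolding coset_left_reg using Kc(2) by blast
    then have "a \<in> {k \<oplus> b | k. k \<in> K}" unfolding eq coset_left_reg[of K b] using assms by simp
    then obtain k where k: "k \<in> K" "a = k \<oplus> b" by blast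
    have "a \<ominus> b = k" unfolding k using assms Kc(5)[OF k(1)] by algebra
    then show ?thesis using k by simp
  qed
  ultimately show ?thesis using sub by (meson assms subset_antisym)
qed

lemma quot_carrier: "carrier (quot_module (left_reg R) K) = (\<lambda>b. K +>\<^bsub>left_reg R\<^esub> b) ` carrier R"
  by (auto simp: quot_module_def A_RCOSETS_def RCOSETS_def a_r_coset_def left_reg_def)

lemma quot_add:
  assumes "a \<in> carrier R" "b \<in> carrier R"
  shows "(K +>\<^bsub>left_reg R\<^esub> a) \<oplus>\<^bsub>quot_module (left_reg R) K\<^esub> (K +>\<^bsub>left_reg R\<^esub> b) = K +>\<^bsub>left_reg R\<^esub> (a \<oplus> b)"
    (is "?l = ?r")
proof -
  note Kc = left_idealD[OF K]
  have l: "?l = {(k \<oplus> a) \<oplus> (h \<oplus> b) | k h. k \<in> K \<and> h \<in> K}"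
    unfolding coset_left_reg by (auto simp: quot_module_def set_add_def set_mult_def left_reg_def; blast)
  have "(k \<oplus> a) \<oplus> (h \<oplus> b) = (k \<oplus> h) \<oplus> (a \<oplus> b)" if "k \<in> K" "h \<in> K" for k h
    using assms Kc(5)[OF that(1)] Kc(5)[OF that(2)] by algebra
  then have "(k \<oplus> a) \<oplus> (h \<oplus> b) \<in> {k \<oplus> (a \<oplus> b) | k. k \<in> K}" if "k \<in> K" "h \<in> K" for k h
    using Kc(3)[OF that] that by blast
  moreover have "k \<oplus> (a \<oplus> b) \<in> {(k \<oplus> a) \<oplus> (h \<oplus> b) | k h. k \<in> K \<and> h \<in> K}" if "k \<in> K" for k
  proof -
    have "k \<oplus> (a \<oplus> b) = (k \<oplus> a) \<oplus> (\<zero> \<oplus> b)" using assms Kc(5)[OF that] by algebra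
    then show ?thesis using that Kc(2) by blast
  qed
  ultimately show ?thesis unfolding l coset_left_reg[of K "a \<oplus> b"] by auto
qed

text \<open>Scalar multiplication on \<open>quot_module\<close> is a union over the representatives
  of a coset. All members of the union are the same coset, and nonemptiness of the coset removes the
  union.\<close>

lemma quot_smult:
  assumes r: "r \<in> carrier R" and b: "b \<in> carrier R"
  shows "r \<odot>\<^bsub>quot_module (left_reg R) K\<^esub> (K +>\<^bsub>left_reg R\<^esub> b) = K +>\<^bsub>left_reg R\<^esub> (r \<otimes> b)"
proof -
  note Kc = left_idealD[OF K]
  have eq: "K +>\<^bsub>left_reg R\<^esub> (r \<otimes> x) = K +>\<^bsub>left_reg R\<^esub> (r \<otimes> b)" if x: "x \<in> K +>\<^bsub>left_reg R\<^esub> b" for x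
  proof -
    obtain k where k: "k \<in> K" "x = k \<oplus> b" using x unfolding coset_left_reg by blast
    have kc: "k \<in> carrier R" using Kc(5) k by blast
    have "r \<otimes> x \<ominus> r \<otimes> b = r \<otimes> k" unfolding k(2) using r b kc by algebra
    then have "r \<otimes> x \<ominus> r \<otimes> b \<in> K" using Kc(4)[OF r k(1)] by simp
    then show ?thesis using coset_eq_iff[of "r \<otimes> x" "r \<otimes> b"] k(2) kc r b by simp
  qed
  have "\<zero> \<oplus> b \<in> K +>\<^bsub>left_reg R\<^esub> b" unfolding coset_left_reg using Kc(2) by blast
  then have ne: "K +>\<^bsub>left_reg R\<^esub> b \<noteq> {}" by blast
  have "r \<odot>\<^bsub>quot_module (left_reg R) K\<^esub> (K +>\<^bsub>left_reg R\<^esub> b)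
    = (\<Union>x\<in>K +>\<^bsub>left_reg R\<^esub> b. K +>\<^bsub>left_reg R\<^esub> (r \<otimes> x))"
    by (simp add: quot_module_def left_reg_def)
  also have "\<dots> = K +>\<^bsub>left_reg R\<^esub> (r \<otimes> b)" using eq ne by auto
  finally show ?thesis .
qed

end
end

context left_module
begin

text \<open>The generator \<open>s\<close> is the preimage of the coset of \<open>\<one>\<close>.
  The formula for \<open>f\<close> on multiples of \<open>s\<close> is kept in the conclusion
  because the graded case compares degrees through it.\<close>

lemma quot_isoD:
  assumes K: "left_ideal R K" and L: "submodule L R M"
    and f: "f \<in> module_hom R (M\<lparr>carrier := L\<rparr>) (quot_module (left_reg R) K)"
    and bij: "bij_betw f L (carrier (quot_module (left_reg R) K))"
  obtains s where "s \<in> L" "L = cyc s" "ann s = K"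
    "\<And>b. b \<in> carrier R \<Longrightarrow> f (b \<odot>\<^bsub>M\<^esub> s) = K +>\<^bsub>left_reg R\<^esub> b"
proof -
  note Lc = L[unfolded submodule_iff]
  have "K +>\<^bsub>left_reg R\<^esub> \<one>\<^bsub>R\<^esub> \<in> f ` L"
    using bij_betw_imp_surj_on[OF bij] R.quot_carrier[OF K] by auto
  then obtain s where s: "s \<in> L" "f s = K +>\<^bsub>left_reg R\<^esub> \<one>\<^bsub>R\<^esub>" by auto
  have sc: "s \<in> carrier M" using s Lc by blast
  have fb: "f (b \<odot>\<^bsub>M\<^esub> s) = K +>\<^bsub>left_reg R\<^esub> b" if b: "b \<in> carrier R" for b
  proof -
    have "f (b \<odot>\<^bsub>M\<^esub> s) = b \<odot>\<^bsub>quot_module (left_reg R) K\<^esub> f s"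
      using f b s unfolding module_hom_def by simp
    then show ?thesis using s(2) R.quot_smult[OF K b R.one_closed] b by simp
  qed
  have inj: "inj_on f L" using bij bij_betw_imp_inj_on by blast
  have "L = cyc s"
  proof
    show "cyc s \<subseteq> L" using Lc s by blast
    show "L \<subseteq> cyc s"
    proof
      fix x assume x: "x \<in> L"
      then have "f x \<in> carrier (quot_module (left_reg R) K)" using bij bij_betw_apply by metis
      then obtain b where b: "b \<in> carrier R" "f x = K +>\<^bsub>left_reg R\<^esub> b" using R.quot_carrier[OF K] by auto
      then have "f x = f (b \<odot>\<^bsub>M\<^esub> s)" using fb by simp
      then have "x = b \<odot>\<^bsub>M\<^esub> s" using inj_onD[OF inj] x Lc b s by blast
      then show "x \<in> cyc s" using b by blast
    qed
  qed
  moreover have "b \<odot>\<^bsub>M\<^esub> s = \<zero>\<^bsub>M\<^esub> \<longleftrightarrow> b \<in> K" if b: "b \<in> carrier R" for b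
  proof -
    have z: "\<zero>\<^bsub>M\<^esub> = \<zero>\<^bsub>R\<^esub> \<odot>\<^bsub>M\<^esub> s" using sc by (simp add: smult_l_null)
    have "b \<odot>\<^bsub>M\<^esub> s = \<zero>\<^bsub>M\<^esub> \<longleftrightarrow> f (b \<odot>\<^bsub>M\<^esub> s) = f (\<zero>\<^bsub>R\<^esub> \<odot>\<^bsub>M\<^esub> s)"
      unfolding z using inj_on_eq_iff[OF inj, of "b \<odot>\<^bsub>M\<^esub> s" "\<zero>\<^bsub>R\<^esub> \<odot>\<^bsub>M\<^esub> s"] Lc b s by simp
    also have "\<dots> \<longleftrightarrow> b \<in> K" using fb b R.coset_eq_iff[OF K b R.zero_closed] by (simp add: R.minus_eq)
    finally show ?thesis .
  qed
  then have "ann s = K" using left_idealD(5)[OF K] by blast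
  ultimately show ?thesis using that s fb by blast
qed

text \<open>Sending \<open>b s\<close> to the coset of \<open>b\<close> is well defined and
  injective precisely because the annihilator of \<open>s\<close> is \<open>K\<close>; the choice
  operator picks a representative \<open>b\<close>.\<close>

lemma quot_isoI:
  assumes K: "left_ideal R K" and s: "s \<in> carrier M" and L: "L = cyc s" and ann: "ann s = K"
  shows "\<exists>f. f \<in> module_hom R (M\<lparr>carrier := L\<rparr>) (quot_module (left_reg R) K)
    \<and> bij_betw f L (carrier (quot_module (left_reg R) K))
    \<and> (\<forall>b\<in>carrier R. f (b \<odot>\<^bsub>M\<^esub> s) = K +>\<^bsub>left_reg R\<^esub> b)"
proof -
  define f where "f = (\<lambda>x. K +>\<^bsub>left_reg R\<^esub> (SOME b. b \<in> carrier R \<and> x = b \<odot>\<^bsub>M\<^esub> s))"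
  have eq: "a \<odot>\<^bsub>M\<^esub> s = b \<odot>\<^bsub>M\<^esub> s \<longleftrightarrow> K +>\<^bsub>left_reg R\<^esub> a = K +>\<^bsub>left_reg R\<^esub> b"
    if "a \<in> carrier R" "b \<in> carrier R" for a b
    using smult_eq_iff[OF that s] R.coset_eq_iff[OF K that] that unfolding ann[symmetric] by auto
  have fb: "f (b \<odot>\<^bsub>M\<^esub> s) = K +>\<^bsub>left_reg R\<^esub> b" if b: "b \<in> carrier R" for b
  proof -
    let ?c = "SOME c. c \<in> carrier R \<and> b \<odot>\<^bsub>M\<^esub> s = c \<odot>\<^bsub>M\<^esub> s"
    have "?c \<in> carrier R \<and> b \<odot>\<^bsub>M\<^esub> s = ?c \<odot>\<^bsub>M\<^esub> s" by (rule someI[of _ b]) (use b in simp)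
    then have "K +>\<^bsub>left_reg R\<^esub> b = K +>\<^bsub>left_reg R\<^esub> ?c" using eq[OF b, of ?c] by blast
    then show ?thesis unfolding f_def by simp
  qed
  have "f \<in> module_hom R (M\<lparr>carrier := L\<rparr>) (quot_module (left_reg R) K)"
    unfolding module_hom_def
  proof (intro CollectI conjI ballI Pi_I; simp)
    fix x y assume "x \<in> L" "y \<in> L"
    then obtain a b where ab: "a \<in> carrier R" "b \<in> carrier R" "x = a \<odot>\<^bsub>M\<^esub> s" "y = b \<odot>\<^bsub>M\<^esub> s"
      unfolding L by blast
    have "x \<oplus>\<^bsub>M\<^esub> y = (a \<oplus>\<^bsub>R\<^esub> b) \<odot>\<^bsub>M\<^esub> s" using ab s by (simp add: smult_l_distr)
    then show "f (x \<oplus>\<^bsub>M\<^esub> y) = f x \<oplus>\<^bsub>quot_module (left_reg R) K\<^esub> f y"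
      using fb ab R.quot_add[OF K ab(1,2)] by simp
  next
    fix r x assume r: "r \<in> carrier R" "x \<in> L"
    then obtain a where a: "a \<in> carrier R" "x = a \<odot>\<^bsub>M\<^esub> s" unfolding L by blast
    have "r \<odot>\<^bsub>M\<^esub> x = (r \<otimes>\<^bsub>R\<^esub> a) \<odot>\<^bsub>M\<^esub> s" using a r s by (simp add: smult_assoc)
    then show "f (r \<odot>\<^bsub>M\<^esub> x) = r \<odot>\<^bsub>quot_module (left_reg R) K\<^esub> f x"
      using fb a r R.quot_smult[OF K r(1) a(1)] by simp
  next
    fix x assume "x \<in> L"
    then obtain a where a: "a \<in> carrier R" "x = a \<odot>\<^bsub>M\<^esub> s" unfolding L by blast
    then show "f x \<in> carrier (quot_module (left_reg R) K)" using fb R.quot_carrier[OF K] by auto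
  qed
  moreover have "bij_betw f L (carrier (quot_module (left_reg R) K))"
    unfolding bij_betw_def
  proof
    show "inj_on f L"
      unfolding L by (rule inj_onI) (use fb eq in auto)
    show "f ` L = carrier (quot_module (left_reg R) K)"
      unfolding L R.quot_carrier[OF K] using fb by (auto simp: image_iff)
  qed
  ultimately show ?thesis using fb by blast
qed

lemma quot_iso_iff:
  assumes K: "left_ideal R K" and L: "submodule L R M"
  shows "module_isomorphic R (M\<lparr>carrier := L\<rparr>) (quot_module (left_reg R) K)
    \<longleftrightarrow> (\<exists>s\<in>L. L = cyc s \<and> ann s = K)"
proof
  assume "module_isomorphic R (M\<lparr>carrier := L\<rparr>) (quot_module (left_reg R) K)"
  then obtain f where "f \<in> module_hom R (M\<lparr>carrier := L\<rparr>) (quot_module (left_reg R) K)"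
    "bij_betw f L (carrier (quot_module (left_reg R) K))"
    unfolding module_isomorphic_def by auto
  then show "\<exists>s\<in>L. L = cyc s \<and> ann s = K" by (rule quot_isoD[OF K L]) blast
next
  assume "\<exists>s\<in>L. L = cyc s \<and> ann s = K"
  then obtain s where s: "s \<in> L" "L = cyc s" "ann s = K" by blast
  then have "s \<in> carrier M" using L[unfolded submodule_iff] by blast
  from quot_isoI[OF K this s(2,3)]
  obtain f where "f \<in> module_hom R (M\<lparr>carrier := L\<rparr>) (quot_module (left_reg R) K)"
    "bij_betw f L (carrier (quot_module (left_reg R) K))" by blast
  then show "module_isomorphic R (M\<lparr>carrier := L\<rparr>) (quot_module (left_reg R) K)"
    unfolding module_isomorphic_def by (intro bexI[of _ f]) simp_all
qed

end

section \<open>Components in direct sums\<close>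

definition component :: "('m, 'c) ring_scheme \<Rightarrow> 'g set \<Rightarrow> ('g \<Rightarrow> 'm set) \<Rightarrow> 'm \<Rightarrow> 'g \<Rightarrow> 'm" where
  "component M I A x = (THE f. f \<in> Pi\<^sub>E I A \<and> finite {g\<in>I. f g \<noteq> \<zero>\<^bsub>M\<^esub>} \<and>
     x = finsum M f {g\<in>I. f g \<noteq> \<zero>\<^bsub>M\<^esub>})"

locale direct_sum = abelian_group M for M :: "('m, 'c) ring_scheme" (structure) +
  fixes I :: "'g set" and A :: "'g \<Rightarrow> 'm set"
  assumes direct_sum: "internal_direct_sum M I A"
begin

abbreviation "cmp \<equiv> component M I A"

lemma summand_subgroup: "g \<in> I \<Longrightarrow> subgroup (A g) (add_monoid M)"
  using direct_sum unfolding internal_direct_sum_def by blast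

lemma summand_carrier: assumes "g \<in> I" "x \<in> A g" shows "x \<in> carrier M"
proof -
  interpret subgroup "A g" "add_monoid M" by (rule summand_subgroup[OF assms(1)])
  show ?thesis using subset assms(2) by auto
qed

lemma summand_zero: assumes "g \<in> I" shows "\<zero> \<in> A g"
proof -
  interpret subgroup "A g" "add_monoid M" by (rule summand_subgroup[OF assms(1)])
  show ?thesis using one_closed by simp
qed

lemma summand_add: assumes "g \<in> I" "x \<in> A g" "y \<in> A g" shows "x \<oplus> y \<in> A g"
proof -
  interpret subgroup "A g" "add_monoid M" by (rule summand_subgroup[OF assms(1)])
  show ?thesis using m_closed assms by simp
qed

lemma summand_uminus: assumes "g \<in> I" "x \<in> A g" shows "\<ominus> x \<in> A g"
proof -
  interpret subgroup "A g" "add_monoid M" by (rule summand_subgroup[OF assms(1)])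
  show ?thesis using m_inv_closed[OF assms(2)] by (simp add: a_inv_def)
qed

lemma summand_minus: "g \<in> I \<Longrightarrow> x \<in> A g \<Longrightarrow> y \<in> A g \<Longrightarrow> x \<ominus> y \<in> A g"
  unfolding a_minus_def by (intro summand_add summand_uminus)

lemma component_props:
  assumes "x \<in> carrier M"
  shows "cmp x \<in> Pi\<^sub>E I A" "finite {g\<in>I. cmp x g \<noteq> \<zero>}" "x = finsum M (cmp x) {g\<in>I. cmp x g \<noteq> \<zero>}"
proof -
  have "\<exists>!f. f \<in> Pi\<^sub>E I A \<and> finite {g\<in>I. f g \<noteq> \<zero>} \<and> x = finsum M f {g\<in>I. f g \<noteq> \<zero>}"
    using direct_sum assms unfolding internal_direct_sum_def by blast
  from theI'[OF this] show "cmp x \<in> Pi\<^sub>E I A" "finite {g\<in>I. cmp x g \<noteq> \<zero>}"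
    "x = finsum M (cmp x) {g\<in>I. cmp x g \<noteq> \<zero>}"
    unfolding component_def by blast+
qed

lemma component_mem: "x \<in> carrier M \<Longrightarrow> g \<in> I \<Longrightarrow> cmp x g \<in> A g"
  using component_props(1) by (rule PiE_mem)

lemma component_closed: "x \<in> carrier M \<Longrightarrow> g \<in> I \<Longrightarrow> cmp x g \<in> carrier M"
  using component_mem summand_carrier by blast

lemma finsum_neutral_subset:
  assumes "finite S" "S \<subseteq> I" "T \<subseteq> S" "\<And>g. g \<in> S - T \<Longrightarrow> f g = \<zero>" "f \<in> S \<rightarrow> carrier M"
  shows "finsum M f T = finsum M f S"
  using assms by (intro add.finprod_mono_neutral_cong_left) auto

text \<open>The set \<open>S\<close> may be larger than the support, so that two families can be
  compared on the union of their supports.\<close>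

lemma component_unique:
  assumes S: "finite S" "S \<subseteq> I" and f: "\<And>g. g \<in> I \<Longrightarrow> f g \<in> A g" "\<And>g. g \<in> I - S \<Longrightarrow> f g = \<zero>"
    and x: "x = finsum M f S" and g: "g \<in> I"
  shows "cmp x g = f g"
proof -
  have fc: "f \<in> S \<rightarrow> carrier M" using f S summand_carrier by blast
  have xc: "x \<in> carrier M" unfolding x using fc by (rule finsum_closed)
  define f' where "f' = restrict f I"
  have T: "{g\<in>I. f' g \<noteq> \<zero>} \<subseteq> S" using f(2) unfolding f'_def by auto
  have "x = finsum M f' S"
    unfolding x f'_def using fc S by (intro finsum_cong') auto
  also have "\<dots> = finsum M f' {g\<in>I. f' g \<noteq> \<zero>}"
    using S T fc unfolding f'_def by (intro finsum_neutral_subset[symmetric]) auto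
  finally have "x = finsum M f' {g\<in>I. f' g \<noteq> \<zero>}" .
  moreover have "f' \<in> Pi\<^sub>E I A" using f(1) unfolding f'_def by auto
  moreover have "finite {g\<in>I. f' g \<noteq> \<zero>}" using T S finite_subset by blast
  moreover have "\<exists>!f. f \<in> Pi\<^sub>E I A \<and> finite {g\<in>I. f g \<noteq> \<zero>} \<and> x = finsum M f {g\<in>I. f g \<noteq> \<zero>}"
    using direct_sum xc unfolding internal_direct_sum_def by blast
  ultimately have "cmp x = f'" unfolding component_def by (intro the1_equality) blast+
  then show ?thesis using g unfolding f'_def by simp
qed

lemma component_add:
  assumes x: "x \<in> carrier M" and y: "y \<in> carrier M" and g: "g \<in> I"
  shows "cmp (x \<oplus> y) g = cmp x g \<oplus> cmp y g"
proof -
  let ?S = "{g\<in>I. cmp x g \<noteq> \<zero>} \<union> {g\<in>I. cmp y g \<noteq> \<zero>}"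
  have fin: "finite ?S" using component_props(2) x y by blast
  have c: "cmp x \<in> ?S \<rightarrow> carrier M" "cmp y \<in> ?S \<rightarrow> carrier M" using component_closed x y by auto
  have "finsum M (cmp x) ?S = x"
    by (rule trans[OF finsum_neutral_subset[symmetric] component_props(3)[OF x, symmetric]])
      (use fin c in auto)
  moreover have "finsum M (cmp y) ?S = y"
    by (rule trans[OF finsum_neutral_subset[symmetric] component_props(3)[OF y, symmetric]])
      (use fin c in auto)
  ultimately have "x \<oplus> y = finsum M (\<lambda>g. cmp x g \<oplus> cmp y g) ?S" using finsum_addf[OF c] by simp
  then show ?thesis
  proof (rule component_unique[OF fin, rotated 3])
    show "cmp x h \<oplus> cmp y h \<in> A h" if "h \<in> I" for h
      using summand_add component_mem x y that by simp
  qed (use g in auto)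
qed

lemma component_summand:
  assumes g: "g \<in> I" and x: "x \<in> A g" and h: "h \<in> I"
  shows "cmp x h = (if h = g then x else \<zero>)"
proof (rule component_unique[where S = "{g}"])
  show "x = (\<Oplus>h\<in>{g}. if h = g then x else \<zero>)"
    using summand_carrier[OF g x] by simp
qed (use assms summand_zero in auto)

lemma component_zero: "g \<in> I \<Longrightarrow> cmp \<zero> g = \<zero>"
  using component_summand[of g \<zero> g] summand_zero by simp

text \<open>The components of \<open>x\<close> add up to \<open>x\<close>, so an additively closed
  set containing them contains \<open>x\<close>. Applied to the set of elements with a desired
  property, this replaces explicit finite sums in most later arguments.\<close>

lemma mem_of_components:
  assumes x: "x \<in> carrier M" and H: "\<zero> \<in> H" "\<And>y z. y \<in> H \<Longrightarrow> z \<in> H \<Longrightarrow> y \<oplus> z \<in> H" "H \<subseteq> carrier M"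
    and c: "\<And>g. g \<in> I \<Longrightarrow> cmp x g \<in> H"
  shows "x \<in> H"
proof -
  have "finsum M (cmp x) S \<in> H" if "finite S" "S \<subseteq> I" for S
    using that
  proof (induction S rule: finite_induct)
    case (insert g S)
    then have "finsum M (cmp x) (insert g S) = cmp x g \<oplus> finsum M (cmp x) S"
      using component_closed[OF x] by (intro finsum_insert) auto
    then show ?case using insert H(2) c by simp
  qed (simp add: H)
  then show ?thesis using component_props(2,3)[OF x] by (metis (no_types, lifting) mem_Collect_eq subsetI)
qed

lemma component_uminus:
  assumes "x \<in> carrier M" "g \<in> I" shows "cmp (\<ominus> x) g = \<ominus> cmp x g"
proof -
  have "cmp (\<ominus> x) g \<oplus> cmp x g = \<zero>"
    using component_add[of "\<ominus> x" x g] assms by (simp add: l_neg component_zero)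
  then show ?thesis using assms component_closed by (simp add: minus_equality)
qed

end

text \<open>A decomposition is built from projections \<pi>. The hypothesis \<open>span\<close>
  stands in for finiteness: applied to the set of elements that are finite sums of their own
  projections, it says that these are all elements.\<close>

lemma internal_direct_sumI:
  fixes M (structure)
  assumes M: "abelian_group M" and sub: "\<And>g. g \<in> I \<Longrightarrow> subgroup (A g) (add_monoid M)"
    and mem: "\<And>x g. x \<in> carrier M \<Longrightarrow> g \<in> I \<Longrightarrow> \<pi> x g \<in> A g"
    and add: "\<And>x y g. x \<in> carrier M \<Longrightarrow> y \<in> carrier M \<Longrightarrow> g \<in> I \<Longrightarrow> \<pi> (x \<oplus> y) g = \<pi> x g \<oplus> \<pi> y g"
    and hom: "\<And>x g h. g \<in> I \<Longrightarrow> x \<in> A g \<Longrightarrow> h \<in> I \<Longrightarrow> \<pi> x h = (if h = g then x else \<zero>)"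
    and span: "\<And>x H. x \<in> carrier M \<Longrightarrow> \<zero> \<in> H \<Longrightarrow> (\<And>y z. y \<in> H \<Longrightarrow> z \<in> H \<Longrightarrow> y \<oplus> z \<in> H) \<Longrightarrow>
      H \<subseteq> carrier M \<Longrightarrow> (\<And>g. g \<in> I \<Longrightarrow> \<pi> x g \<in> H) \<Longrightarrow> x \<in> H"
  shows "internal_direct_sum M I A"
proof -
  interpret abelian_group M by (rule M)
  have Ac: "A g \<subseteq> carrier M" if "g \<in> I" for g
    using subgroup.subset[OF sub[OF that]] by simp
  have A0: "\<zero> \<in> A g" if "g \<in> I" for g
    using subgroup.one_closed[OF sub[OF that]] by simp
  have pc: "\<pi> x g \<in> carrier M" if "x \<in> carrier M" "g \<in> I" for x g using mem Ac that by blast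
  have neutral: "finsum M f T = finsum M f S"
    if "finite S" "T \<subseteq> S" "\<And>g. g \<in> S - T \<Longrightarrow> f g = \<zero>" "f \<in> S \<rightarrow> carrier M" for S T and f :: "'c \<Rightarrow> 'a"
    using that by (intro add.finprod_mono_neutral_cong_left) auto
  have p0: "\<pi> \<zero> g = \<zero>" if "g \<in> I" for g using hom[OF that A0[OF that] that] by simp
  let ?supp = "\<lambda>x. {g\<in>I. \<pi> x g \<noteq> \<zero>}"
  let ?H = "{x \<in> carrier M. finite (?supp x) \<and> x = finsum M (\<pi> x) (?supp x)}"
  have H: "x \<in> ?H" if x: "x \<in> carrier M" for x
  proof (rule span[OF x])
    have s0: "?supp \<zero> = {}" using p0 by auto
    show "\<zero> \<in> ?H" unfolding mem_Collect_eq s0 by simp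
    show "y \<oplus> z \<in> ?H" if "y \<in> ?H" "z \<in> ?H" for y z
    proof -
      have y: "y \<in> carrier M" "finite (?supp y)" "y = finsum M (\<pi> y) (?supp y)"
        and z: "z \<in> carrier M" "finite (?supp z)" "z = finsum M (\<pi> z) (?supp z)" using that by auto
      let ?S = "?supp y \<union> ?supp z"
      have fin: "finite ?S" using y z by blast
      have c: "\<pi> y \<in> ?S \<rightarrow> carrier M" "\<pi> z \<in> ?S \<rightarrow> carrier M" using pc y z by auto
      have sub: "?supp (y \<oplus> z) \<subseteq> ?S" using add[OF y(1) z(1)] by auto
      have "finsum M (\<pi> y) ?S = y" 
        by (rule trans[OF neutral[symmetric] y(3)[symmetric]]) (use fin c in auto)
      moreover have "finsum M (\<pi> z) ?S = z" 
        by (rule trans[OF neutral[symmetric] z(3)[symmetric]]) (use fin c in auto)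
      ultimately have "y \<oplus> z = finsum M (\<lambda>g. \<pi> y g \<oplus> \<pi> z g) ?S" using finsum_addf[OF c] by simp
      also have "\<dots> = finsum M (\<pi> (y \<oplus> z)) ?S"
        using add[OF y(1) z(1)] c pc y(1) z(1) by (intro finsum_cong') auto
      also have "\<dots> = finsum M (\<pi> (y \<oplus> z)) (?supp (y \<oplus> z))"
        by (rule neutral[symmetric, OF fin sub]) (use pc y(1) z(1) in auto)
      finally show ?thesis using y z finite_subset[OF sub fin] by simp
    qed
    show "\<pi> x g \<in> ?H" if g: "g \<in> I" for g
    proof -
      have a: "\<pi> x g \<in> A g" using mem x g by blast
      show ?thesis
      proof (cases "\<pi> x g = \<zero>")
        case True
        then show ?thesis using \<open>\<zero> \<in> ?H\<close> by simp
      next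
        case False
        have "?supp (\<pi> x g) = {g}" using hom[OF g a] g False by (auto split: if_splits)
        moreover have "finsum M (\<pi> (\<pi> x g)) {g} = \<pi> x g"
          using hom[OF g a g] pc[OF x g] by simp
        ultimately show ?thesis using pc[OF x g] by simp
      qed
    qed
  qed auto
  have "\<exists>!f. f \<in> Pi\<^sub>E I A \<and> finite {g\<in>I. f g \<noteq> \<zero>} \<and> x = finsum M f {g\<in>I. f g \<noteq> \<zero>}"
    if x: "x \<in> carrier M" for x
  proof (rule ex1I[of _ "restrict (\<pi> x) I"])
    let ?f = "restrict (\<pi> x) I"
    have s: "{g\<in>I. ?f g \<noteq> \<zero>} = ?supp x" by auto
    have "finsum M ?f (?supp x) = finsum M (\<pi> x) (?supp x)"
      using pc[OF x] by (intro finsum_cong') auto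
    then show "?f \<in> Pi\<^sub>E I A \<and> finite {g\<in>I. ?f g \<noteq> \<zero>} \<and> x = finsum M ?f {g\<in>I. ?f g \<noteq> \<zero>}"
      unfolding s using H[OF x] mem[OF x] by auto
  next
    fix f assume f: "f \<in> Pi\<^sub>E I A \<and> finite {g\<in>I. f g \<noteq> \<zero>} \<and> x = finsum M f {g\<in>I. f g \<noteq> \<zero>}"
    have fA: "f g \<in> A g" if "g \<in> I" for g using f that by auto
    \<comment> \<open>Projecting a finite sum picks out its terms, so any representing family agrees
      with \<pi> on \<open>I\<close>.\<close>
    have *: "\<pi> (finsum M f S) h = (if h \<in> S then f h else \<zero>)" if "finite S" "S \<subseteq> I" "h \<in> I" for S h
      using that
    proof (induction S rule: finite_induct)
      case (insert g S)
      have fc: "f \<in> S \<rightarrow> carrier M" "f g \<in> carrier M" using insert fA Ac by blast+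
      have "finsum M f (insert g S) = f g \<oplus> finsum M f S" using insert fc by (intro finsum_insert) auto
      then have "\<pi> (finsum M f (insert g S)) h = \<pi> (f g) h \<oplus> \<pi> (finsum M f S) h"
        using add[OF fc(2) finsum_closed[OF fc(1)] insert(5)] by simp
      then show ?case using insert hom[of g "f g" h] fA[of g] fA[of h] Ac[of h] by auto
    qed (simp add: p0)
    show "f = restrict (\<pi> x) I"
    proof (rule ext)
      fix h
      show "f h = restrict (\<pi> x) I h"
        using f *[of "{g\<in>I. f g \<noteq> \<zero>}" h] by (cases "h \<in> I") (auto dest: PiE_arb)
    qed
  qed
  then show ?thesis unfolding internal_direct_sum_def using sub by blast
qed

text \<open>The value of \<open>finsum\<close> depends on the whole record, and restricting a ring
  to an ideal gives a different record with the same addition.\<close>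

lemma finsum_restrict_carrier:
  assumes "abelian_group M" "abelian_group N" "carrier N \<subseteq> carrier M" "add N = add M"
    "ring.zero N = ring.zero M" "finite S" "f \<in> S \<rightarrow> carrier N"
  shows "finsum N f S = finsum M f S"
  using assms(6,7)
proof (induction S rule: finite_induct)
  interpret M: abelian_group M by fact
  interpret N: abelian_group N by fact
  {
    case empty
    show ?case using assms by simp
  next
    case (insert g S)
    have "f \<in> S \<rightarrow> carrier M" "f g \<in> carrier M" using insert(4) assms(3) by auto
    then have "finsum M f (insert g S) = f g \<oplus>\<^bsub>M\<^esub> finsum M f S"
      using insert by (intro M.finsum_insert) auto
    moreover have "finsum N f (insert g S) = f g \<oplus>\<^bsub>N\<^esub> finsum N f S"
      using insert by (intro N.finsum_insert) auto
    ultimately show ?case using insert assms(4) by simp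
  }
qed

section \<open>Graded left ideals\<close>

definition opp_group :: "('g, 'e) monoid_scheme \<Rightarrow> ('g, 'e) monoid_scheme" where
  "opp_group G = G\<lparr>monoid.mult := \<lambda>x y. y \<otimes>\<^bsub>G\<^esub> x\<rparr>"

lemma opp_group_simps [simp]:
  "carrier (opp_group G) = carrier G" "one (opp_group G) = one G" "x \<otimes>\<^bsub>opp_group G\<^esub> y = y \<otimes>\<^bsub>G\<^esub> x"
  "opp_group (opp_group G) = G"
  by (simp_all add: opp_group_def)

lemma m_inv_opp_group [simp]: "m_inv (opp_group G) x = m_inv G x"
  unfolding m_inv_def by (simp add: conj_commute)

lemma (in group) group_opp: "group (opp_group G)"
  by (rule groupI) (auto simp: m_assoc intro: r_inv inv_closed)

lemma finsum_opp_ring [simp]: "finsum (opp_ring R) = finsum R"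
  by (intro ext) (simp add: finsum_def)

lemma internal_direct_sum_opp [simp]:
  "internal_direct_sum (opp_ring R) I A = internal_direct_sum R I A"
  by (simp add: internal_direct_sum_def)

lemma component_opp [simp]: "component (opp_ring R) = component R"
  by (intro ext) (simp add: component_def)

section \<open>Homogeneous components of a graded ring and of its ideals\<close>

locale graded_ring_components = graded_ring G R Rg
  for G :: "('g, 'e) monoid_scheme" and R :: "('a, 'b) ring_scheme" (structure) and Rg :: "'g \<Rightarrow> 'a set"
begin

sublocale direct_sum R "carrier G" Rg
  by unfold_locales (rule ring_direct_sum)

lemma gring_opp: "graded_ring_components (opp_group G) (opp_ring R) Rg"
proof -
  interpret o: ring "opp_ring R" by (rule opp_ring_ring)
  interpret og: group "opp_group G" by (rule G.group_opp)
  show ?thesis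
    by (intro graded_ring_components.intro graded_ring.intro graded_ring_axioms.intro)
       (simp_all add: og.is_group o.ring_axioms ring_direct_sum ring_mult_degree)
qed

abbreviation E where "E \<equiv> \<one>\<^bsub>G\<^esub>"
abbreviation gl where "gl I \<equiv> graded_left_ideal G I R Rg"
abbreviation gr where "gr I \<equiv> graded_right_ideal G I R Rg"
abbreviation B where "B \<equiv> neutral_component G R Rg"

lemma gr_conv: "gr I = graded_left_ideal (opp_group G) I (opp_ring R) Rg"
  by (simp add: graded_right_ideal_def graded_left_ideal_def graded_submodule_def right_reg_def)

lemma mult_mem: "g \<in> carrier G \<Longrightarrow> h \<in> carrier G \<Longrightarrow> a \<in> Rg g \<Longrightarrow> b \<in> Rg h \<Longrightarrow> a \<otimes> b \<in> Rg (g \<otimes>\<^bsub>G\<^esub> h)"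
  by (rule ring_mult_degree)

lemma Rg_carrier: "g \<in> carrier G \<Longrightarrow> x \<in> Rg g \<Longrightarrow> x \<in> carrier R"
  by (rule summand_carrier)

text \<open>Multiplication by \<open>x\<close> moves degree \<open>k\<close> to \<open>k h\<close>,
  so the only component of \<open>r\<close> that contributes to degree \<open>g\<close> is the one
  in degree \<open>g\<close> times the inverse of \<open>h\<close>.\<close>

lemma component_mult_right:
  assumes h: "h \<in> carrier G" and x: "x \<in> Rg h" and r: "r \<in> carrier R" and g: "g \<in> carrier G"
  shows "cmp (r \<otimes> x) g = cmp r (g \<otimes>\<^bsub>G\<^esub> inv\<^bsub>G\<^esub> h) \<otimes> x"
proof -
  have xc: "x \<in> carrier R" using Rg_carrier h x by blast
  let ?H = "{r \<in> carrier R. cmp (r \<otimes> x) g = cmp r (g \<otimes>\<^bsub>G\<^esub> inv\<^bsub>G\<^esub> h) \<otimes> x}"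
  have gh: "g \<otimes>\<^bsub>G\<^esub> inv\<^bsub>G\<^esub> h \<in> carrier G" using g h by simp
  have "r \<in> ?H"
  proof (rule mem_of_components[OF r])
    show "\<zero> \<in> ?H" using xc g gh by (simp add: component_zero)
    show "y \<oplus> z \<in> ?H" if "y \<in> ?H" "z \<in> ?H" for y z
      using that xc g gh by (simp add: l_distr component_add component_closed)
    show "cmp r k \<in> ?H" if k: "k \<in> carrier G" for k
    proof -
      let ?a = "cmp r k"
      have a: "?a \<in> Rg k" "?a \<in> carrier R" using component_mem[OF r k] Rg_carrier k by blast+
      have ax: "?a \<otimes> x \<in> Rg (k \<otimes>\<^bsub>G\<^esub> h)" using mult_mem[OF k h a(1) x] .
      have "g = k \<otimes>\<^bsub>G\<^esub> h \<longleftrightarrow> g \<otimes>\<^bsub>G\<^esub> inv\<^bsub>G\<^esub> h = k"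
        using g h k by (metis G.inv_closed G.inv_solve_right')
      then have "cmp (?a \<otimes> x) g = cmp ?a (g \<otimes>\<^bsub>G\<^esub> inv\<^bsub>G\<^esub> h) \<otimes> x"
        using component_summand[OF _ ax g] component_summand[OF k a(1) gh] h k xc by auto
      then show ?thesis using a by simp
    qed
  qed auto
  then show ?thesis by blast
qed

lemma component_mult_left:
  assumes "h \<in> carrier G" "x \<in> Rg h" "r \<in> carrier R" "g \<in> carrier G"
  shows "cmp (x \<otimes> r) g = x \<otimes> cmp r (inv\<^bsub>G\<^esub> h \<otimes>\<^bsub>G\<^esub> g)"
  using graded_ring_components.component_mult_right[OF gring_opp, of h x r g] assms by simp

text \<open>For \<open>x\<close> of degree \<open>g\<close>, the component of
  \<open>\<one> \<otimes> x\<close> in degree \<open>g\<close> is \<open>?e \<otimes> x\<close>. So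
  \<open>?e\<close> acts as a left identity on every component of \<open>\<one>\<close>, hence on
  \<open>\<one>\<close>.\<close>

lemma one_mem: "\<one> \<in> Rg E"
proof -
  let ?e = "cmp \<one> E"
  have e: "?e \<in> carrier R" using component_closed by simp
  have "\<one> \<in> {x \<in> carrier R. ?e \<otimes> x = x}"
  proof (rule mem_of_components)
    show "cmp \<one> g \<in> {x \<in> carrier R. ?e \<otimes> x = x}" if g: "g \<in> carrier G" for g
    proof -
      let ?x = "cmp \<one> g"
      have x: "?x \<in> Rg g" "?x \<in> carrier R" using component_mem component_closed g by simp_all
      have "?x = cmp (\<one> \<otimes> ?x) g" using component_summand[OF g x(1) g] x by simp
      also have "\<dots> = ?e \<otimes> ?x" using component_mult_right[OF g x(1) _ g] g by simp
      finally show ?thesis using x by simp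
    qed
  qed (auto simp: r_distr e)
  then have "?e = \<one>" using e by simp
  then show ?thesis using component_mem[of \<one> E] by simp
qed

lemma neutral_mult [intro]: "g \<in> carrier G \<Longrightarrow> a \<in> Rg E \<Longrightarrow> x \<in> Rg g \<Longrightarrow> a \<otimes> x \<in> Rg g"
  using mult_mem[of E g a x] by simp

lemma mult_neutral [intro]: "g \<in> carrier G \<Longrightarrow> x \<in> Rg g \<Longrightarrow> a \<in> Rg E \<Longrightarrow> x \<otimes> a \<in> Rg g"
  using mult_mem[of g E x a] by simp

lemma B_simps [simp]: "carrier B = Rg E" "add B = add R" "ring.zero B = \<zero>" "one B = \<one>" "monoid.mult B = monoid.mult R"
  by (simp_all add: neutral_component_def)

lemma RgE: "x \<in> Rg E \<Longrightarrow> x \<in> carrier R"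
  using Rg_carrier by blast

lemma B_ring: "ring B"
proof (rule ringI)
  show "abelian_group B"
    by (rule abelian_groupI)
       (auto simp: RgE a_ac summand_add summand_zero intro!: bexI[of _ "\<ominus> x" for x] summand_uminus r_neg)
  show "monoid B"
    by (rule monoidI) (auto simp: RgE m_assoc one_mem)
qed (simp_all add: RgE l_distr r_distr)

sublocale B: ring "neutral_component G R Rg"
  by (rule B_ring)

lemma B_uminus: assumes "x \<in> Rg E" shows "\<ominus>\<^bsub>B\<^esub> x = \<ominus> x"
  using B.minus_equality[of "\<ominus> x" x] assms summand_uminus[of E x] by (simp add: RgE l_neg)

lemma B_minus: "x \<in> Rg E \<Longrightarrow> y \<in> Rg E \<Longrightarrow> x \<ominus>\<^bsub>B\<^esub> y = x \<ominus> y"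
  by (simp add: a_minus_def B_uminus)

lemma opp_B: "opp_ring B = neutral_component (opp_group G) (opp_ring R) Rg"
  by (simp add: neutral_component_def opp_ring_def)

lemma left_reg_carrier_abelian:
  assumes I: "left_ideal R I" shows "abelian_group ((left_reg R)\<lparr>carrier := I\<rparr>)"
proof (rule abelian_groupI; simp add: left_reg_def)
  note Ic = left_idealD[OF I]
  show "x \<oplus> y \<in> I" if "x \<in> I" "y \<in> I" for x y using Ic(3) that .
  show "\<zero> \<in> I" by (rule Ic(2))
  show "x \<oplus> y \<oplus> z = x \<oplus> (y \<oplus> z)" if "x \<in> I" "y \<in> I" "z \<in> I" for x y z
    using Ic(5) that by (simp add: a_assoc)
  show "x \<oplus> y = y \<oplus> x" if "x \<in> I" "y \<in> I" for x y
    using Ic(5) that by (simp add: a_comm)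
  show "\<zero> \<oplus> x = x" if "x \<in> I" for x using Ic(5) that by simp
  show "\<exists>y\<in>I. y \<oplus> x = \<zero>" if "x \<in> I" for x
    using left_ideal_uminus[OF I that] l_neg[OF Ic(5)[OF that]] by blast
qed

text \<open>The definition speaks of a direct sum inside a restricted record. Uniqueness identifies
  its components with those taken in \<open>R\<close>, which reduces gradedness to closure under
  components.\<close>

lemma gl_iff:
  "gl I \<longleftrightarrow> left_ideal R I \<and> (\<forall>x\<in>I. \<forall>g\<in>carrier G. cmp x g \<in> I)" (is "_ \<longleftrightarrow> ?r")
proof
  let ?N = "(left_reg R)\<lparr>carrier := I\<rparr>"
  have Ns: "carrier ?N = I" "add ?N = add R" "ring.zero ?N = \<zero>" by (simp_all add: left_reg_def)
  {
    assume l: "gl I"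
    then have I: "left_ideal R I" and ds: "internal_direct_sum ?N (carrier G) (\<lambda>g. I \<inter> Rg g)"
      unfolding graded_left_ideal_def graded_submodule_def submodule_left_reg by auto
    have N: "abelian_group ?N" by (rule left_reg_carrier_abelian[OF I])
    interpret N: direct_sum ?N "carrier G" "\<lambda>g. I \<inter> Rg g"
      using N ds by (intro direct_sum.intro direct_sum_axioms.intro)
    have "cmp x g \<in> I" if x: "x \<in> I" and g: "g \<in> carrier G" for x g
    proof -
      let ?S = "{h \<in> carrier G. N.cmp x h \<noteq> \<zero>}"
      have fin: "finite ?S" and eq: "x = finsum ?N (N.cmp x) ?S" and mem: "\<And>h. h \<in> carrier G \<Longrightarrow> N.cmp x h \<in> I \<inter> Rg h"
        using N.component_props(2,3)[of x] N.component_mem[of x] x unfolding Ns by auto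
      have "finsum ?N (N.cmp x) ?S = finsum R (N.cmp x) ?S"
        using mem left_idealD(1)[OF I] fin
        by (intro finsum_restrict_carrier N is_abelian_group) (auto simp: Ns)
      then have "cmp x g = N.cmp x g"
        using eq fin g mem by (intro component_unique[of ?S]) auto
      then show ?thesis using mem[OF g] by simp
    qed
    then show ?r using I by blast
  next
    assume r: ?r
    then have I: "left_ideal R I" and c: "\<And>x g. x \<in> I \<Longrightarrow> g \<in> carrier G \<Longrightarrow> cmp x g \<in> I" by auto
    note Ic = left_idealD[OF I]
    have N: "abelian_group ?N" by (rule left_reg_carrier_abelian[OF I])
    interpret N: abelian_group ?N by (rule N)
    have neg: "\<ominus>\<^bsub>?N\<^esub> x = \<ominus> x" if "x \<in> I" for x
      using N.minus_equality[of "\<ominus> x" x] that left_ideal_uminus[OF I that] Ic(5)[OF that]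
      unfolding Ns by (simp add: l_neg)
    have sub: "subgroup (I \<inter> Rg g) (add_monoid ?N)" if g: "g \<in> carrier G" for g
    proof (rule subgroup.intro)
      fix x assume x: "x \<in> I \<inter> Rg g"
      have "\<ominus> x \<in> I \<inter> Rg g" using left_ideal_uminus[OF I] summand_uminus[OF g] x by blast
      then show "inv\<^bsub>add_monoid ?N\<^esub> x \<in> I \<inter> Rg g" using neg x by (simp add: a_inv_def)
    qed (use Ic summand_zero[OF g] summand_add[OF g] in \<open>auto simp: left_reg_def\<close>)
    have "internal_direct_sum ?N (carrier G) (\<lambda>g. I \<inter> Rg g)"
    proof (rule internal_direct_sumI[where \<pi> = cmp, OF N sub]; (unfold Ns)?)
      show "cmp x g \<in> I \<inter> Rg g" if "x \<in> I" "g \<in> carrier G" for x g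
        using c that component_mem Ic by auto
      show "cmp (x \<oplus> y) g = cmp x g \<oplus> cmp y g" if "x \<in> I" "y \<in> I" "g \<in> carrier G" for x y g
        using that component_add Ic by auto
      show "cmp x h = (if h = g then x else \<zero>)" if "g \<in> carrier G" "x \<in> I \<inter> Rg g" "h \<in> carrier G" for x g h
        using that component_summand by auto
      show "x \<in> H" if "x \<in> I" "\<zero> \<in> H" "\<And>y z. y \<in> H \<Longrightarrow> z \<in> H \<Longrightarrow> y \<oplus> z \<in> H" "H \<subseteq> I"
        "\<And>g. g \<in> carrier G \<Longrightarrow> cmp x g \<in> H" for x H
        using mem_of_components[of x H] that Ic(1) by blast
    qed
    then show "gl I" unfolding graded_left_ideal_def graded_submodule_def submodule_left_reg using I by blast
  }
qed

lemma glD: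
  assumes "gl I"
  shows "left_ideal R I" "\<And>x g. x \<in> I \<Longrightarrow> g \<in> carrier G \<Longrightarrow> cmp x g \<in> I" "I \<subseteq> carrier R" "\<zero> \<in> I"
    "\<And>x y. x \<in> I \<Longrightarrow> y \<in> I \<Longrightarrow> x \<oplus> y \<in> I" "\<And>r x. r \<in> carrier R \<Longrightarrow> x \<in> I \<Longrightarrow> r \<otimes> x \<in> I"
    "\<And>x. x \<in> I \<Longrightarrow> x \<in> carrier R"
proof -
  have I: "left_ideal R I" and c: "\<forall>x\<in>I. \<forall>g\<in>carrier G. cmp x g \<in> I" using assms gl_iff by blast+
  note Ic = left_idealD[OF I]
  show "left_ideal R I" "I \<subseteq> carrier R" "\<zero> \<in> I" by (fact I Ic(1,2))+
  show "cmp x g \<in> I" if "x \<in> I" "g \<in> carrier G" for x g using c that by blast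
  show "x \<oplus> y \<in> I" if "x \<in> I" "y \<in> I" for x y by (rule Ic(3)[OF that])
  show "r \<otimes> x \<in> I" if "r \<in> carrier R" "x \<in> I" for r x by (rule Ic(4)[OF that])
  show "x \<in> carrier R" if "x \<in> I" for x by (rule Ic(5)[OF that])
qed

lemma glI:
  assumes I: "I \<subseteq> carrier R" "\<zero> \<in> I" and add: "\<And>x y. x \<in> I \<Longrightarrow> y \<in> I \<Longrightarrow> x \<oplus> y \<in> I"
    and cmp: "\<And>x g. x \<in> I \<Longrightarrow> g \<in> carrier G \<Longrightarrow> cmp x g \<in> I"
    and mult: "\<And>k h r x. k \<in> carrier G \<Longrightarrow> h \<in> carrier G \<Longrightarrow> r \<in> Rg k \<Longrightarrow> x \<in> Rg h \<Longrightarrow> x \<in> I \<Longrightarrow> r \<otimes> x \<in> I"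
  shows "gl I"
proof -
  have "r \<otimes> x \<in> I" if r: "r \<in> carrier R" and x: "x \<in> I" for r x
  proof -
    have xc: "x \<in> carrier R" using x I by blast
    have "r \<in> {r \<in> carrier R. r \<otimes> x \<in> I}"
    proof (rule mem_of_components[OF r])
      show "cmp r k \<in> {r \<in> carrier R. r \<otimes> x \<in> I}" if k: "k \<in> carrier G" for k
      proof -
        let ?r = "cmp r k"
        have rk: "?r \<in> Rg k" "?r \<in> carrier R" using component_mem component_closed r k by auto
        have "x \<in> {x \<in> carrier R. ?r \<otimes> x \<in> I}"
        proof (rule mem_of_components[OF xc])
          show "cmp x h \<in> {x \<in> carrier R. ?r \<otimes> x \<in> I}" if h: "h \<in> carrier G" for h
            using mult[OF k h rk(1) component_mem[OF xc h] cmp[OF x h]] component_closed[OF xc h] by blast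
        qed (use rk I add in \<open>auto simp: r_distr\<close>)
        then show ?thesis using rk by blast
      qed
    qed (use xc I add in \<open>auto simp: l_distr\<close>)
    then show ?thesis by blast
  qed
  then show ?thesis unfolding gl_iff using I add cmp by (blast intro: left_idealI)
qed

lemma subset_hom:
  assumes "gl I" "left_ideal R K" "\<And>g x. g \<in> carrier G \<Longrightarrow> x \<in> Rg g \<Longrightarrow> x \<in> I \<Longrightarrow> x \<in> K"
  shows "I \<subseteq> K"
proof
  fix x assume x: "x \<in> I"
  note I = glD[OF assms(1)] and K = left_idealD[OF assms(2)]
  show "x \<in> K"
    by (rule mem_of_components[OF I(7)[OF x] K(2,3,1)])
       (use assms(3) component_mem[OF I(7)[OF x]] I(2)[OF x] in blast)+
qed

lemma gl_carrier: "gl (carrier R)"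
  unfolding gl_iff using left_ideal_carrier component_closed by blast

lemma gl_zero: "gl {\<zero>}"
  by (rule glI) (auto simp: component_zero Rg_carrier)

lemma gl_Int: "gl I \<Longrightarrow> gl K \<Longrightarrow> gl (I \<inter> K)"
  unfolding gl_iff using left_ideal_Int by blast

lemma gl_sum: assumes "gl I" "gl K" shows "gl {x \<oplus> y | x y. x \<in> I \<and> y \<in> K}"
  unfolding gl_iff
proof (intro conjI ballI)
  note I = glD[OF assms(1)] and K = glD[OF assms(2)]
  show "left_ideal R {x \<oplus> y | x y. x \<in> I \<and> y \<in> K}" by (rule left_ideal_sum[OF I(1) K(1)])
  fix z g assume "z \<in> {x \<oplus> y | x y. x \<in> I \<and> y \<in> K}" and g: "g \<in> carrier G"
  then obtain x y where "z = x \<oplus> y" "x \<in> I" "y \<in> K" by blast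
  then show "cmp z g \<in> {x \<oplus> y | x y. x \<in> I \<and> y \<in> K}"
    using component_add[of x y g] I(2,7) K(2,7) g by blast
qed

lemma gl_principal:
  assumes h: "h \<in> carrier G" and x: "x \<in> Rg h" shows "gl {r \<otimes> x | r. r \<in> carrier R}"
  unfolding gl_iff
proof (intro conjI ballI)
  have xc: "x \<in> carrier R" using Rg_carrier h x by blast
  show "left_ideal R {r \<otimes> x | r. r \<in> carrier R}" by (rule left_ideal_principal[OF xc])
  fix z g assume "z \<in> {r \<otimes> x | r. r \<in> carrier R}" and g: "g \<in> carrier G"
  then obtain r where r: "z = r \<otimes> x" "r \<in> carrier R" by blast
  have "cmp z g = cmp r (g \<otimes>\<^bsub>G\<^esub> inv\<^bsub>G\<^esub> h) \<otimes> x" using component_mult_right[OF h x r(2) g] r by simp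
  then show "cmp z g \<in> {r \<otimes> x | r. r \<in> carrier R}"
    using component_closed[OF r(2), of "g \<otimes>\<^bsub>G\<^esub> inv\<^bsub>G\<^esub> h"] g h by auto
qed

text \<open>Taking the component of degree \<open>g\<close> on both sides of
  \<open>y = r \<otimes> x\<close> replaces \<open>r\<close> by a homogeneous factor.\<close>

lemma principal_hom:
  assumes h: "h \<in> carrier G" and x: "x \<in> Rg h" and g: "g \<in> carrier G"
    and y: "y \<in> Rg g" "y \<in> {r \<otimes> x | r. r \<in> carrier R}"
  obtains r where "r \<in> Rg (g \<otimes>\<^bsub>G\<^esub> inv\<^bsub>G\<^esub> h)" "y = r \<otimes> x"
proof -
  obtain r where r: "y = r \<otimes> x" "r \<in> carrier R" using y by blast
  have "y = cmp y g" using component_summand[OF g y(1) g] by simp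
  also have "\<dots> = cmp r (g \<otimes>\<^bsub>G\<^esub> inv\<^bsub>G\<^esub> h) \<otimes> x" using component_mult_right[OF h x r(2) g] r by simp
  finally show ?thesis using that component_mem[OF r(2), of "g \<otimes>\<^bsub>G\<^esub> inv\<^bsub>G\<^esub> h"] g h by simp
qed

lemma gl_nonzero_hom:
  assumes "gl I" "I \<noteq> {\<zero>}"
  obtains g x where "g \<in> carrier G" "x \<in> Rg g" "x \<in> I" "x \<noteq> \<zero>"
proof (rule ccontr)
  assume nt: "\<not> thesis"
  note th = that
  have *: "x = \<zero>" if gx: "g \<in> carrier G" "x \<in> Rg g" "x \<in> I" for g x using th gx nt by blast
  have "I \<subseteq> {\<zero>}" by (rule subset_hom[OF assms(1)]) (use * glD(1)[OF gl_zero] in auto)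
  then show False using assms glD(4) by blast
qed

section \<open>Extending a submodule of one component to a graded left ideal\<close>

definition bsub :: "'g \<Rightarrow> 'a set \<Rightarrow> bool" where
  "bsub \<tau> W \<longleftrightarrow> W \<subseteq> Rg \<tau> \<and> \<zero> \<in> W \<and> (\<forall>x\<in>W. \<forall>y\<in>W. x \<oplus> y \<in> W) \<and> (\<forall>a\<in>Rg E. \<forall>x\<in>W. a \<otimes> x \<in> W)"

lemma left_ideal_B: "left_ideal B W \<longleftrightarrow> bsub E W"
  unfolding left_ideal_def bsub_def by simp

text \<open>The largest graded left ideal whose component of degree \<^term>\<open>\<tau>\<close> lies in \<^term>\<open>W\<close>.\<close>

definition big :: "'g \<Rightarrow> 'a set \<Rightarrow> 'a set" where
  "big \<tau> W = {x \<in> carrier R. \<forall>g\<in>carrier G. \<forall>b\<in>Rg (\<tau> \<otimes>\<^bsub>G\<^esub> inv\<^bsub>G\<^esub> g). b \<otimes> cmp x g \<in> W}"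

lemma big_hom:
  assumes t: "\<tau> \<in> carrier G" and W: "bsub \<tau> W" and g: "g \<in> carrier G" and x: "x \<in> Rg g"
  shows "x \<in> big \<tau> W \<longleftrightarrow> (\<forall>b\<in>Rg (\<tau> \<otimes>\<^bsub>G\<^esub> inv\<^bsub>G\<^esub> g). b \<otimes> x \<in> W)"
proof -
  have "b \<otimes> cmp x h \<in> W" if "h \<in> carrier G" "h \<noteq> g" "b \<in> Rg (\<tau> \<otimes>\<^bsub>G\<^esub> inv\<^bsub>G\<^esub> h)" for h b
    using component_summand[OF g x that(1)] that Rg_carrier[OF _ that(3)] t W unfolding bsub_def by simp
  then show ?thesis
    unfolding big_def using component_summand[OF g x g] Rg_carrier[OF g x] g by (simp add: Ball_def) metis
qed

lemma gl_big:
  assumes t: "\<tau> \<in> carrier G" and W: "bsub \<tau> W" shows "gl (big \<tau> W)"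
proof (rule glI)
  note Wc = W[unfolded bsub_def]
  show "big \<tau> W \<subseteq> carrier R" unfolding big_def by blast
  show "\<zero> \<in> big \<tau> W"
    unfolding big_def using Wc t Rg_carrier[OF G.m_closed[OF t G.inv_closed]] by (auto simp: component_zero)
  show "x \<oplus> y \<in> big \<tau> W" if "x \<in> big \<tau> W" "y \<in> big \<tau> W" for x y
    using that Wc t Rg_carrier[OF G.m_closed[OF t G.inv_closed]] component_closed
    unfolding big_def by (auto simp: component_add r_distr)
  show "cmp x g \<in> big \<tau> W" if x: "x \<in> big \<tau> W" and g: "g \<in> carrier G" for x g
  proof -
    have "cmp x g \<in> Rg g" using x g component_mem unfolding big_def by blast
    then show ?thesis using big_hom[OF t W g] x g unfolding big_def by blast
  qed
  show "r \<otimes> x \<in> big \<tau> W"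
    if k: "k \<in> carrier G" and h: "h \<in> carrier G" and r: "r \<in> Rg k" and x: "x \<in> Rg h" "x \<in> big \<tau> W" for k h r x
  proof -
    have rx: "r \<otimes> x \<in> Rg (k \<otimes>\<^bsub>G\<^esub> h)" by (rule mult_mem[OF k h r x(1)])
    have kh: "k \<otimes>\<^bsub>G\<^esub> h \<in> carrier G" using k h by simp
    have "b \<otimes> (r \<otimes> x) \<in> W" if b: "b \<in> Rg (\<tau> \<otimes>\<^bsub>G\<^esub> inv\<^bsub>G\<^esub> (k \<otimes>\<^bsub>G\<^esub> h))" for b
    proof -
      \<comment> \<open>The product \<open>b \<otimes> r\<close> has exactly the degree that brings
        \<open>x\<close> to \<tau>, so membership of \<open>x\<close> can be used with it.\<close>
      have "\<tau> \<otimes>\<^bsub>G\<^esub> inv\<^bsub>G\<^esub> (k \<otimes>\<^bsub>G\<^esub> h) \<otimes>\<^bsub>G\<^esub> k = \<tau> \<otimes>\<^bsub>G\<^esub> inv\<^bsub>G\<^esub> h"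
        using t k h by (simp add: G.inv_mult_group G.m_assoc)
      then have "b \<otimes> r \<in> Rg (\<tau> \<otimes>\<^bsub>G\<^esub> inv\<^bsub>G\<^esub> h)" using mult_mem[OF _ k b r] t kh by simp
      then have "(b \<otimes> r) \<otimes> x \<in> W" using x(2) big_hom[OF t W h x(1)] by blast
      then show ?thesis using Rg_carrier[OF _ b] Rg_carrier[OF k r] Rg_carrier[OF h x(1)] t kh by (simp add: m_assoc)
    qed
    then show ?thesis using big_hom[OF t W kh rx] by blast
  qed
qed

lemma big_Int:
  assumes t: "\<tau> \<in> carrier G" and W: "bsub \<tau> W" shows "big \<tau> W \<inter> Rg \<tau> = W"
proof -
  note Wc = W[unfolded bsub_def]
  have "x \<in> big \<tau> W \<longleftrightarrow> (\<forall>b\<in>Rg E. b \<otimes> x \<in> W)" if "x \<in> Rg \<tau>" for x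
    using big_hom[OF t W t that] t by simp
  moreover have "x \<in> W" if "x \<in> Rg \<tau>" "\<forall>b\<in>Rg E. b \<otimes> x \<in> W" for x
    using bspec[OF that(2) one_mem] l_one[OF Rg_carrier[OF t that(1)]] by simp
  moreover have "W \<subseteq> Rg \<tau>" "\<And>x b. x \<in> W \<Longrightarrow> b \<in> Rg E \<Longrightarrow> b \<otimes> x \<in> W" using Wc by blast+
  ultimately show ?thesis by (intro subset_antisym subsetI IntI) (auto simp del: B_simps)
qed

lemma big_greatest:
  assumes t: "\<tau> \<in> carrier G" and T: "gl T" "T \<inter> Rg \<tau> \<subseteq> W" shows "T \<subseteq> big \<tau> W"
proof
  fix x assume x: "x \<in> T"
  have xc: "x \<in> carrier R" using glD(7)[OF T(1) x] .
  have "b \<otimes> cmp x g \<in> W" if g: "g \<in> carrier G" and b: "b \<in> Rg (\<tau> \<otimes>\<^bsub>G\<^esub> inv\<^bsub>G\<^esub> g)" for g b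
  proof -
    have tg: "\<tau> \<otimes>\<^bsub>G\<^esub> inv\<^bsub>G\<^esub> g \<in> carrier G" using t g by simp
    have "b \<otimes> cmp x g \<in> Rg (\<tau> \<otimes>\<^bsub>G\<^esub> inv\<^bsub>G\<^esub> g \<otimes>\<^bsub>G\<^esub> g)" by (rule mult_mem[OF tg g b component_mem[OF xc g]])
    then have "b \<otimes> cmp x g \<in> Rg \<tau>" using t g by (simp add: G.m_assoc)
    moreover have "b \<otimes> cmp x g \<in> T" using glD(2,6)[OF T(1)] x g Rg_carrier[OF tg b] by blast
    ultimately show ?thesis using T(2) by blast
  qed
  then show "x \<in> big \<tau> W" unfolding big_def using xc by blast
qed

lemma big_mono: "V \<subseteq> W \<Longrightarrow> big \<tau> V \<subseteq> big \<tau> W"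
  unfolding big_def by blast

lemma bsub_Int: assumes "gl T" "\<tau> \<in> carrier G" shows "bsub \<tau> (T \<inter> Rg \<tau>)"
  unfolding bsub_def using glD[OF assms(1)] assms(2) summand_zero summand_add RgE by auto

text \<open>The map \<open>big E\<close> embeds the left ideals of \<open>B\<close> into the graded
  left ideals, with intersection with \<open>Rg E\<close> as a left inverse. A chain in
  \<open>B\<close> therefore stabilises together with its image.\<close>

lemma B_dcc:
  assumes "descending_chain_condition gl" shows "descending_chain_condition (left_ideal B)"
  unfolding descending_chain_condition_def left_ideal_B
proof (intro allI impI)
  fix W :: "nat \<Rightarrow> 'a set" assume W: "\<forall>n. bsub E (W n) \<and> W (Suc n) \<subseteq> W n"
  then have "\<forall>n. gl (big E (W n)) \<and> big E (W (Suc n)) \<subseteq> big E (W n)"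
    using gl_big big_mono by blast
  then obtain k where k: "\<And>n. n \<ge> k \<Longrightarrow> big E (W n) = big E (W k)"
    using assms[unfolded descending_chain_condition_def, rule_format, of "\<lambda>n. big E (W n)"] by blast
  have "W n = W k" if "n \<ge> k" for n
    using k[OF that] big_Int[of E] W by (metis G.one_closed)
  then show "\<exists>k. \<forall>n\<ge>k. W n = W k" by blast
qed

lemma B_acc:
  assumes "ascending_chain_condition gl" shows "ascending_chain_condition (left_ideal B)"
  unfolding ascending_chain_condition_def left_ideal_B
proof (intro allI impI)
  fix W :: "nat \<Rightarrow> 'a set" assume W: "\<forall>n. bsub E (W n) \<and> W n \<subseteq> W (Suc n)"
  then have "\<forall>n. gl (big E (W n)) \<and> big E (W n) \<subseteq> big E (W (Suc n))"
    using gl_big big_mono by blast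
  then obtain k where k: "\<And>n. n \<ge> k \<Longrightarrow> big E (W n) = big E (W k)"
    using assms[unfolded ascending_chain_condition_def, rule_format, of "\<lambda>n. big E (W n)"] by blast
  have "W n = W k" if "n \<ge> k" for n
    using k[OF that] big_Int[of E] W by (metis G.one_closed)
  then show "\<exists>k. \<forall>n\<ge>k. W n = W k" by blast
qed

section \<open>The graded radical and the radical of the neutral component\<close>

abbreviation JB where "JB \<equiv> jacobson_radical B"
abbreviation JG where "JG \<equiv> graded_jacobson_radical G R Rg"

text \<open>A larger graded left ideal either has its neutral component inside \<open>n\<close>, and
  then lies in \<open>big E n\<close> by \<open>big_greatest\<close>, or contains an element of
  \<open>Rg E\<close> outside \<open>n\<close> and therefore \<open>\<one>\<close>.\<close>

lemma maximal_graded_big: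
  assumes n: "maximal_left_ideal n B" shows "maximal_graded_left_ideal G (big E n) R Rg"
proof -
  note nl = B.maximal_left_idealD[OF n]
  have bn: "bsub E n" using nl(1) left_ideal_B by blast
  have int: "big E n \<inter> Rg E = n" by (rule big_Int[OF G.one_closed bn])
  show ?thesis unfolding maximal_graded_left_ideal_def
  proof (intro conjI allI impI)
    show "gl (big E n)" by (rule gl_big[OF G.one_closed bn])
    show "big E n \<noteq> carrier R" using int nl(2) one_mem by auto
    fix K assume K: "gl K \<and> big E n \<subseteq> K"
    show "K = big E n \<or> K = carrier R"
    proof (cases "K \<inter> Rg E \<subseteq> n")
      case True
      then show ?thesis using big_greatest[OF G.one_closed] K by blast
    next
      case False
      then obtain a where a: "a \<in> K" "a \<in> Rg E" "a \<notin> n" by blast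
      then obtain r y where r: "r \<in> Rg E" "y \<in> n" "\<one> = r \<otimes> a \<oplus> y" using nl(3)[of a] unfolding B_simps by blast
      have "y \<in> K" using r int K by blast
      then have "\<one> \<in> K" using r a K glD(5,6)[of K] RgE by auto
      then show ?thesis using left_ideal_one glD(1) K by blast
    qed
  qed
qed

lemma proper_gl_big:
  assumes "gl T" "\<one> \<notin> T" obtains n where "maximal_left_ideal n B" "T \<subseteq> big E n"
proof -
  have "left_ideal B (T \<inter> Rg E)" using bsub_Int[OF assms(1)] left_ideal_B by blast
  moreover have "one B \<notin> T \<inter> Rg E" using assms by simp
  ultimately obtain n where "maximal_left_ideal n B" "T \<inter> Rg E \<subseteq> n"
    using B.exists_maximal_left_ideal[of "T \<inter> Rg E"] by metis
  then show ?thesis using that big_greatest[OF G.one_closed assms(1)] by blast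
qed

text \<open>The maximal graded left ideals are the \<open>big E n\<close> for maximal left ideals
  \<open>n\<close> of \<open>B\<close>, and forming \<open>big E\<close> is compatible with
  intersections.\<close>

lemma JG_eq: "JG = big E JB"
proof
  have bJ: "bsub E JB" using B.left_ideal_jacobson left_ideal_B by blast
  have g: "gl (big E JB)" by (rule gl_big[OF G.one_closed bJ])
  show "JG \<subseteq> big E JB"
  proof
    fix x assume x: "x \<in> JG"
    then have xc: "x \<in> carrier R" unfolding graded_jacobson_radical_def by blast
    have "b \<otimes> cmp x g \<in> JB" if gb: "g \<in> carrier G" "b \<in> Rg (E \<otimes>\<^bsub>G\<^esub> inv\<^bsub>G\<^esub> g)" for g b
    proof (rule ccontr)
      assume "b \<otimes> cmp x g \<notin> JB"
      moreover have "b \<otimes> cmp x g \<in> Rg E"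
        using mult_mem[OF _ gb(1) _ component_mem[OF xc gb(1)], of "inv\<^bsub>G\<^esub> g" b] gb by simp
      ultimately obtain n where n: "maximal_left_ideal n B" "b \<otimes> cmp x g \<notin> n"
        using B.not_jacobsonE[of "b \<otimes> cmp x g"] by auto
      have "x \<in> big E n" using x maximal_graded_big[OF n(1)] unfolding graded_jacobson_radical_def by blast
      then show False using n gb unfolding big_def by blast
    qed
    then show "x \<in> big E JB" unfolding big_def using xc by blast
  qed
  show "big E JB \<subseteq> JG"
  proof
    fix x assume x: "x \<in> big E JB"
    have "x \<in> K" if K: "maximal_graded_left_ideal G K R Rg" for K
    proof -
      have Kg: "gl K" and Kp: "K \<noteq> carrier R"
        and mx: "\<And>T. gl T \<Longrightarrow> K \<subseteq> T \<Longrightarrow> T = K \<or> T = carrier R"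
        using K unfolding maximal_graded_left_ideal_def by blast+
      have "\<one> \<notin> K" using Kp left_ideal_one glD(1)[OF Kg] by blast
      then obtain n where n: "maximal_left_ideal n B" "K \<subseteq> big E n" using proper_gl_big[OF Kg] by blast
      have "big E n = K"
        using maximal_graded_big[OF n(1)] mx n(2) unfolding maximal_graded_left_ideal_def by blast
      then show ?thesis using big_mono[OF B.jacobson_subset_maximal[OF n(1)]] x by blast
    qed
    then show "x \<in> JG" unfolding graded_jacobson_radical_def using x unfolding big_def by blast
  qed
qed

lemma gl_JG: "gl JG"
  unfolding JG_eq using gl_big[OF G.one_closed] B.left_ideal_jacobson left_ideal_B by blast

lemma JG_Int: "JG \<inter> Rg E = JB"
  unfolding JG_eq using big_Int[OF G.one_closed] B.left_ideal_jacobson left_ideal_B by blast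

lemma JG_hom:
  assumes "g \<in> carrier G" "x \<in> Rg g"
  shows "x \<in> JG \<longleftrightarrow> (\<forall>b\<in>Rg (inv\<^bsub>G\<^esub> g). b \<otimes> x \<in> JB)"
  unfolding JG_eq using big_hom[OF G.one_closed _ assms] B.left_ideal_jacobson left_ideal_B assms by simp

end

section \<open>The component of degree \<open>\<sigma>\<close> over an Artinian graded ring\<close>

context graded_ring_components
begin

lemma left_component_simps [simp]:
  "carrier (left_component R Rg \<tau>) = Rg \<tau>" "add (left_component R Rg \<tau>) = add R"
  "ring.zero (left_component R Rg \<tau>) = \<zero>" "smult (left_component R Rg \<tau>) = monoid.mult R"
  by (simp_all add: left_component_def left_reg_def)

lemma left_component_module:
  assumes t: "\<tau> \<in> carrier G" shows "left_module B (left_component R Rg \<tau>)"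
proof -
  have "abelian_group (left_component R Rg \<tau>)"
    by (rule abelian_groupI)
       (auto simp: Rg_carrier[OF t] a_ac summand_add[OF t] summand_zero[OF t]
         intro!: bexI[of _ "\<ominus> x" for x] summand_uminus[OF t] r_neg)
  then show ?thesis
    by (intro left_module.intro left_module_axioms.intro B_ring)
       (auto simp: Rg_carrier[OF t] RgE m_assoc l_distr r_distr neutral_mult[OF t])
qed

end

locale graded_artinian_ring = graded_ring_components G R Rg
  for G :: "('g, 'e) monoid_scheme" and R :: "('a, 'b) ring_scheme" (structure) and Rg :: "'g \<Rightarrow> 'a set" +
  fixes \<sigma> :: 'g
  assumes s_carrier: "\<sigma> \<in> carrier G" and artinian: "graded_artinian G R Rg"
begin

lemma gl_dcc: "descending_chain_condition gl"
  using artinian unfolding graded_artinian_def by blast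

lemma gr_dcc: "descending_chain_condition gr"
  using artinian unfolding graded_artinian_def by blast

lemma gart_opp: "graded_artinian_ring (opp_group G) (opp_ring R) Rg \<sigma>"
proof -
  interpret o: graded_ring_components "opp_group G" "opp_ring R" Rg by (rule gring_opp)
  have "graded_right_ideal (opp_group G) I (opp_ring R) Rg = gl I" for I
    using o.gr_conv[of I] by simp
  then show ?thesis
    using artinian s_carrier
    by (intro graded_artinian_ring.intro gring_opp graded_artinian_ring_axioms.intro) (simp_all add: graded_artinian_def gr_conv conj_commute)
qed

lemma B_artinian: "left_artinian_ring B"
  by (intro left_artinian_ring.intro left_artinian_ring_axioms.intro B_ring B_dcc gl_dcc)

sublocale B: left_artinian_ring "neutral_component G R Rg"
  by (rule B_artinian)

sublocale V: left_module "neutral_component G R Rg" "left_component R Rg \<sigma>"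
  by (rule left_component_module[OF s_carrier])

definition LS :: "'a set" where "LS = {x \<in> Rg \<sigma>. \<forall>j\<in>JB. j \<otimes> x = \<zero>}"
definition RS :: "'a set" where "RS = {x \<in> Rg \<sigma>. \<forall>j\<in>JB. x \<otimes> j = \<zero>}"

lemma JB_opp: "jacobson_radical (neutral_component (opp_group G) (opp_ring R) Rg) = JB"
  unfolding opp_B[symmetric] by (rule B.jacobson_opp)

lemma left_socle: "socle B (left_component R Rg \<sigma>) = LS"
  using V.socle_eq_jac_ann[OF B.dcc] unfolding LS_def by simp

text \<open>This is the generator form of the first socle isomorphism in (2).\<close>

definition lgen :: "'a \<Rightarrow> bool" where
  "lgen s \<longleftrightarrow> s \<in> LS \<and> LS = {b \<otimes> s | b. b \<in> Rg E} \<and> {b \<in> Rg E. b \<otimes> s = \<zero>} = JB"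

definition rgen :: "'a \<Rightarrow> bool" where
  "rgen s \<longleftrightarrow> s \<in> RS \<and> RS = {s \<otimes> b | b. b \<in> Rg E} \<and> {b \<in> Rg E. s \<otimes> b = \<zero>} = JB"

lemma left_iso_iff:
  "module_isomorphic B ((left_component R Rg \<sigma>)\<lparr>carrier := socle B (left_component R Rg \<sigma>)\<rparr>)
     (quot_module (left_reg B) JB) \<longleftrightarrow> (\<exists>s. lgen s)"
  using V.quot_iso_iff[OF B.left_ideal_jacobson V.submodule_socle]
  unfolding left_socle lgen_def by (simp add: Bex_def)

lemma LS_opp: "graded_artinian_ring.LS (opp_group G) (opp_ring R) Rg \<sigma> = RS"
  unfolding graded_artinian_ring.LS_def[OF gart_opp] RS_def by (simp add: JB_opp)

lemma RS_opp: "graded_artinian_ring.RS (opp_group G) (opp_ring R) Rg \<sigma> = LS"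
  unfolding graded_artinian_ring.RS_def[OF gart_opp] LS_def by (simp add: JB_opp)

lemma lgen_opp: "graded_artinian_ring.lgen (opp_group G) (opp_ring R) Rg \<sigma> = rgen"
  by (rule ext) (simp add: graded_artinian_ring.lgen_def[OF gart_opp] rgen_def LS_opp JB_opp)

lemma rgen_opp: "graded_artinian_ring.rgen (opp_group G) (opp_ring R) Rg \<sigma> = lgen"
  by (rule ext) (simp add: graded_artinian_ring.rgen_def[OF gart_opp] lgen_def RS_opp JB_opp)

lemma right_iso_iff:
  "module_isomorphic (opp_ring B)
     ((right_component R Rg \<sigma>)\<lparr>carrier := socle (opp_ring B) (right_component R Rg \<sigma>)\<rparr>)
     (quot_module (right_reg B) JB) \<longleftrightarrow> (\<exists>s. rgen s)"
  using graded_artinian_ring.left_iso_iff[OF gart_opp]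
  unfolding lgen_opp JB_opp by (simp add: right_component_def left_component_def right_reg_def opp_B)

lemma LS_D:
  assumes "x \<in> LS"
  shows "x \<in> Rg \<sigma>" "x \<in> carrier R" "\<And>j. j \<in> JB \<Longrightarrow> j \<otimes> x = \<zero>"
  using assms Rg_carrier[OF s_carrier] unfolding LS_def by auto

lemma LS_I: "x \<in> Rg \<sigma> \<Longrightarrow> (\<And>j. j \<in> JB \<Longrightarrow> j \<otimes> x = \<zero>) \<Longrightarrow> x \<in> LS"
  unfolding LS_def by blast

lemma RS_D:
  assumes "x \<in> RS"
  shows "x \<in> Rg \<sigma>" "x \<in> carrier R" "\<And>j. j \<in> JB \<Longrightarrow> x \<otimes> j = \<zero>"
  using assms Rg_carrier[OF s_carrier] unfolding RS_def by auto

lemma RS_I: "x \<in> Rg \<sigma> \<Longrightarrow> (\<And>j. j \<in> JB \<Longrightarrow> x \<otimes> j = \<zero>) \<Longrightarrow> x \<in> RS"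
  unfolding RS_def by blast

lemma JB_E: "j \<in> JB \<Longrightarrow> j \<in> Rg E"
  using B.jacobson_carrier by simp

lemma JB_c: "j \<in> JB \<Longrightarrow> j \<in> carrier R"
  using JB_E RgE by blast

lemma JB_l: "j \<in> JB \<Longrightarrow> a \<in> Rg E \<Longrightarrow> a \<otimes> j \<in> JB"
  using B.jacobson_l_closed by simp

lemma JB_r: "j \<in> JB \<Longrightarrow> a \<in> Rg E \<Longrightarrow> j \<otimes> a \<in> JB"
  using B.jacobson_r_closed by simp

lemma JB_add: "i \<in> JB \<Longrightarrow> j \<in> JB \<Longrightarrow> i \<oplus> j \<in> JB"
  using left_idealD(3)[OF B.left_ideal_jacobson] by simp

lemma JB_zero: "\<zero> \<in> JB"
  using left_idealD(2)[OF B.left_ideal_jacobson] by simp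

lemma JB_minus: "i \<in> JB \<Longrightarrow> j \<in> JB \<Longrightarrow> i \<ominus> j \<in> JB"
  using B.left_ideal_minus[OF B.left_ideal_jacobson] B_minus JB_E by metis

lemma E_mult: "a \<in> Rg E \<Longrightarrow> b \<in> Rg E \<Longrightarrow> a \<otimes> b \<in> Rg E"
  by blast

lemma E_minus: "a \<in> Rg E \<Longrightarrow> b \<in> Rg E \<Longrightarrow> a \<ominus> b \<in> Rg E"
  by (rule summand_minus[OF G.one_closed])

lemma LS_l: assumes x: "x \<in> LS" and a: "a \<in> Rg E" shows "a \<otimes> x \<in> LS"
proof (rule LS_I)
  show "a \<otimes> x \<in> Rg \<sigma>" using neutral_mult[OF s_carrier a] LS_D(1)[OF x] .
  show "j \<otimes> (a \<otimes> x) = \<zero>" if j: "j \<in> JB" for j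
    using LS_D(3)[OF x JB_r[OF j a]] LS_D(2)[OF x] a j RgE JB_c by (simp add: m_assoc)
qed

lemma LS_r: assumes x: "x \<in> LS" and a: "a \<in> Rg E" shows "x \<otimes> a \<in> LS"
proof (rule LS_I)
  show "x \<otimes> a \<in> Rg \<sigma>" using mult_neutral[OF s_carrier _ a] LS_D(1)[OF x] .
  show "j \<otimes> (x \<otimes> a) = \<zero>" if j: "j \<in> JB" for j
    using LS_D(3)[OF x j] LS_D(2)[OF x] a j RgE JB_c by (simp add: m_assoc[symmetric])
qed

lemma RS_r: "x \<in> RS \<Longrightarrow> a \<in> Rg E \<Longrightarrow> x \<otimes> a \<in> RS"
  using graded_artinian_ring.LS_l[OF gart_opp, of x a] by (simp add: LS_opp)

lemma RS_l: "x \<in> RS \<Longrightarrow> a \<in> Rg E \<Longrightarrow> a \<otimes> x \<in> RS"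
  using graded_artinian_ring.LS_r[OF gart_opp, of x a] by (simp add: LS_opp)

lemma LS_zero: "\<zero> \<in> LS"
  by (rule LS_I) (auto simp: summand_zero[OF s_carrier] JB_c)

lemma LS_add: "x \<in> LS \<Longrightarrow> y \<in> LS \<Longrightarrow> x \<oplus> y \<in> LS"
  using LS_D[of x] LS_D[of y] by (intro LS_I) (auto simp: summand_add[OF s_carrier] JB_c r_distr)

lemma RS_zero: "\<zero> \<in> RS"
  using graded_artinian_ring.LS_zero[OF gart_opp] by (simp add: LS_opp)

lemma RS_add: "x \<in> RS \<Longrightarrow> y \<in> RS \<Longrightarrow> x \<oplus> y \<in> RS"
  using graded_artinian_ring.LS_add[OF gart_opp, of x y] by (simp add: LS_opp)

lemma maximal_ann_LS:
  assumes "x \<in> Rg \<sigma>" "maximal_left_ideal {r \<in> Rg E. r \<otimes> x = \<zero>} B" shows "x \<in> LS"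
  using V.maximal_ann_jac_ann[of x] assms unfolding LS_def by simp

text \<open>The chain condition on \<open>B\<close> makes the left socle essential in
  \<open>Rg \<sigma>\<close>: the multiple with maximal annihilator generates a simple
  submodule.\<close>

lemma ex_LS:
  assumes "x \<in> Rg \<sigma>" "x \<noteq> \<zero>"
  obtains b where "b \<in> Rg E" "b \<otimes> x \<in> LS" "b \<otimes> x \<noteq> \<zero>" "maximal_left_ideal {r \<in> Rg E. r \<otimes> (b \<otimes> x) = \<zero>} B"
proof -
  obtain b where b: "b \<in> Rg E" and m: "maximal_left_ideal {r \<in> Rg E. r \<otimes> (b \<otimes> x) = \<zero>} B"
    using V.exists_maximal_ann[OF B.dcc, of x] assms by auto
  have bx: "b \<otimes> x \<in> Rg \<sigma>" using neutral_mult[OF s_carrier b assms(1)] .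
  have "b \<otimes> x \<noteq> \<zero>" using B.maximal_left_idealD(2)[OF m] one_mem by (auto simp: RgE)
  then show ?thesis using that b m maximal_ann_LS[OF bx m] by blast
qed

lemma ex_RS:
  assumes "x \<in> Rg \<sigma>" "x \<noteq> \<zero>" obtains b where "b \<in> Rg E" "x \<otimes> b \<in> RS" "x \<otimes> b \<noteq> \<zero>"
  using graded_artinian_ring.ex_LS[OF gart_opp, of x] assms by (auto simp: LS_opp)

lemma B_split:
  assumes "left_ideal B I" "JB \<subseteq> I"
  obtains e where "e \<in> Rg E" "\<one> \<ominus> e \<in> I" "\<And>y. y \<in> I \<Longrightarrow> y \<otimes> e \<in> JB" "e \<ominus> e \<otimes> e \<in> JB"
  using B.split_over_jacobson[OF assms] by (auto simp: B_minus one_mem E_mult)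

lemma B_split_right:
  assumes "left_ideal (opp_ring B) I" "JB \<subseteq> I"
  obtains e where "e \<in> Rg E" "\<one> \<ominus> e \<in> I" "\<And>y. y \<in> I \<Longrightarrow> e \<otimes> y \<in> JB" "e \<ominus> e \<otimes> e \<in> JB"
  using graded_artinian_ring.B_split[OF gart_opp, of I] assms by (auto simp: JB_opp opp_B)

lemma B_regular:
  assumes "a \<in> Rg E" obtains w where "w \<in> Rg E" "a \<ominus> a \<otimes> w \<otimes> a \<in> JB"
  using B.regular_mod_jacobson[of a] assms by (auto simp: B_minus E_mult)

lemma B_dedekind:
  assumes "u \<in> Rg E" "w \<in> Rg E" "\<one> \<ominus> u \<otimes> w \<in> JB" shows "\<one> \<ominus> w \<otimes> u \<in> JB"
  using B.dedekind_finite_mod_jacobson[of u w] assms by (auto simp: B_minus E_mult one_mem)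

lemma left_ideal_BI:
  assumes "I \<subseteq> Rg E" "\<zero> \<in> I" "\<And>x y. x \<in> I \<Longrightarrow> y \<in> I \<Longrightarrow> x \<oplus> y \<in> I"
    "\<And>r x. r \<in> Rg E \<Longrightarrow> x \<in> I \<Longrightarrow> r \<otimes> x \<in> I"
  shows "left_ideal B I"
  by (rule left_idealI) (use assms in auto)

lemma right_ideal_BI:
  assumes "I \<subseteq> Rg E" "\<zero> \<in> I" "\<And>x y. x \<in> I \<Longrightarrow> y \<in> I \<Longrightarrow> x \<oplus> y \<in> I"
    "\<And>r x. r \<in> Rg E \<Longrightarrow> x \<in> I \<Longrightarrow> x \<otimes> r \<in> I"
  shows "left_ideal (opp_ring B) I"
  by (rule left_idealI) (use assms in auto)

end

section \<open>Graded right ideals and annihilators\<close>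

context graded_ring_components
begin

lemma gr_gl_opp: "graded_left_ideal (opp_group G) I (opp_ring R) Rg = gr I"
  by (simp add: gr_conv)

lemma gl_gr_opp: "graded_right_ideal (opp_group G) I (opp_ring R) Rg = gl I"
  using graded_ring_components.gr_conv[OF gring_opp, of I] by simp

lemmas opp_simps = gr_gl_opp gl_gr_opp

lemma grD:
  assumes "gr I"
  shows "left_ideal (opp_ring R) I" "\<And>x g. x \<in> I \<Longrightarrow> g \<in> carrier G \<Longrightarrow> cmp x g \<in> I" "I \<subseteq> carrier R" "\<zero> \<in> I"
    "\<And>x y. x \<in> I \<Longrightarrow> y \<in> I \<Longrightarrow> x \<oplus> y \<in> I" "\<And>r x. r \<in> carrier R \<Longrightarrow> x \<in> I \<Longrightarrow> x \<otimes> r \<in> I"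
    "\<And>x. x \<in> I \<Longrightarrow> x \<in> carrier R"
  using graded_ring_components.glD[OF gring_opp assms[unfolded gr_conv]] by simp_all

abbreviation lann where "lann U \<equiv> {a \<in> carrier R. \<forall>x\<in>U. a \<otimes> x = \<zero>}"
abbreviation rann where "rann U \<equiv> {a \<in> carrier R. \<forall>x\<in>U. x \<otimes> a = \<zero>}"

text \<open>For homogeneous \<open>x\<close> of degree \<open>h\<close>, the component of
  \<open>a \<otimes> x\<close> in degree \<open>g h\<close> is the component of \<open>a\<close> in
  degree \<open>g\<close> times \<open>x\<close>. Hence the components of an annihilating
  \<open>a\<close> kill the components of every element of \<open>U\<close>.\<close>

lemma gl_lann: assumes "gr U" shows "gl (lann U)"
  unfolding gl_iff
proof (intro conjI ballI)
  note U = grD[OF assms]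
  show "left_ideal R (lann U)"
    by (rule left_idealI) (use U(7) in \<open>auto simp: l_distr m_assoc\<close>)
  fix a g assume a: "a \<in> lann U" and g: "g \<in> carrier G"
  have ac: "a \<in> carrier R" and ag: "cmp a g \<in> carrier R" using a g component_closed by auto
  have "cmp a g \<otimes> x = \<zero>" if x: "x \<in> U" for x
  proof -
    have "x \<in> {x \<in> carrier R. cmp a g \<otimes> x = \<zero>}"
    proof (rule mem_of_components[OF U(7)[OF x]])
      show "cmp x h \<in> {x \<in> carrier R. cmp a g \<otimes> x = \<zero>}" if h: "h \<in> carrier G" for h
      proof -
        have xh: "cmp x h \<in> U" "cmp x h \<in> Rg h" using U(2,7) component_mem x h by auto
        have gh: "g \<otimes>\<^bsub>G\<^esub> h \<in> carrier G" using g h by simp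
        have "cmp (a \<otimes> cmp x h) (g \<otimes>\<^bsub>G\<^esub> h) = cmp a (g \<otimes>\<^bsub>G\<^esub> h \<otimes>\<^bsub>G\<^esub> inv\<^bsub>G\<^esub> h) \<otimes> cmp x h"
          by (rule component_mult_right[OF h xh(2) ac gh])
        also have "a \<otimes> cmp x h = \<zero>" using a xh by blast
        finally show ?thesis using g h gh U(7)[OF xh(1)] by (simp add: G.m_assoc component_zero)
      qed
    qed (use ag in \<open>auto simp: r_distr\<close>)
    then show ?thesis by blast
  qed
  then show "cmp a g \<in> lann U" using ag by blast
qed

lemma gr_rann: "gl U \<Longrightarrow> gr (rann U)"
  using graded_ring_components.gl_lann[OF gring_opp, of U] by (simp add: opp_simps)

end

section \<open>Coincidence of the two socles\<close>

text \<open>Condition (2) with the isomorphisms replaced by generators. Passing to the opposite ring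
  exchanges \<open>s\<close> and \<open>s'\<close>.\<close>

locale cyclic_socles = graded_artinian_ring G R Rg \<sigma>
  for G :: "('g, 'e) monoid_scheme" and R :: "('a, 'b) ring_scheme" (structure)
    and Rg :: "'g \<Rightarrow> 'a set" and \<sigma> :: 'g +
  fixes s s' :: 'a
  assumes lfaithful: "left_faithful_at G R Rg \<sigma>" and rfaithful: "right_faithful_at G R Rg \<sigma>"
    and lgen: "lgen s" and rgen: "rgen s'"
begin

lemma frob_opp: "cyclic_socles (opp_group G) (opp_ring R) Rg \<sigma> s' s"
  using lfaithful rfaithful lgen rgen
  by (intro cyclic_socles.intro cyclic_socles_axioms.intro gart_opp)
     (simp_all add: lgen_opp rgen_opp left_faithful_at_def right_faithful_at_def opp_simps)

lemma s_LS: "s \<in> LS" and LS_eq: "LS = {b \<otimes> s | b. b \<in> Rg E}" and s_ann: "{b \<in> Rg E. b \<otimes> s = \<zero>} = JB"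
  using lgen unfolding lgen_def by blast+

lemma s'_RS: "s' \<in> RS" and RS_eq: "RS = {s' \<otimes> b | b. b \<in> Rg E}" and s'_ann: "{b \<in> Rg E. s' \<otimes> b = \<zero>} = JB"
  using rgen unfolding rgen_def by blast+

lemma s_c: "s \<in> carrier R" using LS_D(2)[OF s_LS] .
lemma s'_c: "s' \<in> carrier R" using RS_D(2)[OF s'_RS] .

text \<open>With \<open>e\<close> and \<open>f\<close> splitting off \<open>I\<close> and
  \<open>K\<close>, the element \<open>u = (\<one> \<ominus> f) \<otimes> e\<close> is nonzero
  modulo \<open>JB\<close> but killed there from the left by \<open>I\<close> and by
  \<open>f\<close>. So \<open>u \<otimes> s\<close> is a nonzero element of \<open>LS\<close> killed
  by \<open>I\<close>, and as \<open>RS\<close> is essential it has a nonzero right multiple in both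
  socles; right multiplication preserves what kills it from the left.\<close>

lemma separate_ideals:
  assumes I: "left_ideal B I" "JB \<subseteq> I" and K: "left_ideal B K" "I \<subset> K"
  obtains x where "x \<in> LS" "x \<in> RS" "\<And>a. a \<in> I \<Longrightarrow> a \<otimes> x = \<zero>" "\<exists>a\<in>K. a \<otimes> x \<noteq> \<zero>"
proof -
  obtain e where e: "e \<in> Rg E" "\<one> \<ominus> e \<in> I" "\<And>y. y \<in> I \<Longrightarrow> y \<otimes> e \<in> JB"
    using B_split[OF I] by metis
  obtain f where f: "f \<in> Rg E" "\<one> \<ominus> f \<in> K" "\<And>y. y \<in> K \<Longrightarrow> y \<otimes> f \<in> JB" "f \<ominus> f \<otimes> f \<in> JB"
    using B_split[OF K(1)] I(2) K(2) by blast
  note Ic = left_idealD[OF I(1), simplified] and Kc = left_idealD[OF K(1), simplified]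
  define k where "k = \<one> \<ominus> f"
  define u where "u = k \<otimes> e"
  have kE: "k \<in> Rg E" unfolding k_def by (rule E_minus[OF one_mem f(1)])
  have uE: "u \<in> Rg E" unfolding u_def by (rule E_mult[OF kE e(1)])
  note c = RgE[OF e(1)] RgE[OF f(1)] RgE[OF kE] RgE[OF uE]
  have fk: "f \<otimes> k \<in> JB"
  proof -
    have "f \<otimes> k = f \<ominus> f \<otimes> f" unfolding k_def using c r_one[of f] by algebra
    then show ?thesis using f(4) by simp
  qed
  have fu: "f \<otimes> u \<in> JB" unfolding u_def using JB_r[OF fk e(1)] c by (simp add: m_assoc)
  have Iu: "y \<otimes> u \<in> JB" if y: "y \<in> I" for y
  proof -
    have yc: "y \<in> carrier R" using Ic(5)[OF y] RgE by blast
    have "y \<otimes> u = y \<otimes> e \<ominus> (y \<otimes> f) \<otimes> e" unfolding u_def k_def using c yc r_one[of y] by algebra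
    moreover have "y \<otimes> f \<in> JB" using f(3) y K(2) by blast
    ultimately show ?thesis using JB_minus[OF e(3)[OF y] JB_r[OF _ e(1)]] by simp
  qed
  have "u \<notin> JB"
  proof
    assume u: "u \<in> JB"
    have "x \<in> I" if x: "x \<in> K" for x
    proof -
      have xE: "x \<in> Rg E" and xc: "x \<in> carrier R" using Kc(5)[OF x] RgE by blast+
      \<comment> \<open>With \<open>u\<close> in \<open>JB\<close>, all three summands lie in
        \<open>I\<close>, so \<open>K\<close> would not exceed \<open>I\<close>.\<close>
      have "x = x \<otimes> f \<oplus> x \<otimes> u \<oplus> (x \<otimes> k) \<otimes> (\<one> \<ominus> e)"
        unfolding u_def k_def using c xc r_one[of x] r_one[of "x \<otimes> f"] r_one[of f] by algebra
      moreover have "x \<otimes> f \<in> I" using f(3)[OF x] I(2) by blast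
      moreover have "x \<otimes> u \<in> I" using JB_l[OF u xE] I(2) by blast
      moreover have "(x \<otimes> k) \<otimes> (\<one> \<ominus> e) \<in> I" using Ic(4)[OF E_mult[OF xE kE] e(2)] .
      ultimately show ?thesis using Ic(3) by metis
    qed
    then show False using K(2) by blast
  qed
  then have us: "u \<otimes> s \<noteq> \<zero>" using s_ann uE by blast
  have usL: "u \<otimes> s \<in> LS" by (rule LS_l[OF s_LS uE])
  obtain b where b: "b \<in> Rg E" "u \<otimes> s \<otimes> b \<in> RS" "u \<otimes> s \<otimes> b \<noteq> \<zero>"
    using ex_RS[OF LS_D(1)[OF usL] us] .
  have kill: "a \<otimes> (u \<otimes> s \<otimes> b) = \<zero>" if "a \<in> carrier R" "a \<otimes> u \<in> JB" for a
  proof -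
    have "a \<otimes> (u \<otimes> s \<otimes> b) = (a \<otimes> u) \<otimes> s \<otimes> b" using that s_c c RgE[OF b(1)] by (simp add: m_assoc)
    then show ?thesis using LS_D(3)[OF s_LS that(2)] RgE[OF b(1)] by simp
  qed
  show ?thesis
  proof (rule that[OF LS_r[OF usL b(1)] b(2)])
    show "a \<otimes> (u \<otimes> s \<otimes> b) = \<zero>" if "a \<in> I" for a
      using kill[OF _ Iu[OF that]] Ic(5)[OF that] RgE by blast
    have xc: "u \<otimes> s \<otimes> b \<in> carrier R" using s_c c RgE[OF b(1)] by simp
    \<comment> \<open>Since \<open>f\<close> kills the element,
      \<open>k = \<one> \<ominus> f\<close> fixes it, and \<open>k\<close> is the required member of
      \<open>K\<close>.\<close>
    have "k \<otimes> (u \<otimes> s \<otimes> b) = u \<otimes> s \<otimes> b \<ominus> f \<otimes> (u \<otimes> s \<otimes> b)"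
      unfolding k_def using xc c(2) l_one[OF xc] by algebra
    also have "\<dots> = u \<otimes> s \<otimes> b" using kill[OF c(2) fu] xc by (simp add: minus_eq)
    finally show "\<exists>a\<in>K. a \<otimes> (u \<otimes> s \<otimes> b) \<noteq> \<zero>" using b(3) f(2) k_def by metis
  qed
qed

text \<open>This is the annihilator of \<open>I\<close> in the intersection of both socles,
  transported to \<open>B\<close> along left multiplication by \<open>s'\<close>, whose image is
  \<open>RS\<close> and whose kernel is \<open>JB\<close>. As a right ideal above \<open>JB\<close>
  it can be fed into the opposite construction.\<close>

definition dual_ideal :: "'a set \<Rightarrow> 'a set" where
  "dual_ideal I = {c \<in> Rg E. s' \<otimes> c \<in> LS \<and> (\<forall>a\<in>I. a \<otimes> (s' \<otimes> c) = \<zero>)}"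

lemma dual_ideal_right:
  assumes I: "left_ideal B I" shows "left_ideal (opp_ring B) (dual_ideal I)" "JB \<subseteq> dual_ideal I"
proof -
  note Ic = left_idealD[OF I, simplified]
  have Ica: "a \<in> carrier R" if "a \<in> I" for a using Ic(5)[OF that] RgE by blast
  show "left_ideal (opp_ring B) (dual_ideal I)"
  proof (rule right_ideal_BI)
    show "\<zero> \<in> dual_ideal I"
      unfolding dual_ideal_def using s'_c Ica by (auto simp: LS_zero summand_zero)
    show "x \<oplus> y \<in> dual_ideal I" if "x \<in> dual_ideal I" "y \<in> dual_ideal I" for x y
      using that s'_c Ica unfolding dual_ideal_def
      by (auto simp: r_distr RgE LS_add summand_add)
    show "x \<otimes> r \<in> dual_ideal I" if r: "r \<in> Rg E" and x: "x \<in> dual_ideal I" for r x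
    proof -
      have xE: "x \<in> Rg E" "s' \<otimes> x \<in> LS" using x unfolding dual_ideal_def by auto
      have "s' \<otimes> (x \<otimes> r) = (s' \<otimes> x) \<otimes> r" using s'_c RgE r xE by (simp add: m_assoc)
      moreover have "a \<otimes> ((s' \<otimes> x) \<otimes> r) = \<zero>" if "a \<in> I" for a
      proof -
        have "a \<otimes> ((s' \<otimes> x) \<otimes> r) = (a \<otimes> (s' \<otimes> x)) \<otimes> r"
          using s'_c RgE r xE Ica[OF that] by (simp add: m_assoc)
        also have "a \<otimes> (s' \<otimes> x) = \<zero>" using x that unfolding dual_ideal_def by blast
        finally show ?thesis using RgE[OF r] by simp
      qed
      ultimately show ?thesis unfolding dual_ideal_def using LS_r[OF xE(2) r] E_mult[OF xE(1) r] by simp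
    qed
  qed (auto simp: dual_ideal_def)
  show "JB \<subseteq> dual_ideal I"
    unfolding dual_ideal_def using RS_D(3)[OF s'_RS] JB_E Ica by (auto simp: LS_zero)
qed

lemma dual_ideal_strict:
  assumes I: "left_ideal B I" "JB \<subseteq> I" and K: "left_ideal B K" "I \<subset> K"
  shows "dual_ideal K \<subset> dual_ideal I"
proof -
  obtain x where x: "x \<in> LS" "x \<in> RS" "\<And>a. a \<in> I \<Longrightarrow> a \<otimes> x = \<zero>" "\<exists>a\<in>K. a \<otimes> x \<noteq> \<zero>"
    using separate_ideals[OF assms] by metis
  obtain c where c: "c \<in> Rg E" "x = s' \<otimes> c" using x(2) RS_eq by blast
  have "c \<in> dual_ideal I" "c \<notin> dual_ideal K" using x c unfolding dual_ideal_def by auto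
  moreover have "dual_ideal K \<subseteq> dual_ideal I" using K(2) unfolding dual_ideal_def by blast
  ultimately show ?thesis by blast
qed

definition dual_ideal' :: "'a set \<Rightarrow> 'a set" where
  "dual_ideal' K = {a \<in> Rg E. a \<otimes> s \<in> RS \<and> (\<forall>c\<in>K. (a \<otimes> s) \<otimes> c = \<zero>)}"

lemma dual_ideal_opp: "cyclic_socles.dual_ideal (opp_group G) (opp_ring R) Rg \<sigma> s = dual_ideal'"
  by (rule ext) (simp add: cyclic_socles.dual_ideal_def[OF frob_opp] dual_ideal'_def LS_opp)

lemma dual_ideal'_left:
  assumes K: "left_ideal (opp_ring B) K" shows "left_ideal B (dual_ideal' K)" "JB \<subseteq> dual_ideal' K"
  using cyclic_socles.dual_ideal_right[OF frob_opp, of K] K by (simp_all add: dual_ideal_opp JB_opp B.jacobson_opp flip: opp_B)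

lemma dual_ideal'_strict:
  assumes "left_ideal (opp_ring B) I" "JB \<subseteq> I" "left_ideal (opp_ring B) K" "I \<subset> K"
  shows "dual_ideal' K \<subset> dual_ideal' I"
  using cyclic_socles.dual_ideal_strict[OF frob_opp, of I K] assms by (simp add: dual_ideal_opp JB_opp B.jacobson_opp flip: opp_B)

text \<open>Composing the two strictly antitone maps gives a strictly monotone self-map of the left
  ideals above the radical; by the descending chain condition it cannot move the unit ideal down.\<close>

lemma s_RS: "s \<in> RS"
proof (rule ccontr)
  assume "s \<notin> RS"
  let ?D = "\<lambda>I. dual_ideal' (dual_ideal I)"
  let ?F = "\<lambda>I. left_ideal B I \<and> JB \<subseteq> I \<and> ?D I \<subset> I"
  have D: "left_ideal B (?D I)" "JB \<subseteq> ?D I" if "left_ideal B I" for I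
    using dual_ideal_right[OF that] dual_ideal'_left by blast+
  have mono: "?D I \<subset> ?D K" if "left_ideal B I" "JB \<subseteq> I" "left_ideal B K" "I \<subset> K" for I K
    by (rule dual_ideal'_strict[OF dual_ideal_right dual_ideal_right(1) dual_ideal_strict]) (use that in blast)+
  have B: "left_ideal B (Rg E)" using B.left_ideal_carrier by simp
  \<comment> \<open>Membership of \<open>\<one>\<close> in this set would mean that
    \<open>\<one> \<otimes> s\<close> lies in \<open>RS\<close>.\<close>
  have "\<one> \<notin> ?D (Rg E)" using \<open>s \<notin> RS\<close> s_c unfolding dual_ideal'_def by simp
  moreover have "?D (Rg E) \<subseteq> Rg E" unfolding dual_ideal'_def by blast
  ultimately have F0: "?F (Rg E)" using B JB_E one_mem by blast
  obtain I where I: "?F I" and mn: "\<And>K. ?F K \<Longrightarrow> K \<subseteq> I \<Longrightarrow> K = I"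
    using dcc_minimal[where F = ?F, OF B.dcc F0] by blast
  \<comment> \<open>Strict monotonicity of \<open>?D\<close> shows that the image of an ideal moved
    strictly down is again moved strictly down, against minimality.\<close>
  have "?F (?D I)" using D[of I] I mono[of "?D I" I] by blast
  then show False using mn[of "?D I"] I by blast
qed

lemma LS_sub_RS: "LS \<subseteq> RS"
  unfolding LS_eq using RS_l[OF s_RS] by blast

lemma LS_RS: "LS = RS"
  using LS_sub_RS cyclic_socles.LS_sub_RS[OF frob_opp] by (simp add: LS_opp RS_opp)

text \<open>Write \<open>s' = u \<otimes> s\<close>, \<open>s = s' \<otimes> v\<close> and
  \<open>s \<otimes> v = w \<otimes> s\<close>. Then \<open>u \<otimes> w\<close> fixes
  \<open>s\<close>, hence is \<open>\<one>\<close> modulo \<open>JB\<close>, and by Dedekind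
  finiteness so is \<open>w \<otimes> u\<close>. As \<open>JB\<close> kills \<open>LS\<close>, left
  multiplication by \<open>w\<close> undoes that by \<open>u\<close> and pulls
  \<open>RS = s' B\<close> back to \<open>s B\<close>.\<close>

lemma LS_s: "LS = {s \<otimes> b | b. b \<in> Rg E}"
proof
  show "{s \<otimes> b | b. b \<in> Rg E} \<subseteq> LS" using LS_r[OF s_LS] by blast
  have "s' \<in> LS" "s \<in> RS" using LS_RS s'_RS s_RS by auto
  then obtain u v where uv: "u \<in> Rg E" "s' = u \<otimes> s" "v \<in> Rg E" "s = s' \<otimes> v"
    using LS_eq RS_eq by blast
  have "s \<otimes> v \<in> LS" by (rule LS_r[OF s_LS uv(3)])
  then obtain w where w: "w \<in> Rg E" "s \<otimes> v = w \<otimes> s" using LS_eq by blast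
  note c = s_c RgE[OF uv(1)] RgE[OF uv(3)] RgE[OF w(1)]
  have "u \<otimes> w \<otimes> s = u \<otimes> (s \<otimes> v)" using w(2) c by (simp add: m_assoc)
  also have "\<dots> = s" using uv(4) c unfolding uv(2) by (simp add: m_assoc)
  finally have "u \<otimes> w \<otimes> s = s" .
  then have "(\<one> \<ominus> u \<otimes> w) \<otimes> s = \<zero>" using c by (simp add: minus_eq l_distr l_minus r_neg)
  then have "\<one> \<ominus> u \<otimes> w \<in> JB" using s_ann E_minus[OF one_mem E_mult[OF uv(1) w(1)]] by blast
  then have wu: "\<one> \<ominus> w \<otimes> u \<in> JB" using B_dedekind uv(1) w(1) by blast
  have wu_fixes: "w \<otimes> (u \<otimes> t) = t" if t: "t \<in> LS" for t
  proof -
    have tc: "t \<in> carrier R" using LS_D(2)[OF t] .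
    have "t \<ominus> w \<otimes> (u \<otimes> t) = (\<one> \<ominus> w \<otimes> u) \<otimes> t" using c tc l_one[OF tc] by algebra
    also have "\<dots> = \<zero>" by (rule LS_D(3)[OF t wu])
    finally show ?thesis using tc c minus_eq_zero_iff[of t "w \<otimes> (u \<otimes> t)"] by simp
  qed
  show "LS \<subseteq> {s \<otimes> b | b. b \<in> Rg E}"
  proof
    fix t assume t: "t \<in> LS"
    have "u \<otimes> t \<in> RS" using LS_l[OF t uv(1)] LS_RS by blast
    then obtain b where b: "b \<in> Rg E" "u \<otimes> t = s' \<otimes> b" using RS_eq by blast
    have "t = w \<otimes> (u \<otimes> s \<otimes> b)" using wu_fixes[OF t] b(2) uv(2) by simp
    also have "\<dots> = w \<otimes> (u \<otimes> s) \<otimes> b" using c RgE[OF b(1)] by (simp add: m_assoc)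
    also have "\<dots> = s \<otimes> b" using wu_fixes[OF s_LS] by simp
    finally show "t \<in> {s \<otimes> b | b. b \<in> Rg E}" using b(1) by blast
  qed
qed

text \<open>Write \<open>x = z \<otimes> s\<close> and take \<open>w\<close> from regularity. Then
  \<open>?q\<close> kills \<open>x\<close>, hence lies in the maximal ideal \<open>n\<close> and
  kills \<open>y\<close> too. So \<open>y = z \<otimes> (w \<otimes> y)\<close> with
  \<open>w \<otimes> y\<close> in \<open>s B\<close>, which makes \<open>y\<close> a right multiple
  of \<open>x\<close>.\<close>

lemma transitive_on_annihilated:
  assumes n: "maximal_left_ideal n B" and x: "x \<in> Rg \<sigma>" "x \<noteq> \<zero>" "\<And>a. a \<in> n \<Longrightarrow> a \<otimes> x = \<zero>"
    and y: "y \<in> Rg \<sigma>" "\<And>a. a \<in> n \<Longrightarrow> a \<otimes> y = \<zero>"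
  obtains b where "b \<in> Rg E" "y = x \<otimes> b"
proof -
  have Jn: "JB \<subseteq> n" by (rule B.jacobson_subset_maximal[OF n])
  note nl = B.maximal_left_idealD[OF n, simplified]
  have xL: "x \<in> LS" and yL: "y \<in> LS" using x y Jn by (auto intro: LS_I)
  obtain z where z: "z \<in> Rg E" "x = z \<otimes> s" using xL LS_eq by blast
  obtain w where w: "w \<in> Rg E" "z \<ominus> z \<otimes> w \<otimes> z \<in> JB" using B_regular[OF z(1)] .
  note c = s_c RgE[OF z(1)] RgE[OF w(1)]
  have xc: "x \<in> carrier R" and yc: "y \<in> carrier R" using xL yL LS_D(2) by blast+
  let ?q = "\<one> \<ominus> z \<otimes> w"
  have qE: "?q \<in> Rg E" by (rule E_minus[OF one_mem E_mult[OF z(1) w(1)]])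
  have "?q \<otimes> x = (z \<ominus> z \<otimes> w \<otimes> z) \<otimes> s" unfolding z(2) using c l_one[of z] by algebra
  then have qx: "?q \<otimes> x = \<zero>" using LS_D(3)[OF s_LS w(2)] by simp
  have "?q \<in> n"
  proof (rule ccontr)
    assume "?q \<notin> n"
    then obtain r m where r: "r \<in> Rg E" "m \<in> n" "\<one> = r \<otimes> ?q \<oplus> m" using nl(3)[OF qE] by blast
    have mc: "m \<in> carrier R" using left_idealD(5)[OF nl(1) r(2)] RgE by simp
    have "x = (r \<otimes> ?q \<oplus> m) \<otimes> x" using r(3) l_one[OF xc] by metis
    also have "\<dots> = r \<otimes> (?q \<otimes> x) \<oplus> m \<otimes> x" using RgE[OF r(1)] mc xc RgE[OF qE] by (simp add: l_distr m_assoc)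
    also have "\<dots> = \<zero>" using qx x(3)[OF r(2)] RgE[OF r(1)] by simp
    finally show False using x(2) by blast
  qed
  then have "?q \<otimes> y = \<zero>" by (rule y(2))
  then have yz: "y = z \<otimes> (w \<otimes> y)"
    using c yc minus_eq_zero_iff[of y "z \<otimes> (w \<otimes> y)"] by (simp add: minus_eq l_distr l_minus m_assoc)
  have "w \<otimes> y \<in> LS" by (rule LS_l[OF yL w(1)])
  then obtain b where b: "b \<in> Rg E" "w \<otimes> y = s \<otimes> b" using LS_s by blast
  have "y = x \<otimes> b" using yz c RgE[OF b(1)] unfolding b(2) z(2) by (simp add: m_assoc)
  then show ?thesis using that b(1) by blast
qed

end

section \<open>Faithfulness for homogeneous elements\<close>

context graded_artinian_ring
begin

lemma faithful_hom:
  assumes f: "left_faithful_at G R Rg \<sigma>" and h: "h \<in> carrier G" and x: "x \<in> Rg h" "x \<noteq> \<zero>"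
  obtains c where "c \<in> Rg (\<sigma> \<otimes>\<^bsub>G\<^esub> inv\<^bsub>G\<^esub> h)" "c \<otimes> x \<in> Rg \<sigma>" "c \<otimes> x \<noteq> \<zero>"
proof -
  let ?I = "{r \<otimes> x | r. r \<in> carrier R}"
  have xc: "x \<in> carrier R" using Rg_carrier[OF h x(1)] .
  have I: "gl ?I" by (rule gl_principal[OF h x(1)])
  have "\<one> \<otimes> x \<in> ?I" by blast
  then have "?I \<noteq> {\<zero>}" using x xc by auto
  then have "?I \<inter> Rg \<sigma> \<noteq> {\<zero>}" using f I unfolding left_faithful_at_def by blast
  moreover have "\<zero> \<in> ?I \<inter> Rg \<sigma>" using glD(4)[OF I] summand_zero[OF s_carrier] by blast
  ultimately obtain y where y: "y \<in> ?I" "y \<in> Rg \<sigma>" "y \<noteq> \<zero>" by blast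
  obtain c where "c \<in> Rg (\<sigma> \<otimes>\<^bsub>G\<^esub> inv\<^bsub>G\<^esub> h)" "y = c \<otimes> x"
    using principal_hom[OF h x(1) s_carrier y(2,1)] .
  then show ?thesis using that y by blast
qed

lemma faithful_hom_right:
  assumes f: "right_faithful_at G R Rg \<sigma>" and h: "h \<in> carrier G" and x: "x \<in> Rg h" "x \<noteq> \<zero>"
  obtains c where "c \<in> Rg (inv\<^bsub>G\<^esub> h \<otimes>\<^bsub>G\<^esub> \<sigma>)" "x \<otimes> c \<in> Rg \<sigma>" "x \<otimes> c \<noteq> \<zero>"
proof -
  have "left_faithful_at (opp_group G) (opp_ring R) Rg \<sigma>"
    using f by (simp add: left_faithful_at_def right_faithful_at_def opp_simps)
  then show ?thesis
    by (rule graded_artinian_ring.faithful_hom[OF gart_opp, of h x]) (use h x that in auto)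
qed

text \<open>Faithfulness forces every nonzero graded subideal to meet \<open>Rg \<sigma>\<close>,
  where the left ideal generated by \<open>x\<close> is just the simple module
  \<open>B x\<close>.\<close>

lemma minimal_of_maximal_ann:
  assumes f: "left_faithful_at G R Rg \<sigma>" and x: "x \<in> Rg \<sigma>"
    and m: "maximal_left_ideal {r \<in> Rg E. r \<otimes> x = \<zero>} B"
  shows "minimal_graded_left_ideal G {r \<otimes> x | r. r \<in> carrier R} R Rg"
proof -
  let ?I = "{r \<otimes> x | r. r \<in> carrier R}"
  have xc: "x \<in> carrier R" using Rg_carrier[OF s_carrier x] .
  have I: "gl ?I" by (rule gl_principal[OF s_carrier x])
  have "x \<noteq> \<zero>" using B.maximal_left_idealD(2)[OF m] one_mem by auto
  moreover have "\<one> \<otimes> x \<in> ?I" by blast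
  ultimately have ne: "?I \<noteq> {\<zero>}" using xc by auto
  have "K = {\<zero>} \<or> K = ?I" if K: "gl K" "K \<subseteq> ?I" for K
  proof (rule disjCI)
    assume nI: "K \<noteq> ?I"
    note Kc = glD[OF K(1)]
    show "K = {\<zero>}"
    proof (rule ccontr)
      assume "K \<noteq> {\<zero>}"
      then have "K \<inter> Rg \<sigma> \<noteq> {\<zero>}" using f K unfolding left_faithful_at_def by blast
      moreover have "\<zero> \<in> K \<inter> Rg \<sigma>" using Kc(4) summand_zero[OF s_carrier] by blast
      ultimately obtain k where k: "k \<in> K" "k \<in> Rg \<sigma>" "k \<noteq> \<zero>" by blast
      obtain a where a: "a \<in> Rg (\<sigma> \<otimes>\<^bsub>G\<^esub> inv\<^bsub>G\<^esub> \<sigma>)" "k = a \<otimes> x"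
        using principal_hom[OF s_carrier x s_carrier k(2)] k(1) K(2) by blast
      have aE: "a \<in> Rg E" using a(1) s_carrier by simp
      have "a \<notin> {r \<in> Rg E. r \<otimes> x = \<zero>}" using a k by blast
      then obtain r y where r: "r \<in> Rg E" "y \<in> Rg E" "y \<otimes> x = \<zero>" "\<one> = r \<otimes> a \<oplus> y"
        using B.maximal_left_idealD(3)[OF m, of a] aE by auto
      have "x = (r \<otimes> a \<oplus> y) \<otimes> x" using r(4) l_one[OF xc] by metis
      also have "\<dots> = r \<otimes> k" using RgE[OF r(1)] RgE[OF r(2)] RgE[OF aE] xc r(3) a(2)
        by (simp add: l_distr m_assoc)
      finally have "x \<in> K" using Kc(6)[OF RgE[OF r(1)] k(1)] by simp
      then have "?I \<subseteq> K" using Kc(6) by blast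
      then show False using nI K(2) by blast
    qed
  qed
  then show ?thesis unfolding minimal_graded_left_ideal_def using I ne by blast
qed

end

section \<open>Annihilators and the ascending chain condition\<close>

context graded_ring_components
begin

lemma gr_subset_hom:
  assumes "gr I" "gr K" "\<And>g x. g \<in> carrier G \<Longrightarrow> x \<in> Rg g \<Longrightarrow> x \<in> I \<Longrightarrow> x \<in> K"
  shows "I \<subseteq> K"
  using graded_ring_components.subset_hom[OF gring_opp, of I K] assms grD(1)[OF assms(2)] by (simp add: opp_simps)

lemma gl_maximal_big:
  assumes n: "maximal_left_ideal n B" and K: "gl K" "big E n \<subseteq> K" "\<one> \<notin> K" shows "K = big E n"
  using maximal_graded_big[OF n] K unfolding maximal_graded_left_ideal_def by auto

lemma gl_colon:
  assumes I: "gl I" and h: "h \<in> carrier G" and x: "x \<in> Rg h"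
  shows "gl {a \<in> carrier R. a \<otimes> x \<in> I}"
  unfolding gl_iff
proof (intro conjI ballI)
  note Ic = glD[OF I]
  have xc: "x \<in> carrier R" using Rg_carrier[OF h x] .
  show "left_ideal R {a \<in> carrier R. a \<otimes> x \<in> I}"
    by (rule left_idealI) (use xc Ic in \<open>auto simp: l_distr m_assoc\<close>)
  fix a g assume a: "a \<in> {a \<in> carrier R. a \<otimes> x \<in> I}" and g: "g \<in> carrier G"
  have gh: "g \<otimes>\<^bsub>G\<^esub> h \<in> carrier G" using g h by simp
  have "cmp (a \<otimes> x) (g \<otimes>\<^bsub>G\<^esub> h) = cmp a (g \<otimes>\<^bsub>G\<^esub> h \<otimes>\<^bsub>G\<^esub> inv\<^bsub>G\<^esub> h) \<otimes> x"
    using component_mult_right[OF h x _ gh] a by blast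
  then have "cmp (a \<otimes> x) (g \<otimes>\<^bsub>G\<^esub> h) = cmp a g \<otimes> x" using g h by (simp add: G.m_assoc)
  moreover have "cmp (a \<otimes> x) (g \<otimes>\<^bsub>G\<^esub> h) \<in> I" using Ic(2) a gh by blast
  ultimately show "cmp a g \<in> {a \<in> carrier R. a \<otimes> x \<in> I}" using a g component_closed by simp
qed

lemma gr_image:
  assumes U: "gr U" and h: "h \<in> carrier G" and y: "y \<in> Rg h"
  shows "gr {y \<otimes> c | c. c \<in> U}"
proof -
  interpret o: graded_ring_components "opp_group G" "opp_ring R" Rg by (rule gring_opp)
  note Uc = grD[OF U]
  have yc: "y \<in> carrier R" using Rg_carrier[OF h y] .
  show ?thesis
    unfolding gr_conv o.gl_iff
  proof (intro conjI ballI)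
    show "left_ideal (opp_ring R) {y \<otimes> c | c. c \<in> U}"
    proof (rule left_idealI; simp)
      show "{y \<otimes> c | c. c \<in> U} \<subseteq> carrier R" using Uc(7) yc by auto
      show "\<exists>c. \<zero> = y \<otimes> c \<and> c \<in> U" using Uc(4) yc by (metis r_null)
      show "\<exists>c. x \<oplus> z = y \<otimes> c \<and> c \<in> U" if x: "\<exists>c. x = y \<otimes> c \<and> c \<in> U" and z: "\<exists>c. z = y \<otimes> c \<and> c \<in> U" for x z
      proof -
        from x obtain c where c: "x = y \<otimes> c" "c \<in> U" by blast
        from z obtain d where d: "z = y \<otimes> d" "d \<in> U" by blast
        have "x \<oplus> z = y \<otimes> (c \<oplus> d)" using c d yc Uc(7) by (simp add: r_distr)
        then show ?thesis using Uc(5)[OF c(2) d(2)] by blast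
      qed
      show "\<exists>c. x \<otimes> r = y \<otimes> c \<and> c \<in> U" if r: "r \<in> carrier R" and x: "\<exists>c. x = y \<otimes> c \<and> c \<in> U" for x r
      proof -
        from x obtain c where c: "x = y \<otimes> c" "c \<in> U" by blast
        have "x \<otimes> r = y \<otimes> (c \<otimes> r)" using c r yc Uc(7) by (simp add: m_assoc)
        then show ?thesis using Uc(6)[OF r c(2)] by blast
      qed
    qed
    fix z g assume z: "z \<in> {y \<otimes> c | c. c \<in> U}" and "g \<in> carrier (opp_group G)"
    then have g: "g \<in> carrier G" by simp
    obtain c where c: "z = y \<otimes> c" "c \<in> U" using z by blast
    have "cmp z g = y \<otimes> cmp c (inv\<^bsub>G\<^esub> h \<otimes>\<^bsub>G\<^esub> g)" using component_mult_left[OF h y Uc(7)[OF c(2)] g] c by simp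
    moreover have "cmp c (inv\<^bsub>G\<^esub> h \<otimes>\<^bsub>G\<^esub> g) \<in> U" using Uc(2)[OF c(2)] g h by simp
    ultimately show "o.cmp z g \<in> {y \<otimes> c | c. c \<in> U}" by auto
  qed
qed

lemma gr_Int: "gr I \<Longrightarrow> gr K \<Longrightarrow> gr (I \<inter> K)"
  using graded_ring_components.gl_Int[OF gring_opp, of I K] by (simp add: opp_simps)

text \<open>The colon ideal of all \<open>a\<close> with \<open>a \<otimes> x\<close> in the left
  ideal of \<open>p \<otimes> x\<close> contains \<open>big E n\<close> and also \<open>p\<close>,
  which is outside \<open>big E n\<close>. By maximality it contains \<open>\<one>\<close>, so
  multiplication by \<open>p\<close> can be undone.\<close>

lemma ann_big:
  assumes n: "maximal_left_ideal n B" and h: "h \<in> carrier G" and x: "x \<in> Rg h"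
    and nx: "\<And>a. a \<in> big E n \<Longrightarrow> a \<otimes> x = \<zero>"
    and k: "k \<in> carrier G" and p: "p \<in> Rg k" "p \<otimes> x \<noteq> \<zero>"
  obtains q where "q \<in> carrier R" "x = q \<otimes> (p \<otimes> x)"
proof -
  have xc: "x \<in> carrier R" using Rg_carrier[OF h x] .
  have pc: "p \<in> carrier R" using Rg_carrier[OF k p(1)] .
  have px: "p \<otimes> x \<in> Rg (k \<otimes>\<^bsub>G\<^esub> h)" using mult_mem[OF k h p(1) x] .
  have kh: "k \<otimes>\<^bsub>G\<^esub> h \<in> carrier G" using k h by simp
  let ?P = "{r \<otimes> (p \<otimes> x) | r. r \<in> carrier R}"
  have P: "gl ?P" by (rule gl_principal[OF kh px])
  let ?K = "{a \<in> carrier R. a \<otimes> x \<in> ?P}"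
  have K: "gl ?K" by (rule gl_colon[OF P h x])
  have gn: "gl (big E n)" using maximal_graded_big[OF n] unfolding maximal_graded_left_ideal_def by blast
  have "big E n \<subseteq> ?K"
    using nx glD(7)[OF gn] glD(4)[OF P] by auto
  moreover have "p \<in> ?K"
  proof -
    have "p \<otimes> x = \<one> \<otimes> (p \<otimes> x)" using pc xc by simp
    then show ?thesis using pc one_closed by blast
  qed
  moreover have "p \<notin> big E n" using nx p by blast
  ultimately have "\<one> \<in> ?K" using gl_maximal_big[OF n K] by blast
  then show ?thesis using that xc by auto
qed

text \<open>The predicate \<open>P\<close> is a parameter so that left and right ideals share one
  notion.\<close>

definition covers :: "('c set \<Rightarrow> bool) \<Rightarrow> 'c set \<Rightarrow> 'c set \<Rightarrow> bool" where
  "covers P I I' \<longleftrightarrow> P I \<and> P I' \<and> I \<subset> I' \<and> (\<forall>K. P K \<and> I \<subseteq> K \<and> K \<subseteq> I' \<longrightarrow> K = I \<or> K = I')"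

lemma cover_hom:
  assumes "covers gl I I'"
  obtains g y where "g \<in> carrier G" "y \<in> Rg g" "y \<in> I'" "y \<notin> I"
proof -
  have I: "gl I" "gl I'" "\<not> I' \<subseteq> I" using assms unfolding covers_def by blast+
  show ?thesis
  proof (rule ccontr)
    assume nt: "\<not> thesis"
    note th = that
    have "I' \<subseteq> I" by (rule subset_hom[OF I(2) glD(1)[OF I(1)]]) (use th nt in blast)
    then show False using I by blast
  qed
qed

text \<open>The quotient of \<open>I'\<close> by \<open>I\<close> is graded simple and generated by
  the class of \<open>y\<close>. An \<open>a\<close> in \<open>big E n\<close> with
  \<open>a \<otimes> y\<close> outside \<open>I\<close> would generate \<open>I'\<close> together
  with \<open>I\<close>, giving \<open>y = i \<oplus> r \<otimes> (a \<otimes> y)\<close> and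
  forcing \<open>\<one>\<close> into \<open>big E n\<close>.\<close>

lemma cover_annihilator:
  assumes cov: "covers gl I I'" and g: "g \<in> carrier G" and y: "y \<in> Rg g" "y \<in> I'" "y \<notin> I"
  obtains n where "maximal_left_ideal n B" "\<And>a. a \<in> big E n \<Longrightarrow> a \<otimes> y \<in> I"
proof -
  have I: "gl I" and I': "gl I'" and sub: "I \<subseteq> I'"
    and mn: "\<And>K. gl K \<Longrightarrow> I \<subseteq> K \<Longrightarrow> K \<subseteq> I' \<Longrightarrow> K = I \<or> K = I'"
    using cov unfolding covers_def by blast+
  note Ic = glD[OF I] and I'c = glD[OF I']
  have yc: "y \<in> carrier R" using Rg_carrier[OF g y(1)] .
  let ?m = "{a \<in> carrier R. a \<otimes> y \<in> I}"
  have m: "gl ?m" by (rule gl_colon[OF I g y(1)])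
  have "\<one> \<notin> ?m" using y yc by simp
  then obtain n where n: "maximal_left_ideal n B" "?m \<subseteq> big E n" using proper_gl_big[OF m] by blast
  have bn: "bsub E n" using B.maximal_left_idealD(1)[OF n(1)] left_ideal_B by blast
  have gn: "gl (big E n)" using gl_big[OF G.one_closed bn] .
  have n1: "\<one> \<notin> big E n"
    using big_Int[OF G.one_closed bn] B.maximal_left_idealD(2)[OF n(1)] one_mem by auto
  have "big E n \<subseteq> ?m"
  proof (rule subset_hom[OF gn glD(1)[OF m]])
    fix k a assume k: "k \<in> carrier G" and a: "a \<in> Rg k" "a \<in> big E n"
    have ac: "a \<in> carrier R" using Rg_carrier[OF k a(1)] .
    have "a \<otimes> y \<in> I"
    proof (rule ccontr)
      assume ay: "a \<otimes> y \<notin> I"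
      have ayd: "a \<otimes> y \<in> Rg (k \<otimes>\<^bsub>G\<^esub> g)" using mult_mem[OF k g a(1) y(1)] .
      have kg: "k \<otimes>\<^bsub>G\<^esub> g \<in> carrier G" using k g by simp
      let ?P = "{r \<otimes> (a \<otimes> y) | r. r \<in> carrier R}"
      let ?K = "{i \<oplus> z | i z. i \<in> I \<and> z \<in> ?P}"
      have P: "gl ?P" by (rule gl_principal[OF kg ayd])
      have K: "gl ?K" by (rule gl_sum[OF I P])
      have IK: "I \<subseteq> ?K"
      proof
        fix i assume i: "i \<in> I"
        then have "i = i \<oplus> \<zero>" using Ic(7) by simp
        then show "i \<in> ?K" using i glD(4)[OF P] by blast
      qed
      have KI: "?K \<subseteq> I'"
      proof -
        have "r \<otimes> (a \<otimes> y) \<in> I'" if "r \<in> carrier R" for r using I'c(6) y(2) ac that by blast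
        then show ?thesis using I'c(5) sub by blast
      qed
      have ayK: "a \<otimes> y \<in> ?K"
      proof -
        have "a \<otimes> y = \<zero> \<oplus> \<one> \<otimes> (a \<otimes> y)" using ac yc by simp
        then show ?thesis using Ic(4) one_closed by blast
      qed
      define Q where "Q = ?K"
      have "Q = I \<or> Q = I'" unfolding Q_def by (rule mn[OF K IK KI])
      moreover have "a \<otimes> y \<in> Q" unfolding Q_def by (rule ayK)
      ultimately have "y \<in> Q" using ay y(2) by blast
      then have "y \<in> ?K" unfolding Q_def .
      then obtain i z where iz: "i \<in> I" "z \<in> ?P" "y = i \<oplus> z" by auto
      then obtain r where r: "r \<in> carrier R" "z = r \<otimes> (a \<otimes> y)" by auto
      have ir: "i \<in> I" "r \<in> carrier R" "y = i \<oplus> r \<otimes> (a \<otimes> y)"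
        by (rule iz(1), rule r(1), rule trans[OF iz(3)], simp only: r(2))
      have ic: "i \<in> carrier R" using Ic(7) ir by blast
      have "(\<one> \<ominus> r \<otimes> a) \<otimes> y = y \<ominus> r \<otimes> (a \<otimes> y)" using ir(2) ac yc l_one[OF yc] by algebra
      also have "\<dots> = i" by (subst (1) ir(3)) (use ic ir(2) ac yc in algebra)
      finally have "\<one> \<ominus> r \<otimes> a \<in> ?m" using ir ac by simp
      then have "\<one> \<ominus> r \<otimes> a \<in> big E n" using n(2) by blast
      then have "(\<one> \<ominus> r \<otimes> a) \<oplus> r \<otimes> a \<in> big E n" using glD(5,6)[OF gn] a ir(2) by blast
      then show False using n1 ir(2) ac by (simp add: minus_eq a_assoc l_neg)
    qed
    then show "a \<in> ?m" using ac by blast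
  qed
  then show ?thesis using that n(1) by blast
qed

end

section \<open>Minimality of right annihilators and its effect on covers\<close>

context cyclic_socles
begin

text \<open>In degree \<sigma> a nonzero element of \<open>T\<close> reaches everything by
  \<open>transitive_on_annihilated\<close>. A homogeneous \<open>y\<close> of another degree is
  moved into \<open>LS\<close> by a left factor \<open>p\<close> that can be undone. As
  \<open>LS = RS\<close>, it follows that \<open>JB\<close> kills \<open>y\<close> on the right, so
  the right ideal of all \<open>c\<close> with \<open>y \<otimes> c\<close> in \<open>T\<close> can
  be split off by an idempotent \<open>e\<close> modulo \<open>JB\<close>. It remains to see that
  \<open>y \<otimes> e\<close> vanishes.\<close>

lemma rann_big_minimal:
  assumes n: "maximal_left_ideal n B" and T: "gr T" "T \<subseteq> rann (big E n)" "T \<noteq> {\<zero>}"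
  shows "rann (big E n) = T"
proof
  show "T \<subseteq> rann (big E n)" by fact
  note Tc = grD[OF T(1)]
  have bn: "bsub E n" using B.maximal_left_idealD(1)[OF n] left_ideal_B by blast
  have gn: "gl (big E n)" using gl_big[OF G.one_closed bn] .
  have nbig: "n \<subseteq> big E n" using big_Int[OF G.one_closed bn] by blast
  have "T \<inter> Rg \<sigma> \<noteq> {\<zero>}" using rfaithful T unfolding right_faithful_at_def by blast
  moreover have "\<zero> \<in> T \<inter> Rg \<sigma>" using Tc(4) summand_zero[OF s_carrier] by blast
  ultimately obtain x where x: "x \<in> T" "x \<in> Rg \<sigma>" "x \<noteq> \<zero>" by blast
  have xn: "a \<otimes> x = \<zero>" if "a \<in> n" for a using that nbig x T(2) by blast
  have deg_s: "v \<in> T" if v: "v \<in> Rg \<sigma>" "v \<in> rann (big E n)" for v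
  proof -
    have "a \<otimes> v = \<zero>" if "a \<in> n" for a using that nbig v by blast
    then obtain b where "b \<in> Rg E" "v = x \<otimes> b"
      using transitive_on_annihilated[OF n x(2,3) xn v(1)] by blast
    then show ?thesis using Tc(6) x(1) RgE by blast
  qed
  show "rann (big E n) \<subseteq> T"
  proof (rule gr_subset_hom[OF gr_rann[OF gn] T(1)])
    fix \<tau> y assume t: "\<tau> \<in> carrier G" and y: "y \<in> Rg \<tau>" "y \<in> rann (big E n)"
    show "y \<in> T"
    proof (cases "y = \<zero>")
      case True
      then show ?thesis using Tc(4) by simp
    next
      case False
      have yc: "y \<in> carrier R" using y by blast
      have ny: "a \<otimes> y = \<zero>" if "a \<in> big E n" for a using y that by blast
      obtain p0 where p0: "p0 \<in> Rg (\<sigma> \<otimes>\<^bsub>G\<^esub> inv\<^bsub>G\<^esub> \<tau>)" "p0 \<otimes> y \<in> Rg \<sigma>" "p0 \<otimes> y \<noteq> \<zero>"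
        using faithful_hom[OF lfaithful t y(1) False] by blast
      obtain b0 where b0: "b0 \<in> Rg E" "b0 \<otimes> (p0 \<otimes> y) \<in> LS" "b0 \<otimes> (p0 \<otimes> y) \<noteq> \<zero>"
        using ex_LS[OF p0(2,3)] by metis
      define p where "p = b0 \<otimes> p0"
      have st: "\<sigma> \<otimes>\<^bsub>G\<^esub> inv\<^bsub>G\<^esub> \<tau> \<in> carrier G" using s_carrier t by simp
      have pd: "p \<in> Rg (\<sigma> \<otimes>\<^bsub>G\<^esub> inv\<^bsub>G\<^esub> \<tau>)" unfolding p_def by (rule neutral_mult[OF st b0(1) p0(1)])
      have pc: "p \<in> carrier R" using Rg_carrier[OF st pd] .
      have py: "p \<otimes> y \<in> LS" "p \<otimes> y \<noteq> \<zero>"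
        using b0 RgE[OF b0(1)] Rg_carrier[OF st p0(1)] yc unfolding p_def by (simp_all add: m_assoc)
      obtain q where q: "q \<in> carrier R" "y = q \<otimes> (p \<otimes> y)"
        using ann_big[OF n t y(1) ny st pd py(2)] by blast
      have qz: "q \<otimes> ((p \<otimes> y) \<otimes> z) = y \<otimes> z" if "z \<in> carrier R" for z
        using q(1) pc yc that by (subst (2) q(2)) (simp add: m_assoc)
      have yJ: "y \<otimes> j = \<zero>" if j: "j \<in> JB" for j
      proof -
        have "(p \<otimes> y) \<otimes> j = \<zero>" using py(1) LS_RS RS_D(3) j by blast
        then show ?thesis using qz[OF JB_c[OF j]] q(1) by simp
      qed
      let ?I = "{c \<in> Rg E. y \<otimes> c \<in> T}"
      have I: "left_ideal (opp_ring B) ?I"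
      proof (rule right_ideal_BI)
        show "\<zero> \<in> ?I" using summand_zero Tc(4) yc by simp
        show "a \<oplus> b \<in> ?I" if "a \<in> ?I" "b \<in> ?I" for a b
          using that Tc(5) yc by (auto simp: r_distr RgE summand_add)
        show "a \<otimes> r \<in> ?I" if r: "r \<in> Rg E" and a: "a \<in> ?I" for r a
          using Tc(6)[OF RgE[OF r], of "y \<otimes> a"] a yc E_mult[of a r] r by (simp add: RgE m_assoc)
      qed blast
      have JI: "JB \<subseteq> ?I" using yJ JB_E Tc(4) by auto
      obtain e where e: "e \<in> Rg E" "\<one> \<ominus> e \<in> ?I" "\<And>c. c \<in> ?I \<Longrightarrow> e \<otimes> c \<in> JB" "e \<ominus> e \<otimes> e \<in> JB"
        using B_split_right[OF I JI] by blast
      have ec: "e \<in> carrier R" using RgE[OF e(1)] .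
      have "y \<otimes> e = \<zero>"
      proof (rule ccontr)
        assume ye: "y \<otimes> e \<noteq> \<zero>"
        have yed: "y \<otimes> e \<in> Rg \<tau>" by (rule mult_neutral[OF t y(1) e(1)])
        obtain c where c: "c \<in> Rg (inv\<^bsub>G\<^esub> \<tau> \<otimes>\<^bsub>G\<^esub> \<sigma>)" "y \<otimes> e \<otimes> c \<in> Rg \<sigma>" "y \<otimes> e \<otimes> c \<noteq> \<zero>"
          using faithful_hom_right[OF rfaithful t yed ye] by blast
        have ts: "inv\<^bsub>G\<^esub> \<tau> \<otimes>\<^bsub>G\<^esub> \<sigma> \<in> carrier G" using s_carrier t by simp
        have cc: "c \<in> carrier R" using Rg_carrier[OF ts c(1)] .
        have "a \<otimes> (y \<otimes> e \<otimes> c) = \<zero>" if "a \<in> big E n" for a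
        proof -
          have "a \<otimes> (y \<otimes> e \<otimes> c) = (a \<otimes> y) \<otimes> e \<otimes> c" using glD(7)[OF gn that] yc ec cc by (simp add: m_assoc)
          then show ?thesis using ny[OF that] ec cc by simp
        qed
        then have yecT: "y \<otimes> e \<otimes> c \<in> T" using deg_s c(2) yc ec cc by simp
        \<comment> \<open>Right faithfulness is applied to \<open>?t\<close> because
          \<open>y \<otimes> e \<otimes> c\<close> already has degree \<sigma>. Replacing
          \<open>y\<close> by \<open>p \<otimes> y\<close>, which has degree \<sigma>, makes the
          degree of \<open>d\<close> inverse to that of \<open>c\<close>, so that
          \<open>c \<otimes> d\<close> is neutral.\<close>
        let ?t = "p \<otimes> y \<otimes> e \<otimes> c"
        have "q \<otimes> ?t = y \<otimes> e \<otimes> c"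
          using qz[of "e \<otimes> c"] pc yc ec cc by (simp add: m_assoc)
        then have t0: "?t \<noteq> \<zero>" using c(3) q(1) by auto
        have pye: "p \<otimes> y \<otimes> e \<in> Rg \<sigma>" using mult_neutral[OF s_carrier LS_D(1)[OF py(1)] e(1)] .
        have td: "?t \<in> Rg (\<sigma> \<otimes>\<^bsub>G\<^esub> (inv\<^bsub>G\<^esub> \<tau> \<otimes>\<^bsub>G\<^esub> \<sigma>))" by (rule mult_mem[OF s_carrier ts pye c(1)])
        have std: "\<sigma> \<otimes>\<^bsub>G\<^esub> (inv\<^bsub>G\<^esub> \<tau> \<otimes>\<^bsub>G\<^esub> \<sigma>) \<in> carrier G" using s_carrier ts by simp
        let ?k = "inv\<^bsub>G\<^esub> (\<sigma> \<otimes>\<^bsub>G\<^esub> (inv\<^bsub>G\<^esub> \<tau> \<otimes>\<^bsub>G\<^esub> \<sigma>)) \<otimes>\<^bsub>G\<^esub> \<sigma>"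
        obtain d where d: "d \<in> Rg ?k" "?t \<otimes> d \<in> Rg \<sigma>" "?t \<otimes> d \<noteq> \<zero>"
          using faithful_hom_right[OF rfaithful std td t0] by blast
        have kc: "?k \<in> carrier G" using std s_carrier by simp
        have dc: "d \<in> carrier R" using Rg_carrier[OF kc d(1)] .
        have "inv\<^bsub>G\<^esub> \<tau> \<otimes>\<^bsub>G\<^esub> \<sigma> \<otimes>\<^bsub>G\<^esub> ?k = E"
          using s_carrier t by (simp add: G.inv_mult_group G.m_assoc) (simp add: G.m_assoc[symmetric])
        then have cdE: "c \<otimes> d \<in> Rg E" using mult_mem[OF ts kc c(1) d(1)] by simp
        \<comment> \<open>Now \<open>e \<otimes> (c \<otimes> d)\<close> lies in \<open>?I\<close>,
          which \<open>e\<close> annihilates modulo \<open>JB\<close>. Idempotency of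
          \<open>e\<close> puts it into \<open>JB\<close>, and this contradicts the choice of
          \<open>d\<close>.\<close>
        have "y \<otimes> (e \<otimes> (c \<otimes> d)) \<in> T"
          using Tc(6)[OF dc yecT] yc ec cc dc by (simp add: m_assoc)
        then have "e \<otimes> (c \<otimes> d) \<in> ?I" using E_mult[OF e(1) cdE] by blast
        then have 1: "e \<otimes> (e \<otimes> (c \<otimes> d)) \<in> JB" by (rule e(3))
        have 2: "(e \<ominus> e \<otimes> e) \<otimes> (c \<otimes> d) \<in> JB" by (rule JB_r[OF e(4) cdE])
        have "e \<otimes> (c \<otimes> d) = e \<otimes> (e \<otimes> (c \<otimes> d)) \<oplus> (e \<ominus> e \<otimes> e) \<otimes> (c \<otimes> d)" using ec cc dc by algebra
        then have "e \<otimes> (c \<otimes> d) \<in> JB" using JB_add[OF 1 2] by simp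
        then have "y \<otimes> (e \<otimes> (c \<otimes> d)) = \<zero>" by (rule yJ)
        moreover have "?t \<otimes> d = p \<otimes> (y \<otimes> (e \<otimes> (c \<otimes> d)))" using pc yc ec cc dc by (simp add: m_assoc)
        ultimately show False using d(3) pc by simp
      qed
      moreover have "y \<otimes> (\<one> \<ominus> e) = y \<ominus> y \<otimes> e" using yc ec r_one[OF yc] by algebra
      ultimately have "y = y \<otimes> (\<one> \<ominus> e)" using yc by (simp add: minus_eq)
      then show ?thesis using e(2) by simp
    qed
  qed
qed

text \<open>Left multiplication by \<open>y\<close> maps \<open>rann I\<close> into
  \<open>rann (big E n)\<close>, and its kernel within \<open>rann I\<close> is
  \<open>rann I'\<close>. The target has no proper nonzero graded right subideal, so the image of
  \<open>U\<close> is zero or everything.\<close>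

lemma rann_cover:
  assumes cov: "covers gl I I'" and U: "gr U" "rann I' \<subseteq> U" "U \<subseteq> rann I"
  shows "U = rann I' \<or> U = rann I"
proof -
  obtain g y where g: "g \<in> carrier G" and y: "y \<in> Rg g" "y \<in> I'" "y \<notin> I" using cover_hom[OF cov] .
  obtain n where n: "maximal_left_ideal n B" "\<And>a. a \<in> big E n \<Longrightarrow> a \<otimes> y \<in> I"
    using cover_annihilator[OF cov g y] by blast
  have I: "gl I" and I': "gl I'" and sub: "I \<subseteq> I'"
    and mn: "\<And>K. gl K \<Longrightarrow> I \<subseteq> K \<Longrightarrow> K \<subseteq> I' \<Longrightarrow> K = I \<or> K = I'"
    using cov unfolding covers_def by blast+
  note Uc = grD[OF U(1)] and Ic = glD[OF I]
  have yc: "y \<in> carrier R" using Rg_carrier[OF g y(1)] .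
  have gn: "gl (big E n)" using maximal_graded_big[OF n(1)] unfolding maximal_graded_left_ideal_def by blast
  have ker: "c \<in> rann I'" if c: "c \<in> rann I" "y \<otimes> c = \<zero>" for c
  proof -
    \<comment> \<open>The kernel of multiplication by \<open>y\<close> on \<open>rann I\<close>. Its
      left annihilator contains \<open>I\<close> and \<open>y\<close>, hence all of
      \<open>I'\<close> by the covering property.\<close>
    let ?W = "rann I \<inter> rann {r \<otimes> y | r. r \<in> carrier R}"
    have W: "gr ?W" by (intro gr_Int gr_rann I gl_principal[OF g y(1)])
    have "gl (I' \<inter> lann ?W)" by (intro gl_Int I' gl_lann W)
    moreover have "I \<subseteq> I' \<inter> lann ?W" using sub Ic(7) by auto
    moreover have "y \<in> lann ?W"
    proof -
      have "\<one> \<otimes> y = y" using yc by simp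
      then have "y \<in> {r \<otimes> y | r. r \<in> carrier R}" using one_closed by (metis (mono_tags, lifting) mem_Collect_eq)
      then show ?thesis using yc by blast
    qed
    ultimately have "I' \<inter> lann ?W = I'" using mn[of "I' \<inter> lann ?W"] y by blast
    moreover have "c \<in> ?W" using c yc by (auto simp: m_assoc)
    ultimately show ?thesis using c by blast
  qed
  let ?Y = "{y \<otimes> c | c. c \<in> U}"
  have Y: "gr ?Y" by (rule gr_image[OF U(1) g y(1)])
  have Yn: "y \<otimes> c \<in> rann (big E n)" if c: "c \<in> rann I" for c
  proof -
    have "a \<otimes> (y \<otimes> c) = \<zero>" if a: "a \<in> big E n" for a
    proof -
      have "a \<otimes> (y \<otimes> c) = (a \<otimes> y) \<otimes> c" using glD(7)[OF gn a] yc c by (simp add: m_assoc)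
      also have "\<dots> = \<zero>" using n(2)[OF a] c by blast
      finally show ?thesis .
    qed
    then show ?thesis using yc c by simp
  qed
  show ?thesis
  proof (cases "?Y = {\<zero>}")
    case True
    then have "U \<subseteq> rann I'" using ker U(3) by blast
    then show ?thesis using U(2) by blast
  next
    case False
    have "?Y \<subseteq> rann (big E n)" using Yn U(3) by blast
    then have eq: "rann (big E n) = ?Y" by (rule rann_big_minimal[OF n(1) Y _ False])
    have "c \<in> U" if c: "c \<in> rann I" for c
    proof -
      have "y \<otimes> c \<in> ?Y" using Yn[OF c] eq by blast
      then obtain d where d: "d \<in> U" "y \<otimes> c = y \<otimes> d" by blast
      have dc: "d \<in> carrier R" "c \<in> carrier R" using Uc(7) d c by auto
      have "c \<ominus> d \<in> rann I" using c d U(3) dc Ic(7) by (auto simp: minus_eq r_distr r_minus)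
      moreover have "y \<otimes> (c \<ominus> d) = \<zero>" using d(2) yc dc by (simp add: minus_eq r_distr r_minus r_neg)
      ultimately have "c \<ominus> d \<in> U" using ker U(2) by blast
      then have "(c \<ominus> d) \<oplus> d \<in> U" using Uc(5) d(1) by blast
      then show ?thesis using dc by (simp add: minus_eq a_assoc l_neg)
    qed
    then show ?thesis using U(3) by blast
  qed
qed

lemma lann_cover:
  assumes "covers gr I I'" "gl U" "lann I' \<subseteq> U" "U \<subseteq> lann I"
  shows "U = lann I' \<or> U = lann I"
proof -
  interpret o: cyclic_socles "opp_group G" "opp_ring R" Rg \<sigma> s' s by (rule frob_opp)
  have "o.covers = (covers :: ('a set \<Rightarrow> bool) \<Rightarrow> _)"
    by (intro ext) (simp add: o.covers_def covers_def)
  then show ?thesis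
    using o.rann_cover[of I I' U] assms by (simp add: opp_simps)
qed

text \<open>Passing twice to annihilators of a cover again gives a cover or an equality. Hence the
  property of being a left annihilator climbs from \<open>0\<close> along covers to every graded left ideal,
  without any use of composition series.\<close>

lemma closed_cover:
  assumes cov: "covers gl I I'" and I: "lann (rann I) = I"
  shows "lann (rann I') = I'"
proof -
  have gI: "gl I" "gl I'" "I \<subset> I'" using cov unfolding covers_def by blast+
  have I'_sub: "I' \<subseteq> lann (rann I')" using glD(7)[OF gI(2)] by blast
  have I_sub: "I \<subseteq> lann (rann I)" using I by simp
  have ne: "rann I' \<noteq> rann I"
  proof
    assume "rann I' = rann I"
    have "I' \<subseteq> lann (rann I)" using I'_sub unfolding \<open>rann I' = rann I\<close> .
    then show False using gI(3) unfolding I by (metis psubsetE)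
  qed
  have "covers gr (rann I') (rann I)"
    unfolding covers_def
  proof (intro conjI allI impI gr_rann gI)
    show "rann I' \<subset> rann I" using ne gI(3) by blast
    show "K = rann I' \<or> K = rann I" if "gr K \<and> rann I' \<subseteq> K \<and> K \<subseteq> rann I" for K
      using rann_cover[OF cov] that by blast
  qed
  then have "I' = lann (rann I) \<or> I' = lann (rann I')"
    by (rule lann_cover) (use gI I'_sub I in auto)
  then show ?thesis using I gI(3) by auto
qed

section \<open>Double annihilators and the Baer property\<close>

lemma exists_cover:
  assumes "gl I" "gl K" "I \<subset> K"
  obtains I' where "covers gl I I'" "I' \<subseteq> K"
proof -
  let ?F = "\<lambda>C. gl C \<and> I \<subset> C \<and> C \<subseteq> K"
  have F0: "?F K" using assms by blast
  obtain I' where I': "?F I'" and mn: "\<And>C. ?F C \<Longrightarrow> C \<subseteq> I' \<Longrightarrow> C = I'"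
    using dcc_minimal[where F = ?F, OF gl_dcc F0] by blast
  have "C = I \<or> C = I'" if "gl C \<and> I \<subseteq> C \<and> C \<subseteq> I'" for C
    using mn[of C] I' that by (metis psubsetI subset_trans)
  then have "covers gl I I'" unfolding covers_def using assms(1) I' by simp
  then show ?thesis using that I' by blast
qed

text \<open>Among the left ideals below \<open>K\<close> that equal their double annihilator, one
  with minimal right annihilator exists by the descending chain condition on the right. A cover of
  it inside \<open>K\<close> is again closed by \<open>closed_cover\<close>, and an unchanged
  annihilator would make the two coincide.\<close>

lemma double_annihilator:
  assumes K: "gl K" shows "lann (rann K) = K"
proof -
  let ?F = "\<lambda>D. \<exists>I. gl I \<and> lann (rann I) = I \<and> I \<subseteq> K \<and> D = rann I"
  have z: "lann (rann {\<zero>}) = {\<zero>}"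
  proof -
    have "\<one> \<in> rann {\<zero>}" by simp
    then show ?thesis by (auto dest: bspec[where x = \<one>])
  qed
  have F0: "?F (rann {\<zero>})" using gl_zero z glD(4)[OF K] by blast
  have Fgr: "?F D \<Longrightarrow> gr D" for D using gr_rann by blast
  obtain D where D: "?F D" and mn: "\<And>E'. ?F E' \<Longrightarrow> E' \<subseteq> D \<Longrightarrow> E' = D"
    using dcc_minimal[where F = ?F, OF gr_dcc F0 Fgr] by blast
  then obtain I where I: "gl I" "lann (rann I) = I" "I \<subseteq> K" "D = rann I" by blast
  have "I = K"
  proof (rule ccontr)
    assume "I \<noteq> K"
    then obtain I' where I': "covers gl I I'" "I' \<subseteq> K" using exists_cover[OF I(1) K] I(3) by blast
    have c: "lann (rann I') = I'" by (rule closed_cover[OF I'(1) I(2)])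
    have sub: "gl I'" "I \<subset> I'" using I'(1) unfolding covers_def by blast+
    then have "?F (rann I')" using I' c by blast
    moreover have "rann I' \<subseteq> D" unfolding I(4) using sub by blast
    ultimately have "rann I' = rann I" using mn I(4) by blast
    then have "lann (rann I') = lann (rann I)" by simp
    then show False using c I(2) sub(2) by blast
  qed
  then show ?thesis using I(2) by simp
qed

lemma gl_acc: "ascending_chain_condition gl"
  unfolding ascending_chain_condition_def
proof (intro allI impI)
  fix I :: "nat \<Rightarrow> 'a set" assume I: "\<forall>n. gl (I n) \<and> I n \<subseteq> I (Suc n)"
  have "gr (rann (I n)) \<and> rann (I (Suc n)) \<subseteq> rann (I n)" for n
    using I gr_rann[of "I n"] by blast
  then obtain k where k: "\<And>n. n \<ge> k \<Longrightarrow> rann (I n) = rann (I k)"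
    using gr_dcc[unfolded descending_chain_condition_def, rule_format, of "\<lambda>n. rann (I n)"] by blast
  have "I n = I k" if "n \<ge> k" for n
  proof -
    have "I n = lann (rann (I n))" using double_annihilator[of "I n"] I by simp
    also have "\<dots> = lann (rann (I k))" using k[OF that] by simp
    also have "\<dots> = I k" using double_annihilator[of "I k"] I by simp
    finally show ?thesis .
  qed
  then show "\<exists>k. \<forall>n\<ge>k. I n = I k" by blast
qed

text \<open>Take a largest \<open>K\<close> inside \<open>I\<close> on which \<phi> is right
  multiplication by some \<open>c\<close>. For a homogeneous \<open>y\<close> in a cover of
  \<open>K\<close>, the error \<open>z = \<phi> y \<ominus> y \<otimes> c\<close> is killed by
  \<open>big E n\<close>, whose right annihilator is \<open>y \<otimes> rann K\<close> by
  minimality. So the error is \<open>y \<otimes> d\<close> with \<open>d\<close> killed by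
  \<open>K\<close>, and \<open>c \<oplus> d\<close> works on a larger ideal.\<close>

lemma baer:
  assumes I: "gl I" and t: "\<tau> \<in> carrier G"
    and phi: "\<And>x. x \<in> I \<Longrightarrow> \<phi> x \<in> carrier R" "\<And>x y. x \<in> I \<Longrightarrow> y \<in> I \<Longrightarrow> \<phi> (x \<oplus> y) = \<phi> x \<oplus> \<phi> y"
      "\<And>r x. r \<in> carrier R \<Longrightarrow> x \<in> I \<Longrightarrow> \<phi> (r \<otimes> x) = r \<otimes> \<phi> x"
      "\<And>g x. g \<in> carrier G \<Longrightarrow> x \<in> I \<Longrightarrow> x \<in> Rg g \<Longrightarrow> \<phi> x \<in> Rg (g \<otimes>\<^bsub>G\<^esub> \<tau>)"
  obtains c where "c \<in> Rg \<tau>" "\<And>x. x \<in> I \<Longrightarrow> \<phi> x = x \<otimes> c"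
proof -
  note Ic = glD[OF I]
  let ?F = "\<lambda>K. gl K \<and> K \<subseteq> I \<and> (\<exists>c\<in>Rg \<tau>. \<forall>x\<in>K. \<phi> x = x \<otimes> c)"
  have "\<phi> (\<zero> \<otimes> \<zero>) = \<zero> \<otimes> \<phi> \<zero>" by (rule phi(3)) (use Ic(4) in auto)
  then have "\<phi> \<zero> = \<zero>" using phi(1) Ic(4) by simp
  then have F0: "?F {\<zero>}" using gl_zero Ic(4) summand_zero[OF t] by (auto intro!: bexI[of _ \<zero>])
  obtain K where K: "?F K" and mx: "\<And>K'. ?F K' \<Longrightarrow> K \<subseteq> K' \<Longrightarrow> K' = K"
    using acc_maximal[where F = ?F, OF gl_acc F0] by blast
  then obtain c where c: "c \<in> Rg \<tau>" "\<And>x. x \<in> K \<Longrightarrow> \<phi> x = x \<otimes> c" and gK: "gl K" "K \<subseteq> I" by blast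
  have cc: "c \<in> carrier R" using Rg_carrier[OF t c(1)] .
  note Kc = glD[OF gK(1)]
  have "K = I"
  proof (rule ccontr)
    assume "K \<noteq> I"
    then obtain K' where K': "covers gl K K'" "K' \<subseteq> I" using exists_cover[OF gK(1) I] gK(2) by blast
    have gK': "gl K'" "K \<subseteq> K'" and mnK: "\<And>C. gl C \<Longrightarrow> K \<subseteq> C \<Longrightarrow> C \<subseteq> K' \<Longrightarrow> C = K \<or> C = K'"
      using K'(1) unfolding covers_def by blast+
    obtain g y where g: "g \<in> carrier G" and y: "y \<in> Rg g" "y \<in> K'" "y \<notin> K" using cover_hom[OF K'(1)] .
    obtain n where n: "maximal_left_ideal n B" "\<And>a. a \<in> big E n \<Longrightarrow> a \<otimes> y \<in> K"
      using cover_annihilator[OF K'(1) g y] by blast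
    have gn: "gl (big E n)" using maximal_graded_big[OF n(1)] unfolding maximal_graded_left_ideal_def by blast
    have yI: "y \<in> I" and yc: "y \<in> carrier R" using y K'(2) Ic(7) by blast+
    have gt: "g \<otimes>\<^bsub>G\<^esub> \<tau> \<in> carrier G" using g t by simp
    define z where "z = \<phi> y \<ominus> y \<otimes> c"
    have zd: "z \<in> Rg (g \<otimes>\<^bsub>G\<^esub> \<tau>)"
      unfolding z_def by (rule summand_minus[OF gt phi(4)[OF g yI y(1)] mult_mem[OF g t y(1) c(1)]])
    have fy: "\<phi> y \<in> carrier R" by (rule phi(1)[OF yI])
    have zc: "z \<in> carrier R" using Rg_carrier[OF gt zd] .
    have zn: "z \<in> rann (big E n)"
    proof -
      have "a \<otimes> z = \<zero>" if a: "a \<in> big E n" for a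
      proof -
        have ac: "a \<in> carrier R" using glD(7)[OF gn a] .
        have "\<phi> (a \<otimes> y) = a \<otimes> \<phi> y" by (rule phi(3)[OF ac yI])
        moreover have "\<phi> (a \<otimes> y) = a \<otimes> y \<otimes> c" by (rule c(2)[OF n(2)[OF a]])
        ultimately show ?thesis unfolding z_def using ac yc cc fy
          by (simp add: minus_eq r_distr r_minus m_assoc r_neg)
      qed
      then show ?thesis using zc by simp
    qed
    let ?Y = "{y \<otimes> d | d. d \<in> rann K}"
    have Y: "gr ?Y" by (rule gr_image[OF gr_rann[OF gK(1)] g y(1)])
    have "?Y \<subseteq> rann (big E n)"
    proof
      fix w assume "w \<in> ?Y"
      then obtain d where d: "w = y \<otimes> d" "d \<in> rann K" by blast
      have "a \<otimes> w = \<zero>" if a: "a \<in> big E n" for a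
      proof -
        have "a \<otimes> w = (a \<otimes> y) \<otimes> d" using d glD(7)[OF gn a] yc by (simp add: m_assoc)
        then show ?thesis using n(2)[OF a] d by simp
      qed
      then show "w \<in> rann (big E n)" using d yc by simp
    qed
    \<comment> \<open>Otherwise \<open>y\<close> would lie in the double annihilator of
      \<open>K\<close>.\<close>
    moreover have "?Y \<noteq> {\<zero>}"
    proof
      assume "?Y = {\<zero>}"
      then have "y \<in> lann (rann K)" using yc by blast
      then have "y \<in> K" unfolding double_annihilator[OF gK(1)] .
      then show False using y(3) by blast
    qed
    ultimately have "z \<in> ?Y" using rann_big_minimal[OF n(1) Y] zn by blast
    then obtain d0 where d0: "d0 \<in> rann K" "z = y \<otimes> d0" by blast
    \<comment> \<open>The multiplier has to be homogeneous. As \<open>z\<close> has degree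
      \<open>g \<tau>\<close>, comparing components shows that the component of \<open>d0\<close> in
      degree \<tau> has the same effect on \<open>y\<close>.\<close>
    define d where "d = cmp d0 \<tau>"
    have dK: "d \<in> rann K" unfolding d_def by (rule grD(2)[OF gr_rann[OF gK(1)] d0(1) t])
    have dt: "d \<in> Rg \<tau>" unfolding d_def using component_mem[OF _ t] d0 by blast
    have dc: "d \<in> carrier R" using dK by blast
    have "z = cmp z (g \<otimes>\<^bsub>G\<^esub> \<tau>)" using component_summand[OF gt zd gt] by simp
    also have "\<dots> = y \<otimes> cmp d0 (inv\<^bsub>G\<^esub> g \<otimes>\<^bsub>G\<^esub> (g \<otimes>\<^bsub>G\<^esub> \<tau>))"
      unfolding d0(2) using component_mult_left[OF g y(1) _ gt] d0(1) by blast
    also have "\<dots> = y \<otimes> d" unfolding d_def using g t by (simp add: G.m_assoc[symmetric])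
    finally have zyd: "z = y \<otimes> d" .
    let ?P = "{r \<otimes> y | r. r \<in> carrier R}"
    let ?C = "{i \<oplus> w | i w. i \<in> K \<and> w \<in> ?P}"
    have P: "gl ?P" by (rule gl_principal[OF g y(1)])
    have C: "gl ?C" by (rule gl_sum[OF gK(1) P])
    have KC: "K \<subseteq> ?C"
    proof
      fix i assume i: "i \<in> K"
      then have "i = i \<oplus> \<zero>" using Kc(7) by simp
      then show "i \<in> ?C" using i glD(4)[OF P] by blast
    qed
    have rI: "r \<otimes> y \<in> I" if "r \<in> carrier R" for r using Ic(6) yI that by blast
    have CI: "?C \<subseteq> I" using rI Ic(5) gK(2) by blast
    have yC: "y \<in> ?C"
    proof -
      have "y = \<zero> \<oplus> \<one> \<otimes> y" using yc by simp
      then show ?thesis using Kc(4) one_closed by blast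
    qed
    have on_C: "\<phi> x = x \<otimes> (c \<oplus> d)" if x: "x \<in> ?C" for x
    proof -
      obtain i r where ir: "i \<in> K" "r \<in> carrier R" "x = i \<oplus> r \<otimes> y" using x by blast
      have ic: "i \<in> carrier R" using Kc(7) ir by blast
      have fyz: "\<phi> y = y \<otimes> c \<oplus> y \<otimes> d"
      proof -
        have "\<phi> y = y \<otimes> c \<oplus> z" unfolding z_def using fy yc cc by algebra
        then show ?thesis using zyd by simp
      qed
      have "\<phi> x = \<phi> i \<oplus> r \<otimes> \<phi> y"
        unfolding ir(3) using phi(2)[of i "r \<otimes> y"] phi(3)[OF ir(2) yI] rI[OF ir(2)] ir(1) gK(2) by auto
      also have "\<dots> = i \<otimes> c \<oplus> (r \<otimes> (y \<otimes> c) \<oplus> r \<otimes> (y \<otimes> d))"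
        unfolding c(2)[OF ir(1)] fyz using ir(2) yc cc dc by (simp add: r_distr)
      also have "\<dots> = x \<otimes> c \<oplus> x \<otimes> d"
        using dK ir yc cc dc ic by (simp add: l_distr m_assoc a_assoc)
      also have "\<dots> = x \<otimes> (c \<oplus> d)" using ir yc ic cc dc by (simp add: r_distr)
      finally show ?thesis .
    qed
    have "\<exists>c\<in>Rg \<tau>. \<forall>x\<in>?C. \<phi> x = x \<otimes> c"
      by (rule bexI[OF ballI summand_add[OF t c(1) dt]]) (rule on_C)
    then have "?F ?C" by (intro conjI C CI)
    then have "?C = K" by (rule mx[OF _ KC])
    then have "y \<in> K" using yC by (rule subst)
    then show False using y(3) by blast
  qed
  then show ?thesis using that c by blast
qed

end

section \<open>Injectivity from the Baer property\<close>

text \<open>This is what makes the graph of a graded homomorphism closed under components.\<close>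

lemma component_additive_map:
  assumes M: "direct_sum M I A" and N: "direct_sum N I C"
    and f: "\<And>x. x \<in> carrier M \<Longrightarrow> f x \<in> carrier N"
      "\<And>x y. x \<in> carrier M \<Longrightarrow> y \<in> carrier M \<Longrightarrow> f (x \<oplus>\<^bsub>M\<^esub> y) = f x \<oplus>\<^bsub>N\<^esub> f y"
      "\<And>g x. g \<in> I \<Longrightarrow> x \<in> A g \<Longrightarrow> f x \<in> C g"
    and x: "x \<in> carrier M" and g: "g \<in> I"
  shows "component N I C (f x) g = f (component M I A x g)"
proof -
  interpret M: direct_sum M I A by (rule M)
  interpret N: direct_sum N I C by (rule N)
  have "f \<zero>\<^bsub>M\<^esub> \<oplus>\<^bsub>N\<^esub> f \<zero>\<^bsub>M\<^esub> = f \<zero>\<^bsub>M\<^esub>" using f(2)[of "\<zero>\<^bsub>M\<^esub>" "\<zero>\<^bsub>M\<^esub>"] by simp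
  then have f0: "f \<zero>\<^bsub>M\<^esub> = \<zero>\<^bsub>N\<^esub>" using f(1)[OF M.zero_closed] by (metis N.add.r_cancel_one)
  let ?H = "{x \<in> carrier M. N.cmp (f x) g = f (M.cmp x g)}"
  have "x \<in> ?H"
  proof (rule M.mem_of_components[OF x])
    show "\<zero>\<^bsub>M\<^esub> \<in> ?H" using f0 g by (simp add: M.component_zero N.component_zero)
    show "y \<oplus>\<^bsub>M\<^esub> z \<in> ?H" if "y \<in> ?H" "z \<in> ?H" for y z
      using that f(1,2) g by (simp add: M.component_add N.component_add M.component_closed)
    show "M.cmp x k \<in> ?H" if k: "k \<in> I" for k
    proof -
      have a: "M.cmp x k \<in> A k" by (rule M.component_mem[OF x k])
      show ?thesis
        using M.component_summand[OF k a g] N.component_summand[OF k f(3)[OF k a] g] f0 M.summand_carrier[OF k a]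
        by simp
    qed
  qed auto
  then show ?thesis by blast
qed

context graded_ring_components
begin

lemma graded_left_reg: "graded_module G R Rg (left_reg R) Rg"
proof -
  interpret L: left_module R "left_reg R" by (rule left_reg_module)
  have s: "carrier (left_reg R) = carrier R" "add (left_reg R) = add R" "ring.zero (left_reg R) = \<zero>"
    "smult (left_reg R) = monoid.mult R" by (simp_all add: left_reg_def)
  have sub: "subgroup (Rg g) (add_monoid (left_reg R))" if g: "g \<in> carrier G" for g
  proof (rule subgroup.intro)
    fix x assume x: "x \<in> Rg g"
    have "\<ominus>\<^bsub>left_reg R\<^esub> x = \<ominus> x"
      using L.M.minus_equality[of "\<ominus> x" x] x Rg_carrier[OF g x] by (simp add: s l_neg)
    then show "inv\<^bsub>add_monoid (left_reg R)\<^esub> x \<in> Rg g"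
      using summand_uminus[OF g x] by (simp add: a_inv_def)
  qed (use summand_zero[OF g] summand_add[OF g] Rg_carrier[OF g] in \<open>auto simp: s\<close>)
  have "internal_direct_sum (left_reg R) (carrier G) Rg"
  proof (rule internal_direct_sumI[where \<pi> = cmp, OF L.M.abelian_group_axioms sub]; (unfold s)?)
    show "x \<in> H" if "x \<in> carrier R" "\<zero> \<in> H" "\<And>y z. y \<in> H \<Longrightarrow> z \<in> H \<Longrightarrow> y \<oplus> z \<in> H" "H \<subseteq> carrier R"
      "\<And>g. g \<in> carrier G \<Longrightarrow> cmp x g \<in> H" for x H
      by (rule mem_of_components[OF that])
  qed (auto simp: component_mem component_add component_summand)
  then show ?thesis
    by (intro graded_module.intro graded_module_axioms.intro graded_ring_axioms left_reg_module)
       (auto simp: s mult_mem)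
qed

lemma module_component_smult:
  assumes M: "graded_module G R Rg M Mg" and h: "h \<in> carrier G" and x: "x \<in> Mg h"
    and r: "r \<in> carrier R" and g: "g \<in> carrier G"
  shows "component M (carrier G) Mg (r \<odot>\<^bsub>M\<^esub> x) (g \<otimes>\<^bsub>G\<^esub> h) = cmp r g \<odot>\<^bsub>M\<^esub> x"
proof -
  interpret M: graded_module G R Rg M Mg by (rule M)
  interpret MD: direct_sum M "carrier G" Mg by unfold_locales (rule M.module_direct_sum)
  have xc: "x \<in> carrier M" by (rule MD.summand_carrier[OF h x])
  have gh: "g \<otimes>\<^bsub>G\<^esub> h \<in> carrier G" using g h by simp
  let ?H = "{r \<in> carrier R. MD.cmp (r \<odot>\<^bsub>M\<^esub> x) (g \<otimes>\<^bsub>G\<^esub> h) = cmp r g \<odot>\<^bsub>M\<^esub> x}"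
  have "r \<in> ?H"
  proof (rule mem_of_components[OF r])
    show "\<zero> \<in> ?H" using xc g gh by (simp add: component_zero MD.component_zero M.smult_l_null)
    show "y \<oplus> z \<in> ?H" if "y \<in> ?H" "z \<in> ?H" for y z
      using that xc g gh
      by (simp add: M.smult_l_distr component_add component_closed MD.component_add M.smult_closed)
    show "cmp r k \<in> ?H" if k: "k \<in> carrier G" for k
    proof -
      let ?a = "cmp r k"
      have a: "?a \<in> Rg k" "?a \<in> carrier R" using component_mem[OF r k] Rg_carrier k by blast+
      have ax: "?a \<odot>\<^bsub>M\<^esub> x \<in> Mg (k \<otimes>\<^bsub>G\<^esub> h)" using M.smult_degree[OF k h a(1) x] .
      have "g \<otimes>\<^bsub>G\<^esub> h = k \<otimes>\<^bsub>G\<^esub> h \<longleftrightarrow> g = k" using g h k by simp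
      then have "MD.cmp (?a \<odot>\<^bsub>M\<^esub> x) (g \<otimes>\<^bsub>G\<^esub> h) = cmp ?a g \<odot>\<^bsub>M\<^esub> x"
        using MD.component_summand[OF _ ax gh] component_summand[OF k a(1) g] h k xc
        by (auto simp: M.smult_l_null)
      then show ?thesis using a by simp
    qed
  qed auto
  then show ?thesis by blast
qed

text \<open>Partial extensions are handled through their graphs, so that unions of chains are unions
  of sets.\<close>

definition partial_hom ::
  "('a, 'm, 'd) module_scheme \<Rightarrow> ('g \<Rightarrow> 'm set) \<Rightarrow> ('m \<times> 'a) set \<Rightarrow> bool" where
  "partial_hom M Mg H \<longleftrightarrow> H \<subseteq> carrier M \<times> carrier R
    \<and> (\<forall>x y x' y'. (x, y) \<in> H \<longrightarrow> (x', y') \<in> H \<longrightarrow> (x \<oplus>\<^bsub>M\<^esub> x', y \<oplus> y') \<in> H)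
    \<and> (\<forall>r\<in>carrier R. \<forall>x y. (x, y) \<in> H \<longrightarrow> (r \<odot>\<^bsub>M\<^esub> x, r \<otimes> y) \<in> H)
    \<and> (\<forall>g\<in>carrier G. \<forall>x y. (x, y) \<in> H \<longrightarrow> (component M (carrier G) Mg x g, cmp y g) \<in> H)
    \<and> (\<forall>y. (\<zero>\<^bsub>M\<^esub>, y) \<in> H \<longrightarrow> y = \<zero>)"

lemma partial_homD:
  assumes "partial_hom M Mg H"
  shows "\<And>x y. (x, y) \<in> H \<Longrightarrow> x \<in> carrier M \<and> y \<in> carrier R"
    "\<And>x y x' y'. (x, y) \<in> H \<Longrightarrow> (x', y') \<in> H \<Longrightarrow> (x \<oplus>\<^bsub>M\<^esub> x', y \<oplus> y') \<in> H"
    "\<And>r x y. r \<in> carrier R \<Longrightarrow> (x, y) \<in> H \<Longrightarrow> (r \<odot>\<^bsub>M\<^esub> x, r \<otimes> y) \<in> H"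
    "\<And>g x y. g \<in> carrier G \<Longrightarrow> (x, y) \<in> H \<Longrightarrow> (component M (carrier G) Mg x g, cmp y g) \<in> H"
    "\<And>y. (\<zero>\<^bsub>M\<^esub>, y) \<in> H \<Longrightarrow> y = \<zero>"
  using assms unfolding partial_hom_def by auto

lemma partial_homI:
  assumes "H \<subseteq> carrier M \<times> carrier R"
    "\<And>x y x' y'. (x, y) \<in> H \<Longrightarrow> (x', y') \<in> H \<Longrightarrow> (x \<oplus>\<^bsub>M\<^esub> x', y \<oplus> y') \<in> H"
    "\<And>r x y. r \<in> carrier R \<Longrightarrow> (x, y) \<in> H \<Longrightarrow> (r \<odot>\<^bsub>M\<^esub> x, r \<otimes> y) \<in> H"
    "\<And>g x y. g \<in> carrier G \<Longrightarrow> (x, y) \<in> H \<Longrightarrow> (component M (carrier G) Mg x g, cmp y g) \<in> H"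
    "\<And>y. (\<zero>\<^bsub>M\<^esub>, y) \<in> H \<Longrightarrow> y = \<zero>"
  shows "partial_hom M Mg H"
  using assms unfolding partial_hom_def by blast

text \<open>The last clause of \<open>partial_hom\<close> is applied to the difference of the two
  pairs, formed by adding the multiple by \<open>\<ominus> \<one>\<close>.\<close>

lemma partial_hom_unique:
  assumes M: "left_module R M" and H: "partial_hom M Mg H" and y: "(x, y) \<in> H" "(x, y') \<in> H"
  shows "y = y'"
proof -
  interpret M: left_module R M by (rule M)
  note Hd = partial_homD[OF H]
  have c: "x \<in> carrier M" "y \<in> carrier R" "y' \<in> carrier R" using Hd(1) y by blast+
  have "(x \<oplus>\<^bsub>M\<^esub> (\<ominus> \<one>) \<odot>\<^bsub>M\<^esub> x, y \<oplus> (\<ominus> \<one>) \<otimes> y') \<in> H"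
    using Hd(2)[OF y(1) Hd(3)[OF _ y(2)]] by simp
  moreover have "x \<oplus>\<^bsub>M\<^esub> (\<ominus> \<one>) \<odot>\<^bsub>M\<^esub> x = \<zero>\<^bsub>M\<^esub>"
    using c by (simp add: M.smult_l_minus M.smult_one M.M.r_neg)
  ultimately have "y \<oplus> (\<ominus> \<one>) \<otimes> y' = \<zero>" using Hd(5) by simp
  then have "y \<ominus> y' = \<zero>" using c by (simp add: minus_eq l_minus)
  then show ?thesis using c minus_eq_zero_iff by blast
qed

text \<open>The scalars moving \<open>x\<close> into the domain form a graded left ideal, on which
  the old map evaluated at \<open>r x\<close> has degree \<open>g\<close>. The Baer hypothesis
  represents it as right multiplication by \<open>c\<close>, and \<open>c\<close> is then a
  consistent value at \<open>x\<close>.\<close>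

lemma partial_hom_extend:
  assumes M: "graded_module G R Rg M Mg" and H: "partial_hom M Mg H" and H0: "(\<zero>\<^bsub>M\<^esub>, \<zero>) \<in> H"
    and g: "g \<in> carrier G" and x: "x \<in> Mg g"
    and baer: "\<And>I \<phi>. gl I \<Longrightarrow> (\<And>x. x \<in> I \<Longrightarrow> \<phi> x \<in> carrier R) \<Longrightarrow>
      (\<And>x y. x \<in> I \<Longrightarrow> y \<in> I \<Longrightarrow> \<phi> (x \<oplus> y) = \<phi> x \<oplus> \<phi> y) \<Longrightarrow>
      (\<And>r x. r \<in> carrier R \<Longrightarrow> x \<in> I \<Longrightarrow> \<phi> (r \<otimes> x) = r \<otimes> \<phi> x) \<Longrightarrow>
      (\<And>k x. k \<in> carrier G \<Longrightarrow> x \<in> I \<Longrightarrow> x \<in> Rg k \<Longrightarrow> \<phi> x \<in> Rg (k \<otimes>\<^bsub>G\<^esub> g)) \<Longrightarrow>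
      \<exists>c\<in>Rg g. \<forall>x\<in>I. \<phi> x = x \<otimes> c"
  obtains H' where "partial_hom M Mg H'" "H \<subseteq> H'" "x \<in> Domain H'"
proof -
  interpret M: graded_module G R Rg M Mg by (rule M)
  interpret MD: direct_sum M "carrier G" Mg by unfold_locales (rule M.module_direct_sum)
  have Ml: "left_module R M" by unfold_locales
  note Hd = partial_homD[OF H] and uniq = partial_hom_unique[OF Ml H]
  have xc: "x \<in> carrier M" by (rule MD.summand_carrier[OF g x])
  let ?I = "{r \<in> carrier R. r \<odot>\<^bsub>M\<^esub> x \<in> Domain H}"
  define \<phi> where "\<phi> r = (THE y. (r \<odot>\<^bsub>M\<^esub> x, y) \<in> H)" for r
  have phiI: "\<phi> r = y" if "(r \<odot>\<^bsub>M\<^esub> x, y) \<in> H" for r y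
    unfolding \<phi>_def using that uniq by blast
  have phi: "(r \<odot>\<^bsub>M\<^esub> x, \<phi> r) \<in> H" if "r \<in> ?I" for r
    using that phiI by blast
  have I: "gl ?I"
    unfolding gl_iff
  proof (intro conjI ballI)
    show "left_ideal R ?I"
    proof (rule left_idealI)
      show "\<zero> \<in> ?I" using H0 xc by (auto simp: M.smult_l_null)
      show "a \<oplus> b \<in> ?I" if "a \<in> ?I" "b \<in> ?I" for a b
        using Hd(2)[OF phi[OF that(1)] phi[OF that(2)]] that xc by (auto simp: M.smult_l_distr)
      show "r \<otimes> a \<in> ?I" if "r \<in> carrier R" "a \<in> ?I" for r a
        using Hd(3)[OF that(1) phi[OF that(2)]] that xc by (auto simp: M.smult_assoc)
    qed blast
    fix r k assume r: "r \<in> ?I" and k: "k \<in> carrier G"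
    have kg: "k \<otimes>\<^bsub>G\<^esub> g \<in> carrier G" using k g by simp
    have "(MD.cmp (r \<odot>\<^bsub>M\<^esub> x) (k \<otimes>\<^bsub>G\<^esub> g), cmp (\<phi> r) (k \<otimes>\<^bsub>G\<^esub> g)) \<in> H" by (rule Hd(4)[OF kg phi[OF r]])
    then show "cmp r k \<in> ?I"
      using module_component_smult[OF M g x _ k] r component_closed k by auto
  qed
  have "\<exists>c\<in>Rg g. \<forall>r\<in>?I. \<phi> r = r \<otimes> c"
  proof (rule baer[OF I])
    show "\<phi> r \<in> carrier R" if "r \<in> ?I" for r using Hd(1) phi[OF that] by blast
    show "\<phi> (a \<oplus> b) = \<phi> a \<oplus> \<phi> b" if "a \<in> ?I" "b \<in> ?I" for a b
      using Hd(2)[OF phi[OF that(1)] phi[OF that(2)]] that xc by (intro phiI) (simp add: M.smult_l_distr)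
    show "\<phi> (r \<otimes> a) = r \<otimes> \<phi> a" if "r \<in> carrier R" "a \<in> ?I" for r a
      using Hd(3)[OF that(1) phi[OF that(2)]] that xc by (intro phiI) (simp add: M.smult_assoc)
    show "\<phi> r \<in> Rg (k \<otimes>\<^bsub>G\<^esub> g)" if k: "k \<in> carrier G" and r: "r \<in> ?I" "r \<in> Rg k" for k r
    proof -
      have kg: "k \<otimes>\<^bsub>G\<^esub> g \<in> carrier G" using k g by simp
      have "MD.cmp (r \<odot>\<^bsub>M\<^esub> x) (k \<otimes>\<^bsub>G\<^esub> g) = r \<odot>\<^bsub>M\<^esub> x"
        using MD.component_summand[OF kg M.smult_degree[OF k g r(2) x] kg] by simp
      then have "(r \<odot>\<^bsub>M\<^esub> x, cmp (\<phi> r) (k \<otimes>\<^bsub>G\<^esub> g)) \<in> H" using Hd(4)[OF kg phi[OF r(1)]] by simp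
      then have "\<phi> r = cmp (\<phi> r) (k \<otimes>\<^bsub>G\<^esub> g)" by (rule phiI)
      then show ?thesis using component_mem[OF _ kg] Hd(1) phi[OF r(1)] by metis
    qed
  qed
  then obtain c where c: "c \<in> Rg g" "\<And>r. r \<in> ?I \<Longrightarrow> \<phi> r = r \<otimes> c" by blast
  have cc: "c \<in> carrier R" by (rule Rg_carrier[OF g c(1)])
  define H' where "H' = {(n \<oplus>\<^bsub>M\<^esub> r \<odot>\<^bsub>M\<^esub> x, y \<oplus> r \<otimes> c) | n y r. (n, y) \<in> H \<and> r \<in> carrier R}"
  have H'I: "(n \<oplus>\<^bsub>M\<^esub> r \<odot>\<^bsub>M\<^esub> x, y \<oplus> r \<otimes> c) \<in> H'" if "(n, y) \<in> H" "r \<in> carrier R" for n y r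
    unfolding H'_def using that by blast
  have H'E: "\<exists>n y r. p = n \<oplus>\<^bsub>M\<^esub> r \<odot>\<^bsub>M\<^esub> x \<and> q = y \<oplus> r \<otimes> c \<and> (n, y) \<in> H \<and> r \<in> carrier R"
    if "(p, q) \<in> H'" for p q
    using that unfolding H'_def by blast
  have "partial_hom M Mg H'"
  proof (rule partial_homI)
    show "H' \<subseteq> carrier M \<times> carrier R"
      unfolding H'_def using Hd(1) xc cc M.smult_closed by auto
  next
    fix p q p' q' assume "(p, q) \<in> H'" "(p', q') \<in> H'"
    then obtain n y r n' y' r' where
      1: "p = n \<oplus>\<^bsub>M\<^esub> r \<odot>\<^bsub>M\<^esub> x" "q = y \<oplus> r \<otimes> c" "(n, y) \<in> H" "r \<in> carrier R" and
      2: "p' = n' \<oplus>\<^bsub>M\<^esub> r' \<odot>\<^bsub>M\<^esub> x" "q' = y' \<oplus> r' \<otimes> c" "(n', y') \<in> H" "r' \<in> carrier R"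
      using H'E by metis
    have cs: "n \<in> carrier M" "y \<in> carrier R" "n' \<in> carrier M" "y' \<in> carrier R" using Hd(1) 1 2 by blast+
    have "p \<oplus>\<^bsub>M\<^esub> p' = (n \<oplus>\<^bsub>M\<^esub> n') \<oplus>\<^bsub>M\<^esub> (r \<oplus> r') \<odot>\<^bsub>M\<^esub> x"
      unfolding 1 2 using cs 1(4) 2(4) xc by (simp add: M.smult_l_distr M.smult_closed M.M.a_ac)
    moreover have "q \<oplus> q' = (y \<oplus> y') \<oplus> (r \<oplus> r') \<otimes> c"
      unfolding 1 2 using cs 1(4) 2(4) cc by (simp add: l_distr a_ac)
    ultimately show "(p \<oplus>\<^bsub>M\<^esub> p', q \<oplus> q') \<in> H'"
      using H'I[OF Hd(2)[OF 1(3) 2(3)]] 1(4) 2(4) by simp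
  next
    fix t p q assume t: "t \<in> carrier R" and "(p, q) \<in> H'"
    then obtain n y r where
      1: "p = n \<oplus>\<^bsub>M\<^esub> r \<odot>\<^bsub>M\<^esub> x" "q = y \<oplus> r \<otimes> c" "(n, y) \<in> H" "r \<in> carrier R" using H'E by metis
    have cs: "n \<in> carrier M" "y \<in> carrier R" using Hd(1) 1 by blast+
    have "t \<odot>\<^bsub>M\<^esub> p = t \<odot>\<^bsub>M\<^esub> n \<oplus>\<^bsub>M\<^esub> (t \<otimes> r) \<odot>\<^bsub>M\<^esub> x"
      unfolding 1 using cs 1(4) t xc by (simp add: M.smult_r_distr M.smult_assoc M.smult_closed)
    moreover have "t \<otimes> q = t \<otimes> y \<oplus> (t \<otimes> r) \<otimes> c"
      unfolding 1 using cs 1(4) t cc by (simp add: r_distr m_assoc)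
    ultimately show "(t \<odot>\<^bsub>M\<^esub> p, t \<otimes> q) \<in> H'" using H'I[OF Hd(3)[OF t 1(3)]] 1(4) t by simp
  next
    fix h p q assume h: "h \<in> carrier G" and "(p, q) \<in> H'"
    then obtain n y r where
      1: "p = n \<oplus>\<^bsub>M\<^esub> r \<odot>\<^bsub>M\<^esub> x" "q = y \<oplus> r \<otimes> c" "(n, y) \<in> H" "r \<in> carrier R" using H'E by metis
    have cs: "n \<in> carrier M" "y \<in> carrier R" using Hd(1) 1 by blast+
    let ?k = "h \<otimes>\<^bsub>G\<^esub> inv\<^bsub>G\<^esub> g"
    have k: "?k \<in> carrier G" "?k \<otimes>\<^bsub>G\<^esub> g = h" using h g by (simp_all add: G.m_assoc)
    have "MD.cmp p h = MD.cmp n h \<oplus>\<^bsub>M\<^esub> cmp r ?k \<odot>\<^bsub>M\<^esub> x"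
      unfolding 1 using module_component_smult[OF M g x 1(4) k(1)] k cs h xc 1(4)
      by (simp add: MD.component_add M.smult_closed)
    moreover have "cmp q h = cmp y h \<oplus> cmp r ?k \<otimes> c"
      unfolding 1 using component_mult_right[OF g c(1) 1(4) h] cs h cc 1(4) by (simp add: component_add)
    ultimately show "(MD.cmp p h, cmp q h) \<in> H'"
      using H'I[OF Hd(4)[OF h 1(3)] component_closed[OF 1(4) k(1)]] by simp
  next
    \<comment> \<open>Consistency: if \<open>n\<close> and \<open>r x\<close> cancel, then
      \<open>r\<close> belongs to \<open>?I\<close> and \<open>\<phi> r\<close>, equal to
      \<open>r \<otimes> c\<close>, is the negative of \<open>y\<close>.\<close>
    fix q assume "(\<zero>\<^bsub>M\<^esub>, q) \<in> H'"
    then obtain n y r where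
      1: "\<zero>\<^bsub>M\<^esub> = n \<oplus>\<^bsub>M\<^esub> r \<odot>\<^bsub>M\<^esub> x" "q = y \<oplus> r \<otimes> c" "(n, y) \<in> H" "r \<in> carrier R" using H'E by metis
    have cs: "n \<in> carrier M" "y \<in> carrier R" using Hd(1) 1 by blast+
    have rx: "r \<odot>\<^bsub>M\<^esub> x \<in> carrier M" using 1(4) xc M.smult_closed by blast
    have "r \<odot>\<^bsub>M\<^esub> x = \<ominus>\<^bsub>M\<^esub> n"
      using M.M.minus_equality[of "r \<odot>\<^bsub>M\<^esub> x" n] 1(1) cs rx by (simp add: M.M.a_comm)
    also have "\<dots> = (\<ominus> \<one>) \<odot>\<^bsub>M\<^esub> n" by (rule M.uminus_conv_smult[OF cs(1)])
    finally have "(r \<odot>\<^bsub>M\<^esub> x, (\<ominus> \<one>) \<otimes> y) \<in> H" using Hd(3)[OF _ 1(3), of "\<ominus> \<one>"] by simp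
    then have "\<phi> r = (\<ominus> \<one>) \<otimes> y" "r \<in> ?I" using phiI 1(4) by blast+
    then have "r \<otimes> c = \<ominus> y" using c(2) cs by (simp add: l_minus)
    then show "q = \<zero>" unfolding 1 using cs by (simp add: r_neg)
  qed
  moreover have "H \<subseteq> H'"
  proof (rule subrelI)
    fix n y assume ny: "(n, y) \<in> H"
    have "n \<in> carrier M" "y \<in> carrier R" using Hd(1) ny by blast+
    then show "(n, y) \<in> H'" using H'I[OF ny zero_closed] xc cc by (simp add: M.smult_l_null)
  qed
  moreover have "x \<in> Domain H'"
    using H'I[OF H0 one_closed] xc by (auto simp: M.smult_one)
  ultimately show ?thesis using that by blast
qed

text \<open>Zorn's lemma gives a maximal partial extension. Its domain contains every homogeneous
  element by \<open>partial_hom_extend\<close>, hence everything. The universe \<open>'m\<close> is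
  arbitrary in this direction.\<close>

lemma injective_of_baer:
  assumes baer: "\<And>I \<phi> \<tau>. gl I \<Longrightarrow> \<tau> \<in> carrier G \<Longrightarrow> (\<And>x. x \<in> I \<Longrightarrow> \<phi> x \<in> carrier R) \<Longrightarrow>
      (\<And>x y. x \<in> I \<Longrightarrow> y \<in> I \<Longrightarrow> \<phi> (x \<oplus> y) = \<phi> x \<oplus> \<phi> y) \<Longrightarrow>
      (\<And>r x. r \<in> carrier R \<Longrightarrow> x \<in> I \<Longrightarrow> \<phi> (r \<otimes> x) = r \<otimes> \<phi> x) \<Longrightarrow>
      (\<And>k x. k \<in> carrier G \<Longrightarrow> x \<in> I \<Longrightarrow> x \<in> Rg k \<Longrightarrow> \<phi> x \<in> Rg (k \<otimes>\<^bsub>G\<^esub> \<tau>)) \<Longrightarrow>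
      \<exists>c\<in>Rg \<tau>. \<forall>x\<in>I. \<phi> x = x \<otimes> c"
  shows "graded_injective TYPE('m) G R Rg (left_reg R) Rg"
  unfolding graded_injective_def
proof (intro conjI allI impI graded_left_reg)
  fix M :: "('a, 'm) module" and Mg and N :: "('a, 'm) module" and Ng i f
  assume "graded_module G R Rg M Mg \<and> graded_module G R Rg N Ng \<and>
    i \<in> graded_hom G R N Ng M Mg \<and> inj_on i (carrier N) \<and> f \<in> graded_hom G R N Ng (left_reg R) Rg"
  then have M: "graded_module G R Rg M Mg" and N: "graded_module G R Rg N Ng"
    and i: "i \<in> graded_hom G R N Ng M Mg" and inj: "inj_on i (carrier N)"
    and f: "f \<in> graded_hom G R N Ng (left_reg R) Rg" by blast+
  interpret M: graded_module G R Rg M Mg by (rule M)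
  interpret MD: direct_sum M "carrier G" Mg by unfold_locales (rule M.module_direct_sum)
  interpret N: graded_module G R Rg N Ng by (rule N)
  interpret ND: direct_sum N "carrier G" Ng by unfold_locales (rule N.module_direct_sum)
  have Ml: "left_module R M" by unfold_locales
  have i': "\<And>x. x \<in> carrier N \<Longrightarrow> i x \<in> carrier M"
    "\<And>x y. x \<in> carrier N \<Longrightarrow> y \<in> carrier N \<Longrightarrow> i (x \<oplus>\<^bsub>N\<^esub> y) = i x \<oplus>\<^bsub>M\<^esub> i y"
    "\<And>r x. r \<in> carrier R \<Longrightarrow> x \<in> carrier N \<Longrightarrow> i (r \<odot>\<^bsub>N\<^esub> x) = r \<odot>\<^bsub>M\<^esub> i x"
    "\<And>g x. g \<in> carrier G \<Longrightarrow> x \<in> Ng g \<Longrightarrow> i x \<in> Mg g"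
    using i unfolding graded_hom_def module_hom_def by (auto simp: image_subset_iff)
  have f': "\<And>x. x \<in> carrier N \<Longrightarrow> f x \<in> carrier R"
    "\<And>x y. x \<in> carrier N \<Longrightarrow> y \<in> carrier N \<Longrightarrow> f (x \<oplus>\<^bsub>N\<^esub> y) = f x \<oplus> f y"
    "\<And>r x. r \<in> carrier R \<Longrightarrow> x \<in> carrier N \<Longrightarrow> f (r \<odot>\<^bsub>N\<^esub> x) = r \<otimes> f x"
    "\<And>g x. g \<in> carrier G \<Longrightarrow> x \<in> Ng g \<Longrightarrow> f x \<in> Rg g"
    using f unfolding graded_hom_def module_hom_def by (auto simp: left_reg_def image_subset_iff)
  have z0: "i \<zero>\<^bsub>N\<^esub> = \<zero>\<^bsub>M\<^esub>" "f \<zero>\<^bsub>N\<^esub> = \<zero>"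
  proof -
    have z: "\<zero> \<odot>\<^bsub>N\<^esub> \<zero>\<^bsub>N\<^esub> = \<zero>\<^bsub>N\<^esub>" by (simp add: N.smult_l_null)
    show "i \<zero>\<^bsub>N\<^esub> = \<zero>\<^bsub>M\<^esub>" using i'(3)[of \<zero> "\<zero>\<^bsub>N\<^esub>"] i'(1) by (simp add: z M.smult_l_null)
    show "f \<zero>\<^bsub>N\<^esub> = \<zero>" using f'(3)[of \<zero> "\<zero>\<^bsub>N\<^esub>"] f'(1) by (simp add: z)
  qed
  \<comment> \<open>The graph of \<open>f\<close> composed with the inverse of the injection
    \<open>i\<close>.\<close>
  let ?H0 = "{(i n, f n) | n. n \<in> carrier N}"
  have H0: "partial_hom M Mg ?H0"
  proof (rule partial_homI)
    show "?H0 \<subseteq> carrier M \<times> carrier R" using i'(1) f'(1) by auto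
    show "(x \<oplus>\<^bsub>M\<^esub> x', y \<oplus> y') \<in> ?H0" if xy: "(x, y) \<in> ?H0" "(x', y') \<in> ?H0" for x y x' y'
    proof -
      obtain n n' where n: "x = i n" "y = f n" "n \<in> carrier N" "x' = i n'" "y' = f n'" "n' \<in> carrier N"
        using xy by blast
      then have "x \<oplus>\<^bsub>M\<^esub> x' = i (n \<oplus>\<^bsub>N\<^esub> n')" "y \<oplus> y' = f (n \<oplus>\<^bsub>N\<^esub> n')" "n \<oplus>\<^bsub>N\<^esub> n' \<in> carrier N"
        using i'(2) f'(2) by simp_all
      then show ?thesis by blast
    qed
    show "(r \<odot>\<^bsub>M\<^esub> x, r \<otimes> y) \<in> ?H0" if r: "r \<in> carrier R" and xy: "(x, y) \<in> ?H0" for r x y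
    proof -
      obtain n where n: "x = i n" "y = f n" "n \<in> carrier N" using xy by blast
      then have "r \<odot>\<^bsub>M\<^esub> x = i (r \<odot>\<^bsub>N\<^esub> n)" "r \<otimes> y = f (r \<odot>\<^bsub>N\<^esub> n)" "r \<odot>\<^bsub>N\<^esub> n \<in> carrier N"
        using i'(3) f'(3) r N.smult_closed by simp_all
      then show ?thesis by blast
    qed
    show "(MD.cmp x g, cmp y g) \<in> ?H0" if g: "g \<in> carrier G" and xy: "(x, y) \<in> ?H0" for g x y
    proof -
      obtain n where n: "x = i n" "y = f n" "n \<in> carrier N" using xy by blast
      have "MD.cmp (i n) g = i (ND.cmp n g)"
        by (rule component_additive_map[OF ND.direct_sum_axioms MD.direct_sum_axioms i'(1,2,4) n(3) g])
      moreover have "cmp (f n) g = f (ND.cmp n g)"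
        by (rule component_additive_map[OF ND.direct_sum_axioms direct_sum_axioms f'(1,2,4) n(3) g])
      ultimately show ?thesis using n ND.component_closed[OF n(3) g] by blast
    qed
    show "y = \<zero>" if yH: "(\<zero>\<^bsub>M\<^esub>, y) \<in> ?H0" for y
    proof -
      obtain n where n: "\<zero>\<^bsub>M\<^esub> = i n" "y = f n" "n \<in> carrier N" using yH by blast
      then have "n = \<zero>\<^bsub>N\<^esub>" using inj_onD[OF inj, of n "\<zero>\<^bsub>N\<^esub>"] z0 by simp
      then show ?thesis using n z0 by simp
    qed
  qed
  let ?A = "{H. partial_hom M Mg H \<and> ?H0 \<subseteq> H}"
  have "\<exists>H\<in>?A. \<forall>H'\<in>?A. H \<subseteq> H' \<longrightarrow> H' = H"
  proof (rule subset_Zorn_nonempty)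
    show "?A \<noteq> {}" using H0 by blast
    fix C assume C: "C \<noteq> {}" "subset.chain ?A C"
    then have CA: "\<And>H. H \<in> C \<Longrightarrow> partial_hom M Mg H \<and> ?H0 \<subseteq> H"
      and tot: "\<And>H K. H \<in> C \<Longrightarrow> K \<in> C \<Longrightarrow> H \<subseteq> K \<or> K \<subseteq> H"
      unfolding subset_chain_def by auto
    note Cd = partial_homD[OF CA[THEN conjunct1]]
    have "partial_hom M Mg (\<Union>C)"
    proof (rule partial_homI)
      show "\<Union>C \<subseteq> carrier M \<times> carrier R" using Cd(1) by auto
      show "(x \<oplus>\<^bsub>M\<^esub> x', y \<oplus> y') \<in> \<Union>C" if xy: "(x, y) \<in> \<Union>C" "(x', y') \<in> \<Union>C" for x y x' y'
      proof -
        obtain H K where HK: "H \<in> C" "K \<in> C" "(x, y) \<in> H" "(x', y') \<in> K" using xy by blast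
        then obtain L where "L \<in> C" "(x, y) \<in> L" "(x', y') \<in> L" using tot by blast
        then show ?thesis using Cd(2) by blast
      qed
      show "(r \<odot>\<^bsub>M\<^esub> x, r \<otimes> y) \<in> \<Union>C" if "r \<in> carrier R" "(x, y) \<in> \<Union>C" for r x y
        using Cd(3) that by blast
      show "(MD.cmp x g, cmp y g) \<in> \<Union>C" if "g \<in> carrier G" "(x, y) \<in> \<Union>C" for g x y
        using Cd(4) that by blast
      show "y = \<zero>" if "(\<zero>\<^bsub>M\<^esub>, y) \<in> \<Union>C" for y using Cd(5) that by blast
    qed
    then show "\<Union>C \<in> ?A" using C CA by blast
  qed
  then obtain H where HA: "H \<in> ?A" and mxA: "\<forall>H'\<in>?A. H \<subseteq> H' \<longrightarrow> H' = H" by (rule bexE)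
  have H: "partial_hom M Mg H" and H0H: "?H0 \<subseteq> H" using CollectD[OF HA] by simp_all
  have mx: "H' = H" if "partial_hom M Mg H'" "?H0 \<subseteq> H'" "H \<subseteq> H'" for H'
    by (rule mxA[rule_format]) (use that in simp_all)
  note Hd = partial_homD[OF H] and uniq = partial_hom_unique[OF Ml H]
  have zH: "(\<zero>\<^bsub>M\<^esub>, \<zero>) \<in> H" using H0H z0 by force
  have dom_hom: "x \<in> Domain H" if g: "g \<in> carrier G" and x: "x \<in> Mg g" for g x
  proof -
    obtain H' where H': "partial_hom M Mg H'" "H \<subseteq> H'" "x \<in> Domain H'"
      by (rule partial_hom_extend[OF M H zH g x]) (rule baer[OF _ g])
    then have "H' = H" using mx[OF H'(1)] H0H by blast
    then show ?thesis using H' by simp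
  qed
  have dom: "x \<in> Domain H" if x: "x \<in> carrier M" for x
  proof (rule MD.mem_of_components[OF x])
    show "\<zero>\<^bsub>M\<^esub> \<in> Domain H" using zH by blast
    show "y \<oplus>\<^bsub>M\<^esub> z \<in> Domain H" if "y \<in> Domain H" "z \<in> Domain H" for y z
      using that Hd(2) by blast
    show "Domain H \<subseteq> carrier M" using Hd(1) by blast
    show "MD.cmp x g \<in> Domain H" if "g \<in> carrier G" for g
      using dom_hom[OF that MD.component_mem[OF x that]] .
  qed
  define h where "h x = (THE y. (x, y) \<in> H)" for x
  have hI: "h x = y" if "(x, y) \<in> H" for x y unfolding h_def using that uniq by blast
  have h: "(x, h x) \<in> H" if "x \<in> carrier M" for x using dom[OF that] hI by blast
  have "h \<in> graded_hom G R M Mg (left_reg R) Rg"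
    unfolding graded_hom_def module_hom_def
  proof (intro CollectI conjI ballI Pi_I)
    show "h x \<in> carrier (left_reg R)" if "x \<in> carrier M" for x
      using Hd(1)[OF h[OF that]] by (simp add: left_reg_def)
    show "h (x \<oplus>\<^bsub>M\<^esub> y) = h x \<oplus>\<^bsub>left_reg R\<^esub> h y" if "x \<in> carrier M" "y \<in> carrier M" for x y
      using hI[OF Hd(2)[OF h[OF that(1)] h[OF that(2)]]] by (simp add: left_reg_def)
    show "h (r \<odot>\<^bsub>M\<^esub> x) = r \<odot>\<^bsub>left_reg R\<^esub> h x" if "r \<in> carrier R" "x \<in> carrier M" for r x
      using hI[OF Hd(3)[OF that(1) h[OF that(2)]]] by (simp add: left_reg_def)
    show "h ` Mg g \<subseteq> Rg g" if g: "g \<in> carrier G" for g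
    proof (rule image_subsetI)
      fix x assume x: "x \<in> Mg g"
      have xc: "x \<in> carrier M" by (rule MD.summand_carrier[OF g x])
      have "(x, cmp (h x) g) \<in> H" using Hd(4)[OF g h[OF xc]] MD.component_summand[OF g x g] by simp
      then have "h x = cmp (h x) g" by (rule hI)
      then show "h x \<in> Rg g" using component_mem[OF _ g] Hd(1)[OF h[OF xc]] by metis
    qed
  qed
  moreover have "\<forall>n\<in>carrier N. h (i n) = f n" using hI H0H by blast
  ultimately show "\<exists>h\<in>graded_hom G R M Mg (left_reg R) Rg. \<forall>x\<in>carrier N. h (i x) = f x" by blast
qed

end

section \<open>From socles to the Frobenius property\<close>

context graded_artinian_ring
begin

text \<open>A generator of a simple submodule of \<open>Rg \<sigma>\<close> generates a minimal
  graded left ideal. The elements of \<open>Rg \<sigma>\<close> all of whose multiples lie in the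
  graded socle form a \<open>B\<close>-submodule, so \<open>V.socle_subset\<close> passes from the
  generators to \<open>LS\<close>.\<close>

lemma socle_subset_graded_socle:
  assumes f: "left_faithful_at G R Rg \<sigma>" and x: "x \<in> LS" and r: "r \<in> carrier R"
  shows "r \<otimes> x \<in> graded_socle G R Rg"
proof -
  let ?S = "graded_socle G R Rg"
  interpret S: subgroup ?S "add_monoid R"
    unfolding graded_socle_def
  proof (rule group.generate_is_subgroup[OF a_group])
    show "\<Union> {I. minimal_graded_left_ideal G I R Rg} \<subseteq> carrier (add_monoid R)"
      unfolding minimal_graded_left_ideal_def using glD(3) by auto
  qed
  let ?H = "{x \<in> Rg \<sigma>. \<forall>r\<in>carrier R. r \<otimes> x \<in> ?S}"
  have xc: "x \<in> carrier R" if "x \<in> Rg \<sigma>" for x using Rg_carrier[OF s_carrier that] .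
  have H: "submodule ?H B (left_component R Rg \<sigma>)"
    unfolding V.submodule_iff
  proof (intro conjI ballI)
    show "\<zero>\<^bsub>left_component R Rg \<sigma>\<^esub> \<in> ?H"
      using S.one_closed summand_zero[OF s_carrier] by simp
    show "x \<oplus>\<^bsub>left_component R Rg \<sigma>\<^esub> y \<in> ?H" if "x \<in> ?H" "y \<in> ?H" for x y
      using that S.m_closed summand_add[OF s_carrier] xc by (auto simp: r_distr)
    show "r \<odot>\<^bsub>left_component R Rg \<sigma>\<^esub> x \<in> ?H" if "r \<in> carrier B" "x \<in> ?H" for r x
      using that RgE[of r] xc neutral_mult[OF s_carrier] by (auto simp flip: m_assoc)
  qed auto
  have "socle B (left_component R Rg \<sigma>) \<subseteq> ?H"
  proof (rule V.socle_subset[OF H])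
    fix x assume x: "x \<in> carrier (left_component R Rg \<sigma>)"
      and m: "maximal_left_ideal {r \<in> carrier B. r \<odot>\<^bsub>left_component R Rg \<sigma>\<^esub> x = \<zero>\<^bsub>left_component R Rg \<sigma>\<^esub>} B"
    have "minimal_graded_left_ideal G {r \<otimes> x | r. r \<in> carrier R} R Rg"
      using minimal_of_maximal_ann[OF f, of x] x m by simp
    then have "r \<otimes> x \<in> ?S" if "r \<in> carrier R" for r
      unfolding graded_socle_def using that by (intro generate.incl) blast
    then show "x \<in> ?H" using x by simp
  qed
  then show ?thesis using x r unfolding left_socle by blast
qed

text \<open>If \<open>a \<otimes> x\<close> were nonzero for a homogeneous \<open>a\<close>,
  faithfulness would give \<open>c\<close> of degree inverse to that of \<open>a\<close> with
  \<open>c \<otimes> a \<otimes> x\<close> nonzero; but \<open>c \<otimes> a\<close> is in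
  \<open>JB\<close>.\<close>

lemma JG_annihilates_LS:
  assumes f: "left_faithful_at G R Rg \<sigma>" and x: "x \<in> LS" and a: "a \<in> JG"
  shows "a \<otimes> x = \<zero>"
proof -
  have xd: "x \<in> Rg \<sigma>" and xc: "x \<in> carrier R" using LS_D(1,2)[OF x] .
  have A: "gl {a \<in> carrier R. a \<otimes> x = \<zero>}"
    using gl_colon[OF gl_zero s_carrier xd] by simp
  have "JG \<subseteq> {a \<in> carrier R. a \<otimes> x = \<zero>}"
  proof (rule subset_hom[OF gl_JG glD(1)[OF A]])
    fix g a assume g: "g \<in> carrier G" and a: "a \<in> Rg g" "a \<in> JG"
    have ac: "a \<in> carrier R" by (rule Rg_carrier[OF g a(1)])
    have "a \<otimes> x = \<zero>"
    proof (rule ccontr)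
      assume as: "a \<otimes> x \<noteq> \<zero>"
      have gs: "g \<otimes>\<^bsub>G\<^esub> \<sigma> \<in> carrier G" using g s_carrier by simp
      obtain c where c: "c \<in> Rg (\<sigma> \<otimes>\<^bsub>G\<^esub> inv\<^bsub>G\<^esub> (g \<otimes>\<^bsub>G\<^esub> \<sigma>))" "c \<otimes> (a \<otimes> x) \<noteq> \<zero>"
        using faithful_hom[OF f gs mult_mem[OF g s_carrier a(1) xd] as] by blast
      have "\<sigma> \<otimes>\<^bsub>G\<^esub> inv\<^bsub>G\<^esub> (g \<otimes>\<^bsub>G\<^esub> \<sigma>) = inv\<^bsub>G\<^esub> g"
        using g s_carrier by (simp add: G.inv_mult_group G.m_assoc[symmetric])
      then have cg: "c \<in> Rg (inv\<^bsub>G\<^esub> g)" using c by simp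
      then have "c \<otimes> a \<in> JB" using JG_hom[OF g a(1)] a(2) by blast
      then have "c \<otimes> a \<otimes> x = \<zero>" by (rule LS_D(3)[OF x])
      moreover have "c \<in> carrier R" using Rg_carrier[OF _ cg] g by simp
      ultimately show False using c(2) ac xc by (simp add: m_assoc)
    qed
    then show "a \<in> {a \<in> carrier R. a \<otimes> x = \<zero>}" using ac by blast
  qed
  then show ?thesis using a by blast
qed

end

section \<open>The graded socle and the isomorphism required in (1)\<close>

context cyclic_socles
begin

text \<open>A minimal graded left ideal meets \<open>Rg \<sigma>\<close> by faithfulness, and a
  nonzero element there has a nonzero multiple in \<open>LS = B s\<close>. By minimality the ideal
  lies in \<open>R s\<close>.\<close>

lemma graded_socle_eq: "graded_socle G R Rg = {r \<otimes> s | r. r \<in> carrier R}"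
proof
  show "{r \<otimes> s | r. r \<in> carrier R} \<subseteq> graded_socle G R Rg"
    using socle_subset_graded_socle[OF lfaithful s_LS] by blast
  have sd: "s \<in> Rg \<sigma>" by (rule LS_D(1)[OF s_LS])
  let ?P = "{r \<otimes> s | r. r \<in> carrier R}"
  have P: "gl ?P" by (rule gl_principal[OF s_carrier sd])
  show "graded_socle G R Rg \<subseteq> ?P"
    unfolding graded_socle_def
  proof (rule group.generate_subgroup_incl[OF a_group])
    show "subgroup ?P (add_monoid R)"
    proof (rule subgroup.intro)
      show "?P \<subseteq> carrier (add_monoid R)" using glD(3)[OF P] by simp
      show "x \<otimes>\<^bsub>add_monoid R\<^esub> y \<in> ?P" if "x \<in> ?P" "y \<in> ?P" for x y
        using glD(5)[OF P that] unfolding monoid.simps .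
      show "\<one>\<^bsub>add_monoid R\<^esub> \<in> ?P" using glD(4)[OF P] unfolding monoid.simps .
      fix x assume "x \<in> ?P"
      then show "inv\<^bsub>add_monoid R\<^esub> x \<in> ?P"
        using left_ideal_uminus[OF glD(1)[OF P]] unfolding a_inv_def by blast
    qed
    show "\<Union> {I. minimal_graded_left_ideal G I R Rg} \<subseteq> ?P"
    proof (rule Union_least)
      fix T assume "T \<in> {I. minimal_graded_left_ideal G I R Rg}"
      then have T: "gl T" "T \<noteq> {\<zero>}" and mn: "\<And>K. gl K \<Longrightarrow> K \<subseteq> T \<Longrightarrow> K = {\<zero>} \<or> K = T"
        unfolding minimal_graded_left_ideal_def by blast+
      note Tc = glD[OF T(1)]
      have "T \<inter> Rg \<sigma> \<noteq> {\<zero>}" using lfaithful T unfolding left_faithful_at_def by blast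
      moreover have "\<zero> \<in> T \<inter> Rg \<sigma>" using Tc(4) summand_zero[OF s_carrier] by blast
      ultimately obtain t where t: "t \<in> T" "t \<in> Rg \<sigma>" "t \<noteq> \<zero>" by blast
      obtain b where b: "b \<in> Rg E" "b \<otimes> t \<in> LS" "b \<otimes> t \<noteq> \<zero>" using ex_LS[OF t(2,3)] by metis
      have btT: "b \<otimes> t \<in> T" using Tc(6) t(1) RgE[OF b(1)] by blast
      obtain c where c: "c \<in> Rg E" "b \<otimes> t = c \<otimes> s" using b(2) LS_eq by blast
      have btP: "b \<otimes> t \<in> T \<inter> ?P" using btT c RgE by blast
      have "T \<inter> ?P = {\<zero>} \<or> T \<inter> ?P = T" by (rule mn[OF gl_Int[OF T(1) P]]) blast
      then show "T \<subseteq> ?P" using btP b(3) by blast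
    qed
  qed
qed

text \<open>For homogeneous \<open>a\<close> with \<open>a \<otimes> s = \<zero>\<close>, every
  product \<open>b \<otimes> a\<close> of neutral degree kills \<open>s\<close> and is therefore in
  \<open>JB\<close>, which is the criterion \<open>JG_hom\<close>.\<close>

lemma s_ann_JG: "{a \<in> carrier R. a \<otimes> s = \<zero>} = JG"
proof
  have sd: "s \<in> Rg \<sigma>" by (rule LS_D(1)[OF s_LS])
  have A: "gl {a \<in> carrier R. a \<otimes> s = \<zero>}"
    using gl_colon[OF gl_zero s_carrier sd] by simp
  show "{a \<in> carrier R. a \<otimes> s = \<zero>} \<subseteq> JG"
  proof (rule subset_hom[OF A glD(1)[OF gl_JG]])
    fix g a assume g: "g \<in> carrier G" and a: "a \<in> Rg g" "a \<in> {a \<in> carrier R. a \<otimes> s = \<zero>}"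
    have gi: "inv\<^bsub>G\<^esub> g \<in> carrier G" using g by simp
    have "b \<otimes> a \<in> JB" if b: "b \<in> Rg (inv\<^bsub>G\<^esub> g)" for b
    proof -
      have bc: "b \<in> carrier R" by (rule Rg_carrier[OF gi b])
      have "b \<otimes> a \<in> Rg E" using mult_mem[OF gi g b a(1)] g by simp
      moreover have "b \<otimes> a \<otimes> s = \<zero>" using a bc s_c by (simp add: m_assoc)
      ultimately show ?thesis using s_ann by blast
    qed
    then show "a \<in> JG" using JG_hom[OF g a(1)] by blast
  qed
  show "JG \<subseteq> {a \<in> carrier R. a \<otimes> s = \<zero>}"
    using JG_annihilates_LS[OF lfaithful s_LS] glD(7)[OF gl_JG] by blast
qed

lemma graded_frobenius: "graded_frobenius TYPE('m) G R Rg \<sigma>"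
  unfolding graded_frobenius_def graded_quasi_frobenius_def graded_left_noetherian_def
proof (intro conjI artinian gl_acc)
  show "graded_injective TYPE('m) G R Rg (left_reg R) Rg"
  proof (rule injective_of_baer)
    fix I \<phi> \<tau>
    assume *: "gl I" "\<tau> \<in> carrier G" "\<And>x. x \<in> I \<Longrightarrow> \<phi> x \<in> carrier R"
      "\<And>x y. x \<in> I \<Longrightarrow> y \<in> I \<Longrightarrow> \<phi> (x \<oplus> y) = \<phi> x \<oplus> \<phi> y"
      "\<And>r x. r \<in> carrier R \<Longrightarrow> x \<in> I \<Longrightarrow> \<phi> (r \<otimes> x) = r \<otimes> \<phi> x"
      "\<And>k x. k \<in> carrier G \<Longrightarrow> x \<in> I \<Longrightarrow> x \<in> Rg k \<Longrightarrow> \<phi> x \<in> Rg (k \<otimes>\<^bsub>G\<^esub> \<tau>)"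
    show "\<exists>c\<in>Rg \<tau>. \<forall>x\<in>I. \<phi> x = x \<otimes> c"
      by (rule baer[OF *]) blast+
  qed
  interpret L: left_module R "left_reg R" by (rule left_reg_module)
  let ?S = "graded_socle G R Rg"
  have sd: "s \<in> Rg \<sigma>" by (rule LS_D(1)[OF s_LS])
  have simps: "carrier (left_reg R) = carrier R" "ring.zero (left_reg R) = \<zero>" "smult (left_reg R) = monoid.mult R"
    by (simp_all add: left_reg_def)
  have "\<exists>f. f \<in> module_hom R ((left_reg R)\<lparr>carrier := ?S\<rparr>) (quot_module (left_reg R) JG)
    \<and> bij_betw f ?S (carrier (quot_module (left_reg R) JG))
    \<and> (\<forall>b\<in>carrier R. f (b \<odot>\<^bsub>left_reg R\<^esub> s) = JG +>\<^bsub>left_reg R\<^esub> b)"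
    by (rule L.quot_isoI[OF glD(1)[OF gl_JG]]) (simp_all add: simps s_c graded_socle_eq s_ann_JG)
  then obtain f where f: "f \<in> module_hom R ((left_reg R)\<lparr>carrier := ?S\<rparr>) (quot_module (left_reg R) JG)"
    "bij_betw f ?S (carrier (quot_module (left_reg R) JG))"
    and fb: "\<And>b. b \<in> carrier R \<Longrightarrow> f (b \<otimes> s) = JG +>\<^bsub>left_reg R\<^esub> b" unfolding simps by blast
  \<comment> \<open>As \<open>s\<close> has degree \<sigma>, an element of degree
    \<open>g \<sigma>\<close> in the socle is \<open>r \<otimes> s\<close> with \<open>r\<close> of
    degree \<open>g\<close>. This is the origin of the shift by \<sigma>.\<close>
  have deg: "f ` shift G \<sigma> (\<lambda>g. ?S \<inter> Rg g) g \<subseteq> quot_grading (left_reg R) Rg JG g" if g: "g \<in> carrier G" for g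
  proof (rule image_subsetI)
    fix x assume "x \<in> shift G \<sigma> (\<lambda>g. ?S \<inter> Rg g) g"
    then have x: "x \<in> ?S" "x \<in> Rg (g \<otimes>\<^bsub>G\<^esub> \<sigma>)" unfolding shift_def by blast+
    have gs: "g \<otimes>\<^bsub>G\<^esub> \<sigma> \<in> carrier G" using g s_carrier by simp
    obtain r where r: "r \<in> Rg (g \<otimes>\<^bsub>G\<^esub> \<sigma> \<otimes>\<^bsub>G\<^esub> inv\<^bsub>G\<^esub> \<sigma>)" "x = r \<otimes> s"
      using principal_hom[OF s_carrier sd gs x(2) x(1)[unfolded graded_socle_eq]] .
    have rg: "r \<in> Rg g" using r(1) g s_carrier by (simp add: G.m_assoc)
    then show "f x \<in> quot_grading (left_reg R) Rg JG g"
      unfolding quot_grading_def r(2) using fb[OF Rg_carrier[OF g rg]] by blast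
  qed
  show "graded_isomorphic G R ((left_reg R)\<lparr>carrier := ?S\<rparr>) (shift G \<sigma> (\<lambda>g. ?S \<inter> Rg g))
     (quot_module (left_reg R) JG) (quot_grading (left_reg R) Rg JG)"
    unfolding graded_isomorphic_def graded_hom_def using f deg by auto
qed

end

section \<open>The Baer property from injectivity\<close>

context graded_ring_components
begin

text \<open>The test modules for injectivity have elements of type \<open>'a + 'm\<close>, so that graded left
  ideals enter only through their copies under \<open>Inl\<close>; the shift by \<open>\<tau>\<close> turns maps of
  degree \<open>\<tau>\<close> into morphisms.\<close>

definition inl_module :: "'a set \<Rightarrow> ('a, 'a + 'm) module" where
  "inl_module I = \<lparr>carrier = Inl ` I, monoid.mult = undefined, one = undefined,
     ring.zero = Inl \<zero>, add = (\<lambda>x y. Inl (projl x \<oplus> projl y)), smult = (\<lambda>r x. Inl (r \<otimes> projl x))\<rparr>"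

definition inl_grading :: "'g \<Rightarrow> 'a set \<Rightarrow> 'g \<Rightarrow> ('a + 'm) set" where
  "inl_grading \<tau> I g = Inl ` (I \<inter> Rg (g \<otimes>\<^bsub>G\<^esub> inv\<^bsub>G\<^esub> \<tau>))"

lemma inl_module_simps:
  "carrier (inl_module I) = Inl ` I" "ring.zero (inl_module I) = Inl \<zero>"
  "x \<oplus>\<^bsub>inl_module I\<^esub> y = Inl (projl x \<oplus> projl y)" "r \<odot>\<^bsub>inl_module I\<^esub> x = Inl (r \<otimes> projl x)"
  by (simp_all add: inl_module_def)

lemma graded_inl_module:
  assumes I: "gl I" and t: "\<tau> \<in> carrier G"
  shows "graded_module G R Rg (inl_module I :: ('a, 'a + 'm) module) (inl_grading \<tau> I)"
proof -
  let ?M = "inl_module I :: ('a, 'a + 'm) module"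
  note Ic = glD[OF I] and s = inl_module_simps[of I]
  have M: "abelian_group ?M"
  proof (rule abelian_groupI)
    fix x assume "x \<in> carrier ?M"
    then obtain a where a: "x = Inl a" "a \<in> I" by (auto simp: s)
    have "\<ominus> a \<in> I" by (rule left_ideal_uminus[OF Ic(1) a(2)])
    then show "\<exists>y\<in>carrier ?M. y \<oplus>\<^bsub>?M\<^esub> x = \<zero>\<^bsub>?M\<^esub>"
      using l_neg[OF Ic(7)[OF a(2)]] by (auto simp: s a)
  qed (use Ic(4,5,7) in \<open>auto simp: s a_ac\<close>)
  interpret M: abelian_group ?M by (rule M)
  have Ml: "left_module R ?M"
  proof (intro left_module.intro left_module_axioms.intro ring_axioms M)
  qed (use Ic(6,7) in \<open>auto simp: s l_distr r_distr m_assoc\<close>)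
  have neg: "\<ominus>\<^bsub>?M\<^esub> (Inl a) = Inl (\<ominus> a)" if a: "a \<in> I" for a
  proof (rule M.minus_equality)
    show "Inl (\<ominus> a) \<oplus>\<^bsub>?M\<^esub> Inl a = \<zero>\<^bsub>?M\<^esub>" using l_neg[OF Ic(7)[OF a]] by (simp add: s)
    show "Inl a \<in> carrier ?M" "Inl (\<ominus> a) \<in> carrier ?M"
      using a left_ideal_uminus[OF Ic(1) a] by (simp_all add: s)
  qed
  have gt: "g \<otimes>\<^bsub>G\<^esub> inv\<^bsub>G\<^esub> \<tau> \<in> carrier G" if "g \<in> carrier G" for g using that t by simp
  have sub: "subgroup (inl_grading \<tau> I g) (add_monoid ?M)" if g: "g \<in> carrier G" for g
  proof (rule subgroup.intro)
    note gt = gt[OF g]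
    fix x :: "'a + 'm" assume "x \<in> inl_grading \<tau> I g"
    then obtain a where a: "x = Inl a" "a \<in> I" "a \<in> Rg (g \<otimes>\<^bsub>G\<^esub> inv\<^bsub>G\<^esub> \<tau>)" unfolding inl_grading_def by blast
    have "Inl (\<ominus> a) \<in> (inl_grading \<tau> I g :: ('a + 'm) set)"
      unfolding inl_grading_def using left_ideal_uminus[OF Ic(1) a(2)] summand_uminus[OF gt a(3)] by blast
    then show "inv\<^bsub>add_monoid ?M\<^esub> x \<in> inl_grading \<tau> I g"
      using neg[OF a(2)] unfolding a(1) a_inv_def by simp
  qed (use Ic(4,5) summand_zero[OF gt[OF g]] summand_add[OF gt[OF g]] in \<open>auto simp: s inl_grading_def\<close>)
  have ds: "internal_direct_sum ?M (carrier G) (inl_grading \<tau> I)"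
  proof (rule internal_direct_sumI[OF M sub])
    let ?p = "\<lambda>x g. Inl (cmp (projl x) (g \<otimes>\<^bsub>G\<^esub> inv\<^bsub>G\<^esub> \<tau>)) :: 'a + 'm"
    show "?p x g \<in> inl_grading \<tau> I g" if "x \<in> carrier ?M" "g \<in> carrier G" for x g
      using that Ic(2,7) component_mem gt[OF that(2)] unfolding s inl_grading_def by auto
    show "?p (x \<oplus>\<^bsub>?M\<^esub> y) g = ?p x g \<oplus>\<^bsub>?M\<^esub> ?p y g"
      if "x \<in> carrier ?M" "y \<in> carrier ?M" "g \<in> carrier G" for x y g
      using that Ic(7) gt[OF that(3)] unfolding s by (auto simp: component_add)
    show "?p x h = (if h = g then x else \<zero>\<^bsub>?M\<^esub>)"
      if "g \<in> carrier G" "x \<in> inl_grading \<tau> I g" "h \<in> carrier G" for x g h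
      using that component_summand[OF gt[OF that(1)] _ gt[OF that(3)]] t unfolding s inl_grading_def by auto
    show "x \<in> H" if x: "x \<in> carrier ?M" and H: "\<zero>\<^bsub>?M\<^esub> \<in> H" "\<And>y z. y \<in> H \<Longrightarrow> z \<in> H \<Longrightarrow> y \<oplus>\<^bsub>?M\<^esub> z \<in> H"
      "H \<subseteq> carrier ?M" "\<And>g. g \<in> carrier G \<Longrightarrow> ?p x g \<in> H" for x H
    proof -
      obtain a where a: "x = Inl a" "a \<in> I" using x by (auto simp: s)
      have "a \<in> {a \<in> I. Inl a \<in> H}"
      proof (rule mem_of_components[OF Ic(7)[OF a(2)]])
        show "\<zero> \<in> {a \<in> I. Inl a \<in> H}" using H(1) Ic(4) by (simp add: s)
        show "y \<oplus> z \<in> {a \<in> I. Inl a \<in> H}" if "y \<in> {a \<in> I. Inl a \<in> H}" "z \<in> {a \<in> I. Inl a \<in> H}" for y z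
          using H(2)[of "Inl y" "Inl z"] that Ic(5) by (simp add: s)
        show "{a \<in> I. Inl a \<in> H} \<subseteq> carrier R" using Ic(3) by blast
        \<comment> \<open>Degree \<open>g\<close> of the ring sits in degree \<open>g \<tau>\<close>
          of the shifted copy.\<close>
        show "cmp a g \<in> {a \<in> I. Inl a \<in> H}" if g: "g \<in> carrier G" for g
          using H(4)[of "g \<otimes>\<^bsub>G\<^esub> \<tau>"] Ic(2)[OF a(2) g] g t by (simp add: a(1) G.m_assoc)
      qed
      then show ?thesis using a by blast
    qed
  qed
  show ?thesis
  proof (intro graded_module.intro graded_module_axioms.intro graded_ring_axioms Ml ds)
    show "a \<odot>\<^bsub>?M\<^esub> x \<in> inl_grading \<tau> I (g \<otimes>\<^bsub>G\<^esub> h)"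
      if gh: "g \<in> carrier G" "h \<in> carrier G" and a: "a \<in> Rg g" and x: "x \<in> inl_grading \<tau> I h" for g h a x
    proof -
      obtain b where b: "x = Inl b" "b \<in> I" "b \<in> Rg (h \<otimes>\<^bsub>G\<^esub> inv\<^bsub>G\<^esub> \<tau>)" using x unfolding inl_grading_def by blast
      have "a \<otimes> b \<in> Rg (g \<otimes>\<^bsub>G\<^esub> (h \<otimes>\<^bsub>G\<^esub> inv\<^bsub>G\<^esub> \<tau>))" by (rule mult_mem[OF gh(1) gt[OF gh(2)] a b(3)])
      then have "a \<otimes> b \<in> Rg (g \<otimes>\<^bsub>G\<^esub> h \<otimes>\<^bsub>G\<^esub> inv\<^bsub>G\<^esub> \<tau>)" using gh t by (simp add: G.m_assoc)
      moreover have "a \<otimes> b \<in> I" using Ic(6) b(2) Rg_carrier[OF gh(1) a] by blast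
      ultimately show ?thesis unfolding inl_grading_def by (simp add: s b(1))
    qed
  qed
qed

text \<open>An extension \<open>h\<close> to the shifted copy of \<open>R\<close> is determined by
  its value at \<open>Inl \<one>\<close>. In the grading shifted by \<tau> the unit has degree
  \<tau>, hence so does this value.\<close>

lemma baer_of_injective:
  assumes inj: "graded_injective TYPE('a + 'm) G R Rg (left_reg R) Rg"
    and I: "gl I" and t: "\<tau> \<in> carrier G"
    and phi: "\<And>x. x \<in> I \<Longrightarrow> \<phi> x \<in> carrier R" "\<And>x y. x \<in> I \<Longrightarrow> y \<in> I \<Longrightarrow> \<phi> (x \<oplus> y) = \<phi> x \<oplus> \<phi> y"
      "\<And>r x. r \<in> carrier R \<Longrightarrow> x \<in> I \<Longrightarrow> \<phi> (r \<otimes> x) = r \<otimes> \<phi> x"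
      "\<And>g x. g \<in> carrier G \<Longrightarrow> x \<in> I \<Longrightarrow> x \<in> Rg g \<Longrightarrow> \<phi> x \<in> Rg (g \<otimes>\<^bsub>G\<^esub> \<tau>)"
  shows "\<exists>c\<in>Rg \<tau>. \<forall>x\<in>I. \<phi> x = x \<otimes> c"
proof -
  let ?M = "inl_module (carrier R) :: ('a, 'a + 'm) module"
  let ?N = "inl_module I :: ('a, 'a + 'm) module"
  let ?Mg = "inl_grading \<tau> (carrier R) :: 'g \<Rightarrow> ('a + 'm) set"
  let ?Ng = "inl_grading \<tau> I :: 'g \<Rightarrow> ('a + 'm) set"
  note Ic = glD[OF I] and s = inl_module_simps
  have M: "graded_module G R Rg ?M ?Mg" by (rule graded_inl_module[OF gl_carrier t])
  have N: "graded_module G R Rg ?N ?Ng" by (rule graded_inl_module[OF I t])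
  have i: "id \<in> graded_hom G R ?N ?Ng ?M ?Mg"
    unfolding graded_hom_def module_hom_def inl_grading_def using Ic(3) by (auto simp: s)
  have deg: "\<phi> a \<in> Rg g" if g: "g \<in> carrier G" and a: "a \<in> I" "a \<in> Rg (g \<otimes>\<^bsub>G\<^esub> inv\<^bsub>G\<^esub> \<tau>)" for a g
    using phi(4)[OF _ a] g t by (simp add: G.m_assoc)
  have f: "\<phi> \<circ> projl \<in> graded_hom G R ?N ?Ng (left_reg R) Rg"
    unfolding graded_hom_def module_hom_def inl_grading_def
    using phi(1,2,3) deg by (auto simp: s left_reg_def)
  have "inj_on id (carrier ?N)" by simp
  then obtain h where h: "h \<in> graded_hom G R ?M ?Mg (left_reg R) Rg"
    and hf: "\<And>x. x \<in> carrier ?N \<Longrightarrow> h (id x) = (\<phi> \<circ> projl) x"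
    using inj M N i f unfolding graded_injective_def by blast
  have h1: "h (Inl \<one>) \<in> Rg \<tau>"
  proof -
    have "Inl \<one> \<in> ?Mg \<tau>" unfolding inl_grading_def using one_mem t by simp
    then show ?thesis using h t unfolding graded_hom_def by blast
  qed
  have "\<phi> x = x \<otimes> h (Inl \<one>)" if x: "x \<in> I" for x
  proof -
    have xc: "x \<in> carrier R" by (rule Ic(7)[OF x])
    have "\<phi> x = h (Inl x)" using hf[of "Inl x"] x by (simp add: s)
    also have "Inl x = x \<odot>\<^bsub>?M\<^esub> Inl \<one>" using xc by (simp add: s)
    also have "h (x \<odot>\<^bsub>?M\<^esub> Inl \<one>) = x \<odot>\<^bsub>left_reg R\<^esub> h (Inl \<one>)"
    proof -
      have "\<forall>r\<in>carrier R. \<forall>y\<in>carrier ?M. h (r \<odot>\<^bsub>?M\<^esub> y) = r \<odot>\<^bsub>left_reg R\<^esub> h y"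
        using h unfolding graded_hom_def module_hom_def by blast
      then show ?thesis using xc by (simp add: s(1))
    qed
    finally show ?thesis by (simp add: left_reg_def)
  qed
  then show ?thesis using h1 by blast
qed

end

section \<open>From the Frobenius property to socles\<close>

context graded_ring_components
begin

lemma gr_nonzero_hom:
  assumes "gr I" "I \<noteq> {\<zero>}"
  obtains g x where "g \<in> carrier G" "x \<in> Rg g" "x \<in> I" "x \<noteq> \<zero>"
  using graded_ring_components.gl_nonzero_hom[OF gring_opp, of I] assms by (auto simp: opp_simps)

text \<open>The graded socle is generated only additively; closure under scalars and components is
  inherited from the minimal graded left ideals.\<close>

lemma gl_graded_socle: "gl (graded_socle G R Rg)"
proof -
  let ?S = "graded_socle G R Rg"
  interpret S: subgroup ?S "add_monoid R"
    unfolding graded_socle_def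
  proof (rule group.generate_is_subgroup[OF a_group])
    show "\<Union> {I. minimal_graded_left_ideal G I R Rg} \<subseteq> carrier (add_monoid R)"
      unfolding minimal_graded_left_ideal_def using glD(3) by auto
  qed
  have sc: "x \<in> carrier R" if "x \<in> ?S" for x using S.subset that by auto
  have sneg: "\<ominus> x \<in> ?S" if "x \<in> ?S" for x using S.m_inv_closed[OF that] by (simp add: a_inv_def)
  let ?H = "{x \<in> ?S. (\<forall>r\<in>carrier R. r \<otimes> x \<in> ?S) \<and> (\<forall>g\<in>carrier G. cmp x g \<in> ?S)}"
  have "?S \<subseteq> ?H"
  proof (subst (1) graded_socle_def, rule group.generate_subgroup_incl[OF a_group])
    show "subgroup ?H (add_monoid R)"
    proof (rule subgroup.intro)
      show "?H \<subseteq> carrier (add_monoid R)" using sc by auto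
      show "x \<otimes>\<^bsub>add_monoid R\<^esub> y \<in> ?H" if "x \<in> ?H" "y \<in> ?H" for x y
        using that sc S.m_closed by (auto simp: r_distr component_add)
      show "\<one>\<^bsub>add_monoid R\<^esub> \<in> ?H" using S.one_closed by (auto simp: component_zero)
      fix x assume x: "x \<in> ?H"
      then have "\<ominus> x \<in> ?H" using sc sneg by (auto simp: r_minus component_uminus)
      then show "inv\<^bsub>add_monoid R\<^esub> x \<in> ?H" by (simp add: a_inv_def)
    qed
    show "\<Union> {I. minimal_graded_left_ideal G I R Rg} \<subseteq> ?H"
    proof
      fix x assume "x \<in> \<Union> {I. minimal_graded_left_ideal G I R Rg}"
      then obtain T where T: "minimal_graded_left_ideal G T R Rg" "x \<in> T" by blast
      have TS: "T \<subseteq> ?S" unfolding graded_socle_def using T(1) by (auto intro: generate.incl)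
      have "gl T" using T(1) unfolding minimal_graded_left_ideal_def by blast
      then show "x \<in> ?H" using TS T(2) glD(2,6)[OF \<open>gl T\<close>] by blast
    qed
  qed
  then have H: "r \<otimes> x \<in> ?S" "cmp x g \<in> ?S" if "x \<in> ?S" "r \<in> carrier R" "g \<in> carrier G" for r x g
    using that by blast+
  have "left_ideal R ?S"
    by (rule left_idealI) (use sc S.one_closed S.m_closed H(1)[OF _ _ G.one_closed] in simp_all, blast)
  then show ?thesis unfolding gl_iff using H(2)[OF _ zero_closed] by blast
qed

end

context graded_artinian_ring
begin

lemma LS_subsetI:
  assumes H: "H \<subseteq> Rg \<sigma>" "\<zero> \<in> H" "\<And>x y. x \<in> H \<Longrightarrow> y \<in> H \<Longrightarrow> x \<oplus> y \<in> H"
      "\<And>b x. b \<in> Rg E \<Longrightarrow> x \<in> H \<Longrightarrow> b \<otimes> x \<in> H"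
    and simple: "\<And>x. x \<in> Rg \<sigma> \<Longrightarrow> maximal_left_ideal {r \<in> Rg E. r \<otimes> x = \<zero>} B \<Longrightarrow> x \<in> H"
  shows "LS \<subseteq> H"
  unfolding left_socle[symmetric]
  by (rule V.socle_subset) (use H simple in \<open>auto simp: V.submodule_iff\<close>)

lemma RS_subsetI:
  assumes "H \<subseteq> Rg \<sigma>" "\<zero> \<in> H" "\<And>x y. x \<in> H \<Longrightarrow> y \<in> H \<Longrightarrow> x \<oplus> y \<in> H"
      "\<And>b x. b \<in> Rg E \<Longrightarrow> x \<in> H \<Longrightarrow> x \<otimes> b \<in> H"
      "\<And>x. x \<in> Rg \<sigma> \<Longrightarrow> maximal_left_ideal {r \<in> Rg E. x \<otimes> r = \<zero>} (opp_ring B) \<Longrightarrow> x \<in> H"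
  shows "RS \<subseteq> H"
  using graded_artinian_ring.LS_subsetI[OF gart_opp, of H] assms by (simp add: LS_opp flip: opp_B)

end

text \<open>Injectivity enters as the Baer property for graded left ideals, which keeps the type of
  the test modules out of the locale.\<close>

locale graded_frobenius_ring = graded_artinian_ring G R Rg \<sigma>
  for G :: "('g, 'e) monoid_scheme" and R :: "('a, 'b) ring_scheme" (structure)
    and Rg :: "'g \<Rightarrow> 'a set" and \<sigma> :: 'g +
  assumes noetherian: "ascending_chain_condition gl"
    and baer_property: "\<lbrakk>gl I; \<tau> \<in> carrier G; \<And>x. x \<in> I \<Longrightarrow> \<phi> x \<in> carrier R;
      \<And>x y. x \<in> I \<Longrightarrow> y \<in> I \<Longrightarrow> \<phi> (x \<oplus> y) = \<phi> x \<oplus> \<phi> y;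
      \<And>r x. r \<in> carrier R \<Longrightarrow> x \<in> I \<Longrightarrow> \<phi> (r \<otimes> x) = r \<otimes> \<phi> x;
      \<And>g x. g \<in> carrier G \<Longrightarrow> x \<in> I \<Longrightarrow> x \<in> Rg g \<Longrightarrow> \<phi> x \<in> Rg (g \<otimes>\<^bsub>G\<^esub> \<tau>)\<rbrakk>
      \<Longrightarrow> \<exists>c\<in>Rg \<tau>. \<forall>x\<in>I. \<phi> x = x \<otimes> c"
    and socle_iso: "graded_isomorphic G R
       ((left_reg R)\<lparr>carrier := graded_socle G R Rg\<rparr>)
       (shift G \<sigma> (\<lambda>g. graded_socle G R Rg \<inter> Rg g))
       (quot_module (left_reg R) (graded_jacobson_radical G R Rg))
       (quot_grading (left_reg R) Rg (graded_jacobson_radical G R Rg))"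
begin

text \<open>The annihilator condition says exactly that sending
  \<open>i \<oplus> r \<otimes> y\<close> to \<open>r \<otimes> t\<close> is well defined on the sum
  of \<open>I\<close> and \<open>R y\<close>. The Baer property represents this map by a right
  multiplication.\<close>

lemma extend_hom:
  assumes I: "gl I" and g: "g \<in> carrier G" and h: "h \<in> carrier G" and y: "y \<in> Rg g" and t: "t \<in> Rg h"
    and ann: "\<And>r. r \<in> carrier R \<Longrightarrow> r \<otimes> y \<in> I \<Longrightarrow> r \<otimes> t = \<zero>"
  obtains c where "c \<in> Rg (inv\<^bsub>G\<^esub> g \<otimes>\<^bsub>G\<^esub> h)" "\<And>x. x \<in> I \<Longrightarrow> x \<otimes> c = \<zero>" "y \<otimes> c = t"
proof -
  note Ic = glD[OF I]
  have yc: "y \<in> carrier R" and tc: "t \<in> carrier R" using Rg_carrier g h y t by blast+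
  let ?P = "{r \<otimes> y | r. r \<in> carrier R}"
  let ?K = "{i \<oplus> z | i z. i \<in> I \<and> z \<in> ?P}"
  have K: "gl ?K" by (intro gl_sum I gl_principal[OF g y])
  define \<phi> where "\<phi> x = (THE z. \<exists>i r. i \<in> I \<and> r \<in> carrier R \<and> x = i \<oplus> r \<otimes> y \<and> z = r \<otimes> t)" for x
  have phiI: "\<phi> (i \<oplus> r \<otimes> y) = r \<otimes> t" if i: "i \<in> I" and r: "r \<in> carrier R" for i r
    unfolding \<phi>_def
  proof (rule the_equality)
    fix z assume "\<exists>j q. j \<in> I \<and> q \<in> carrier R \<and> i \<oplus> r \<otimes> y = j \<oplus> q \<otimes> y \<and> z = q \<otimes> t"
    then obtain j q where jq: "j \<in> I" "q \<in> carrier R" "i \<oplus> r \<otimes> y = j \<oplus> q \<otimes> y" "z = q \<otimes> t" by blast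
    have ic: "i \<in> carrier R" "j \<in> carrier R" using Ic(7) i jq by blast+
    have "(q \<ominus> r) \<otimes> y = (j \<oplus> q \<otimes> y) \<ominus> r \<otimes> y \<ominus> j" using ic r jq(2) yc by algebra
    also have "\<dots> = i \<ominus> j" unfolding jq(3)[symmetric] using ic r yc by algebra
    finally have "(q \<ominus> r) \<otimes> y \<in> I" using left_ideal_minus[OF Ic(1) i jq(1)] by simp
    then have "(q \<ominus> r) \<otimes> t = \<zero>" using ann r jq(2) by blast
    then have "q \<otimes> t \<ominus> r \<otimes> t = \<zero>" using r jq(2) tc by (simp add: minus_eq l_distr l_minus)
    then show "z = r \<otimes> t" using jq r tc minus_eq_zero_iff by simp
  qed (use i r in blast)
  have Ke: "\<exists>i r. i \<in> I \<and> r \<in> carrier R \<and> x = i \<oplus> r \<otimes> y" if "x \<in> ?K" for x using that by blast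
  have Ki: "i \<oplus> r \<otimes> y \<in> ?K" if "i \<in> I" "r \<in> carrier R" for i r using that by blast
  have "\<exists>c\<in>Rg (inv\<^bsub>G\<^esub> g \<otimes>\<^bsub>G\<^esub> h). \<forall>x\<in>?K. \<phi> x = x \<otimes> c"
  proof (rule baer_property[OF K])
    show "inv\<^bsub>G\<^esub> g \<otimes>\<^bsub>G\<^esub> h \<in> carrier G" using g h by simp
    show "\<phi> x \<in> carrier R" if "x \<in> ?K" for x
      using Ke[OF that] phiI tc by auto
    show "\<phi> (x \<oplus> z) = \<phi> x \<oplus> \<phi> z" if x: "x \<in> ?K" and z: "z \<in> ?K" for x z
    proof -
      obtain i r where 1: "i \<in> I" "r \<in> carrier R" "x = i \<oplus> r \<otimes> y" using Ke[OF x] by blast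
      obtain j q where 2: "j \<in> I" "q \<in> carrier R" "z = j \<oplus> q \<otimes> y" using Ke[OF z] by blast
      have ic: "i \<in> carrier R" "j \<in> carrier R" using Ic(7) 1 2 by blast+
      have "x \<oplus> z = (i \<oplus> j) \<oplus> (r \<oplus> q) \<otimes> y" unfolding 1 2 using ic 1(2) 2(2) yc by algebra
      then have "\<phi> (x \<oplus> z) = (r \<oplus> q) \<otimes> t" using phiI[of "i \<oplus> j" "r \<oplus> q"] Ic(5) 1 2 by simp
      also have "\<dots> = \<phi> x \<oplus> \<phi> z" using phiI 1 2 tc by (simp add: l_distr)
      finally show ?thesis .
    qed
    show "\<phi> (q \<otimes> x) = q \<otimes> \<phi> x" if q: "q \<in> carrier R" and x: "x \<in> ?K" for q x
    proof -
      obtain i r where 1: "i \<in> I" "r \<in> carrier R" "x = i \<oplus> r \<otimes> y" using Ke[OF x] by blast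
      have ic: "i \<in> carrier R" using Ic(7) 1 by blast
      have "q \<otimes> x = q \<otimes> i \<oplus> (q \<otimes> r) \<otimes> y" unfolding 1 using ic 1(2) q yc by algebra
      then have "\<phi> (q \<otimes> x) = (q \<otimes> r) \<otimes> t" using phiI[of "q \<otimes> i" "q \<otimes> r"] Ic(6) 1 q by simp
      also have "\<dots> = q \<otimes> \<phi> x" using phiI 1 q tc by (simp add: m_assoc)
      finally show ?thesis .
    qed
    show "\<phi> x \<in> Rg (k \<otimes>\<^bsub>G\<^esub> (inv\<^bsub>G\<^esub> g \<otimes>\<^bsub>G\<^esub> h))" if k: "k \<in> carrier G" and x: "x \<in> ?K" "x \<in> Rg k" for k x
    proof -
      obtain i r where 1: "i \<in> I" "r \<in> carrier R" "x = i \<oplus> r \<otimes> y" using Ke[OF x(1)] by blast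
      have ic: "i \<in> carrier R" using Ic(7) 1 by blast
      have kg: "k \<otimes>\<^bsub>G\<^esub> inv\<^bsub>G\<^esub> g \<in> carrier G" using k g by simp
      let ?r = "cmp r (k \<otimes>\<^bsub>G\<^esub> inv\<^bsub>G\<^esub> g)"
      have "x = cmp x k" using component_summand[OF k x(2) k] by simp
      also have "\<dots> = cmp i k \<oplus> ?r \<otimes> y"
        unfolding 1 using ic 1(2) yc k component_mult_right[OF g y 1(2) k] by (simp add: component_add)
      finally have "\<phi> x = ?r \<otimes> t"
        using phiI[OF Ic(2)[OF 1(1) k] component_closed[OF 1(2) kg]] by simp
      moreover have "?r \<otimes> t \<in> Rg (k \<otimes>\<^bsub>G\<^esub> inv\<^bsub>G\<^esub> g \<otimes>\<^bsub>G\<^esub> h)"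
        by (rule mult_mem[OF kg h component_mem[OF 1(2) kg] t])
      ultimately show ?thesis using k g h by (simp add: G.m_assoc)
    qed
  qed
  then obtain c where c: "c \<in> Rg (inv\<^bsub>G\<^esub> g \<otimes>\<^bsub>G\<^esub> h)" "\<And>x. x \<in> ?K \<Longrightarrow> \<phi> x = x \<otimes> c" by blast
  have "x \<otimes> c = \<zero>" if x: "x \<in> I" for x
  proof -
    have eq: "x \<oplus> \<zero> \<otimes> y = x" using Ic(7)[OF x] yc by simp
    show ?thesis using phiI[OF x zero_closed] c(2)[OF Ki[OF x zero_closed]] tc unfolding eq by simp
  qed
  moreover have "y \<otimes> c = t"
  proof -
    have eq: "\<zero> \<oplus> \<one> \<otimes> y = y" using yc by simp
    show ?thesis using phiI[OF Ic(4) one_closed] c(2)[OF Ki[OF Ic(4) one_closed]] tc unfolding eq by simp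
  qed
  ultimately show ?thesis using that c(1) by blast
qed

text \<open>The preimage \<open>s\<close> of the coset of \<open>\<one>\<close> generates the socle;
  the work lies in its degree, since the isomorphism is only given to respect degrees forwards. The
  components of \<open>s\<close> are multiples of \<open>s\<close> by homogeneous elements whose sum
  \<open>b\<close> is \<open>\<one>\<close> modulo \<open>JG\<close>. Comparing neutral components
  shows that \<open>s\<close> equals its component of degree \<sigma>.\<close>

lemma socle_generator:
  obtains s where "s \<in> Rg \<sigma>" "graded_socle G R Rg = {r \<otimes> s | r. r \<in> carrier R}"
    "{a \<in> carrier R. a \<otimes> s = \<zero>} = JG"
proof -
  interpret L: left_module R "left_reg R" by (rule left_reg_module)
  have lr: "carrier (left_reg R) = carrier R" "ring.zero (left_reg R) = \<zero>" "smult (left_reg R) = monoid.mult R"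
    by (simp_all add: left_reg_def)
  let ?S = "graded_socle G R Rg"
  note Sc = glD[OF gl_graded_socle] and Jl = glD(1)[OF gl_JG]
  obtain f where f: "f \<in> graded_hom G R ((left_reg R)\<lparr>carrier := ?S\<rparr>) (shift G \<sigma> (\<lambda>g. ?S \<inter> Rg g))
       (quot_module (left_reg R) JG) (quot_grading (left_reg R) Rg JG)"
    and bij: "bij_betw f ?S (carrier (quot_module (left_reg R) JG))"
    using socle_iso unfolding graded_isomorphic_def by auto
  have fh: "f \<in> module_hom R ((left_reg R)\<lparr>carrier := ?S\<rparr>) (quot_module (left_reg R) JG)"
    using f unfolding graded_hom_def by blast
  have Ssub: "submodule ?S R (left_reg R)" using submodule_left_reg Sc(1) by blast
  obtain s where s: "s \<in> ?S" "?S = {r \<otimes> s | r. r \<in> carrier R}" "{a \<in> carrier R. a \<otimes> s = \<zero>} = JG"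
    and fb: "\<And>b. b \<in> carrier R \<Longrightarrow> f (b \<otimes> s) = JG +>\<^bsub>left_reg R\<^esub> b"
    by (rule L.quot_isoD[OF Jl Ssub fh bij, unfolded lr], rule that)
  have sc: "s \<in> carrier R" using Sc(7) s(1) by blast
  have gs: "g \<otimes>\<^bsub>G\<^esub> \<sigma> \<in> carrier G" if "g \<in> carrier G" for g using that s_carrier by simp
  have deg: "\<exists>a\<in>Rg g. cmp s (g \<otimes>\<^bsub>G\<^esub> \<sigma>) = a \<otimes> s" if g: "g \<in> carrier G" for g
  proof -
    let ?x = "cmp s (g \<otimes>\<^bsub>G\<^esub> \<sigma>)"
    have xS: "?x \<in> ?S" by (rule Sc(2)[OF s(1) gs[OF g]])
    then have "?x \<in> shift G \<sigma> (\<lambda>g. ?S \<inter> Rg g) g"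
      unfolding shift_def using component_mem[OF sc gs[OF g]] by blast
    then have "f ?x \<in> quot_grading (left_reg R) Rg JG g" using f g unfolding graded_hom_def by blast
    then obtain a where a: "a \<in> Rg g" "f ?x = JG +>\<^bsub>left_reg R\<^esub> a" unfolding quot_grading_def by blast
    have ac: "a \<in> carrier R" by (rule Rg_carrier[OF g a(1)])
    have "f ?x = f (a \<otimes> s)" using fb[OF ac] a(2) by simp
    then have "?x = a \<otimes> s"
      using inj_onD[OF bij_betw_imp_inj_on[OF bij]] xS Sc(6)[OF ac s(1)] by blast
    then show ?thesis using a(1) by blast
  qed
  \<comment> \<open>The multiplier \<open>b\<close> is tracked degree by degree while the components
    of \<open>s\<close> are added up.\<close>
  let ?H = "{x \<in> carrier R. \<exists>b\<in>carrier R. x = b \<otimes> s \<and> (\<forall>g\<in>carrier G. cmp x (g \<otimes>\<^bsub>G\<^esub> \<sigma>) = cmp b g \<otimes> s)}"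
  have "s \<in> ?H"
  proof (rule mem_of_components[OF sc])
    have "\<forall>g\<in>carrier G. cmp \<zero> (g \<otimes>\<^bsub>G\<^esub> \<sigma>) = cmp \<zero> g \<otimes> s"
      using gs sc by (simp add: component_zero)
    then show "\<zero> \<in> ?H" using sc by (auto intro!: bexI[of _ \<zero>])
    show "y \<oplus> z \<in> ?H" if y: "y \<in> ?H" and z: "z \<in> ?H" for y z
    proof -
      obtain b where b: "b \<in> carrier R" "y = b \<otimes> s" "\<forall>g\<in>carrier G. cmp y (g \<otimes>\<^bsub>G\<^esub> \<sigma>) = cmp b g \<otimes> s"
        using y by blast
      obtain c where c: "c \<in> carrier R" "z = c \<otimes> s" "\<forall>g\<in>carrier G. cmp z (g \<otimes>\<^bsub>G\<^esub> \<sigma>) = cmp c g \<otimes> s"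
        using z by blast
      have yz: "y \<in> carrier R" "z \<in> carrier R" using y z by blast+
      have "y \<oplus> z = (b \<oplus> c) \<otimes> s" using b(1,2) c(1,2) sc by (simp add: l_distr)
      moreover have "\<forall>g\<in>carrier G. cmp (y \<oplus> z) (g \<otimes>\<^bsub>G\<^esub> \<sigma>) = cmp (b \<oplus> c) g \<otimes> s"
        using b(1,3) c(1,3) yz gs sc by (simp add: component_add component_closed l_distr)
      ultimately show ?thesis using yz b(1) c(1) sc by (intro CollectI conjI bexI[of _ "b \<oplus> c"]) simp_all
    qed
    show "cmp s k \<in> ?H" if k: "k \<in> carrier G" for k
    proof -
      let ?g = "k \<otimes>\<^bsub>G\<^esub> inv\<^bsub>G\<^esub> \<sigma>"
      have g: "?g \<in> carrier G" "?g \<otimes>\<^bsub>G\<^esub> \<sigma> = k" using k s_carrier by (simp_all add: G.m_assoc)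
      obtain a where a: "a \<in> Rg ?g" "cmp s k = a \<otimes> s" using deg[OF g(1)] g(2) by auto
      have ac: "a \<in> carrier R" by (rule Rg_carrier[OF g(1) a(1)])
      have "cmp (cmp s k) (h \<otimes>\<^bsub>G\<^esub> \<sigma>) = cmp a h \<otimes> s" if h: "h \<in> carrier G" for h
      proof -
        have "h \<otimes>\<^bsub>G\<^esub> \<sigma> = k \<longleftrightarrow> h = ?g" using g h s_carrier k by (metis G.right_cancel)
        then show ?thesis
          using component_summand[OF k component_mem[OF sc k] gs[OF h]] component_summand[OF g(1) a(1) h] a(2) sc
          by simp
      qed
      then show ?thesis using a ac sc component_closed[OF sc k] by blast
    qed
  qed auto
  then obtain b where b: "b \<in> carrier R" "s = b \<otimes> s" "\<And>g. g \<in> carrier G \<Longrightarrow> cmp s (g \<otimes>\<^bsub>G\<^esub> \<sigma>) = cmp b g \<otimes> s"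
    by blast
  have bE: "cmp b E \<in> carrier R" by (rule component_closed[OF b(1) G.one_closed])
  have "(\<one> \<ominus> b) \<otimes> s = \<one> \<otimes> s \<ominus> b \<otimes> s" using b(1) sc by algebra
  also have "\<dots> = \<zero>" using b(2) sc by (simp add: minus_eq r_neg)
  finally have "\<one> \<ominus> b \<in> JG" using s(3) b(1) by blast
  then have "cmp (\<one> \<ominus> b) E \<in> JG" using glD(2)[OF gl_JG] by blast
  moreover have "cmp (\<one> \<ominus> b) E = \<one> \<ominus> cmp b E"
    using b(1) component_summand[OF G.one_closed one_mem G.one_closed]
    by (simp add: minus_eq component_add component_uminus)
  ultimately have "(\<one> \<ominus> cmp b E) \<otimes> s = \<zero>" using s(3) by auto
  then have "s \<ominus> cmp b E \<otimes> s = \<zero>" using bE sc by (simp add: minus_eq l_distr l_minus)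
  then have "s = cmp b E \<otimes> s" using minus_eq_zero_iff[of s "cmp b E \<otimes> s"] bE sc by simp
  also have "\<dots> = cmp s \<sigma>" using b(3)[OF G.one_closed] s_carrier by simp
  finally have "s \<in> Rg \<sigma>" using component_mem[OF sc s_carrier] by simp
  then show ?thesis using that s by blast
qed

definition sgen :: 'a where
  "sgen = (SOME s. s \<in> Rg \<sigma> \<and> graded_socle G R Rg = {r \<otimes> s | r. r \<in> carrier R}
     \<and> {a \<in> carrier R. a \<otimes> s = \<zero>} = JG)"

abbreviation "s \<equiv> sgen"

lemma sgen: "s \<in> Rg \<sigma>" "graded_socle G R Rg = {r \<otimes> s | r. r \<in> carrier R}"
  "{a \<in> carrier R. a \<otimes> s = \<zero>} = JG"
proof -
  have "\<exists>s. s \<in> Rg \<sigma> \<and> graded_socle G R Rg = {r \<otimes> s | r. r \<in> carrier R}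
     \<and> {a \<in> carrier R. a \<otimes> s = \<zero>} = JG"
    by (rule socle_generator) blast
  from someI_ex[OF this] show "s \<in> Rg \<sigma>" "graded_socle G R Rg = {r \<otimes> s | r. r \<in> carrier R}"
    "{a \<in> carrier R. a \<otimes> s = \<zero>} = JG" unfolding sgen_def by blast+
qed

section \<open>Left faithfulness, the left socle and separation\<close>

lemma s_c: "s \<in> carrier R" by (rule Rg_carrier[OF s_carrier sgen(1)])

lemma s_ann_B: "b \<in> Rg E \<Longrightarrow> b \<otimes> s = \<zero> \<longleftrightarrow> b \<in> JB"
  using sgen(3) JG_Int RgE by blast

text \<open>By the descending chain condition a nonzero graded left ideal contains a minimal one,
  which lies in the socle \<open>R s\<close>. A nonzero homogeneous element of it is
  \<open>r \<otimes> s\<close> with \<open>r\<close> outside \<open>JG\<close>, so some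
  \<open>b \<otimes> r\<close> in \<open>Rg E\<close> avoids \<open>JB\<close> and yields a nonzero
  multiple in degree \<sigma>.\<close>

lemma lfaithful: "left_faithful_at G R Rg \<sigma>"
  unfolding left_faithful_at_def
proof (intro allI impI)
  fix I assume I: "gl I \<and> I \<noteq> {\<zero>}"
  let ?F = "\<lambda>T. gl T \<and> T \<noteq> {\<zero>} \<and> T \<subseteq> I"
  have F0: "?F I" using I by blast
  obtain T where T: "?F T" and mn: "\<And>K. ?F K \<Longrightarrow> K \<subseteq> T \<Longrightarrow> K = T"
    using dcc_minimal[where F = ?F, OF gl_dcc F0] by blast
  have "minimal_graded_left_ideal G T R Rg"
    unfolding minimal_graded_left_ideal_def using T mn by blast
  then have TS: "T \<subseteq> graded_socle G R Rg" unfolding graded_socle_def by (auto intro: generate.incl)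
  have gT: "gl T" "T \<noteq> {\<zero>}" using T by blast+
  obtain h x where h: "h \<in> carrier G" and x: "x \<in> Rg h" "x \<in> T" "x \<noteq> \<zero>"
    by (rule gl_nonzero_hom[OF gT])
  have "x \<in> {r \<otimes> s | r. r \<in> carrier R}" using TS x(2) sgen(2) by blast
  then obtain r where r: "r \<in> Rg (h \<otimes>\<^bsub>G\<^esub> inv\<^bsub>G\<^esub> \<sigma>)" "x = r \<otimes> s"
    using principal_hom[OF s_carrier sgen(1) h x(1)] by blast
  have hs: "h \<otimes>\<^bsub>G\<^esub> inv\<^bsub>G\<^esub> \<sigma> \<in> carrier G" using h s_carrier by simp
  have rc: "r \<in> carrier R" by (rule Rg_carrier[OF hs r(1)])
  have "r \<notin> JG" using sgen(3) r x by blast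
  then obtain b where b: "b \<in> Rg (inv\<^bsub>G\<^esub> (h \<otimes>\<^bsub>G\<^esub> inv\<^bsub>G\<^esub> \<sigma>))" "b \<otimes> r \<notin> JB"
    using JG_hom[OF hs r(1)] by blast
  have hi: "inv\<^bsub>G\<^esub> (h \<otimes>\<^bsub>G\<^esub> inv\<^bsub>G\<^esub> \<sigma>) \<in> carrier G" using hs by simp
  have bc: "b \<in> carrier R" by (rule Rg_carrier[OF hi b(1)])
  have br: "b \<otimes> r \<in> Rg E" using mult_mem[OF hi hs b(1) r(1)] hs by (simp del: G.inv_mult_group)
  have bx: "b \<otimes> x = (b \<otimes> r) \<otimes> s" using r(2) bc rc s_c by (simp add: m_assoc)
  have "b \<otimes> x \<noteq> \<zero>" unfolding bx using s_ann_B[OF br] b(2) by blast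
  moreover have "b \<otimes> x \<in> Rg \<sigma>" unfolding bx by (rule neutral_mult[OF s_carrier br sgen(1)])
  moreover have "b \<otimes> x \<in> I" using glD(6)[OF gT(1) bc x(2)] T by blast
  ultimately show "I \<inter> Rg \<sigma> \<noteq> {\<zero>}" by blast
qed

lemma s_LS: "s \<in> LS"
  using sgen(1) s_ann_B JB_E by (auto intro: LS_I)

lemma LS_eq: "LS = {b \<otimes> s | b. b \<in> Rg E}"
proof
  show "{b \<otimes> s | b. b \<in> Rg E} \<subseteq> LS" using LS_l[OF s_LS] by blast
  show "LS \<subseteq> {b \<otimes> s | b. b \<in> Rg E}"
  proof
    fix x assume x: "x \<in> LS"
    have "\<one> \<otimes> x \<in> graded_socle G R Rg" by (rule socle_subset_graded_socle[OF lfaithful x one_closed])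
    then have "x \<in> {r \<otimes> s | r. r \<in> carrier R}" using sgen(2) LS_D(2)[OF x] by simp
    then obtain r where "r \<in> Rg (\<sigma> \<otimes>\<^bsub>G\<^esub> inv\<^bsub>G\<^esub> \<sigma>)" "x = r \<otimes> s"
      using principal_hom[OF s_carrier sgen(1) s_carrier LS_D(1)[OF x]] by blast
    then show "x \<in> {b \<otimes> s | b. b \<in> Rg E}" using s_carrier by auto
  qed
qed

lemma lgen_s: "lgen s"
  unfolding lgen_def using s_LS LS_eq s_ann_B JB_E by blast

text \<open>The witness is \<open>e \<otimes> s\<close>, where \<open>e\<close> splits off
  \<open>n\<close> modulo \<open>JB\<close>. Homogeneous elements of \<open>big E n\<close> multiply
  \<open>e\<close> into \<open>JG\<close>, the annihilator of \<open>s\<close>, while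
  \<open>e\<close> is outside \<open>JB\<close> because it is outside \<open>n\<close>.\<close>

lemma maximal_annihilates:
  assumes n: "maximal_left_ideal n B"
  obtains t where "t \<in> Rg \<sigma>" "t \<noteq> \<zero>" "\<And>a. a \<in> big E n \<Longrightarrow> a \<otimes> t = \<zero>"
proof -
  note nl = B.maximal_left_idealD[OF n]
  have bn: "bsub E n" using nl(1) left_ideal_B by blast
  obtain e where e: "e \<in> Rg E" "\<one> \<ominus> e \<in> n" "\<And>y. y \<in> n \<Longrightarrow> y \<otimes> e \<in> JB"
    using B_split[OF nl(1) B.jacobson_subset_maximal[OF n]] by metis
  have ec: "e \<in> carrier R" by (rule RgE[OF e(1)])
  have gn: "gl (big E n)" by (rule gl_big[OF G.one_closed bn])
  have sub: "big E n \<subseteq> {a \<in> carrier R. a \<otimes> e \<in> JG}"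
  proof (rule subset_hom[OF gn glD(1)[OF gl_colon[OF gl_JG G.one_closed e(1)]]])
    fix k a assume k: "k \<in> carrier G" and a: "a \<in> Rg k" "a \<in> big E n"
    have ki: "inv\<^bsub>G\<^esub> k \<in> carrier G" using k by simp
    have ac: "a \<in> carrier R" by (rule Rg_carrier[OF k a(1)])
    have ae: "a \<otimes> e \<in> Rg k" by (rule mult_neutral[OF k a(1) e(1)])
    have "b \<otimes> (a \<otimes> e) \<in> JB" if b: "b \<in> Rg (inv\<^bsub>G\<^esub> k)" for b
    proof -
      have bc: "b \<in> carrier R" by (rule Rg_carrier[OF ki b])
      have "b \<otimes> a \<in> n" using big_hom[OF G.one_closed bn k a(1)] a(2) b k by simp
      then show ?thesis using e(3) bc ac ec by (simp add: m_assoc[symmetric])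
    qed
    then show "a \<in> {a \<in> carrier R. a \<otimes> e \<in> JG}" using JG_hom[OF k ae] ac by blast
  qed
  have "a \<otimes> (e \<otimes> s) = \<zero>" if "a \<in> big E n" for a
  proof -
    have ac: "a \<in> carrier R" by (rule glD(7)[OF gn that])
    have "a \<otimes> e \<in> {a \<in> carrier R. a \<otimes> s = \<zero>}"
      unfolding sgen(3) using that sub by blast
    then show ?thesis using ac ec s_c by (simp add: m_assoc)
  qed
  moreover have "e \<otimes> s \<in> Rg \<sigma>" by (rule neutral_mult[OF s_carrier e(1) sgen(1)])
  moreover have "e \<otimes> s \<noteq> \<zero>"
  proof
    assume "e \<otimes> s = \<zero>"
    then have "e \<in> n" using s_ann_B[OF e(1)] B.jacobson_subset_maximal[OF n] by blast
    then have "(\<one> \<ominus> e) \<oplus> e \<in> n" using e(2) left_idealD(3)[OF nl(1)] by simp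
    then show False using nl(2) ec by (simp add: minus_eq a_assoc l_neg)
  qed
  ultimately show ?thesis using that by blast
qed

text \<open>Enlarge the colon ideal of \<open>y\<close> modulo \<open>I\<close> to some
  \<open>big E n\<close> and take an element \<open>t\<close> killed by it. Then a single right
  multiplication sends \<open>y\<close> to \<open>t\<close> and \<open>I\<close> to zero.\<close>

lemma separate:
  assumes I: "gl I" and g: "g \<in> carrier G" and y: "y \<in> Rg g" "y \<notin> I"
  obtains c where "c \<in> Rg (inv\<^bsub>G\<^esub> g \<otimes>\<^bsub>G\<^esub> \<sigma>)" "\<And>x. x \<in> I \<Longrightarrow> x \<otimes> c = \<zero>" "y \<otimes> c \<in> Rg \<sigma>" "y \<otimes> c \<noteq> \<zero>"
proof -
  let ?m = "{r \<in> carrier R. r \<otimes> y \<in> I}"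
  have m: "gl ?m" by (rule gl_colon[OF I g y(1)])
  have "\<one> \<notin> ?m" using y Rg_carrier[OF g y(1)] by simp
  then obtain n where n: "maximal_left_ideal n B" "?m \<subseteq> big E n" using proper_gl_big[OF m] by blast
  obtain t where t: "t \<in> Rg \<sigma>" "t \<noteq> \<zero>" "\<And>a. a \<in> big E n \<Longrightarrow> a \<otimes> t = \<zero>"
    using maximal_annihilates[OF n(1)] by metis
  have "r \<otimes> t = \<zero>" if "r \<in> carrier R" "r \<otimes> y \<in> I" for r using that t(3) n(2) by blast
  then obtain c where "c \<in> Rg (inv\<^bsub>G\<^esub> g \<otimes>\<^bsub>G\<^esub> \<sigma>)" "\<And>x. x \<in> I \<Longrightarrow> x \<otimes> c = \<zero>" "y \<otimes> c = t"
    using extend_hom[OF I g s_carrier y(1) t(1)] by metis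
  then show ?thesis using that t by metis
qed

section \<open>Right faithfulness and the right socle\<close>

lemma rfaithful: "right_faithful_at G R Rg \<sigma>"
  unfolding right_faithful_at_def
proof (intro allI impI)
  fix I assume I: "gr I \<and> I \<noteq> {\<zero>}"
  obtain g x where g: "g \<in> carrier G" and x: "x \<in> Rg g" "x \<in> I" "x \<noteq> \<zero>"
    by (rule gr_nonzero_hom[of I]) (use I in auto)
  obtain c where c: "c \<in> Rg (inv\<^bsub>G\<^esub> g \<otimes>\<^bsub>G\<^esub> \<sigma>)" "x \<otimes> c \<in> Rg \<sigma>" "x \<otimes> c \<noteq> \<zero>"
    using separate[OF gl_zero g x(1)] x(3) by blast
  have "c \<in> carrier R" using Rg_carrier[OF _ c(1)] g s_carrier by simp
  then have "x \<otimes> c \<in> I" using grD(6) I x(2) by blast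
  then show "I \<inter> Rg \<sigma> \<noteq> {\<zero>}" using c by blast
qed

text \<open>The annihilator \<open>JG\<close> of \<open>s\<close> also kills \<open>x\<close>, so
  \<open>extend_hom\<close> sends \<open>s\<close> to \<open>x\<close> by a multiplier of neutral
  degree.\<close>

lemma LS_s: assumes x: "x \<in> LS" obtains c where "c \<in> Rg E" "x = s \<otimes> c"
proof -
  have "r \<otimes> x = \<zero>" if "r \<in> carrier R" "r \<otimes> s \<in> {\<zero>}" for r
    using JG_annihilates_LS[OF lfaithful x] sgen(3) that by blast
  then obtain c where "c \<in> Rg (inv\<^bsub>G\<^esub> \<sigma> \<otimes>\<^bsub>G\<^esub> \<sigma>)" "s \<otimes> c = x"
    using extend_hom[OF gl_zero s_carrier s_carrier sgen(1) LS_D(1)[OF x]] by metis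
  then show ?thesis using that s_carrier by auto
qed

text \<open>If \<open>t \<otimes> j\<close> were nonzero, simplicity of \<open>B t\<close> and left
  faithfulness would show that whatever kills \<open>t \<otimes> j\<close> kills \<open>t\<close>.
  Then some \<open>d\<close> brings \<open>t \<otimes> j\<close> back to \<open>t\<close>, so
  \<open>t\<close> is killed by the unit \<open>\<one> \<ominus> j \<otimes> d\<close> and
  vanishes.\<close>

lemma simple_radical:
  assumes t: "t \<in> Rg \<sigma>" and m: "maximal_left_ideal {r \<in> Rg E. r \<otimes> t = \<zero>} B" and j: "j \<in> JB"
  shows "t \<otimes> j = \<zero>"
proof (rule ccontr)
  assume tj: "t \<otimes> j \<noteq> \<zero>"
  have tc: "t \<in> carrier R" by (rule Rg_carrier[OF s_carrier t])
  have jc: "j \<in> carrier R" by (rule JB_c[OF j])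
  have tjd: "t \<otimes> j \<in> Rg \<sigma>" by (rule mult_neutral[OF s_carrier t JB_E[OF j]])
  have A: "gl {r \<in> carrier R. r \<otimes> u \<in> {\<zero>}}" if "u \<in> Rg \<sigma>" for u by (rule gl_colon[OF gl_zero s_carrier that])
  have "{r \<in> carrier R. r \<otimes> (t \<otimes> j) \<in> {\<zero>}} \<subseteq> {r \<in> carrier R. r \<otimes> t \<in> {\<zero>}}"
  proof (rule subset_hom[OF A[OF tjd] glD(1)[OF A[OF t]]])
    fix k r assume k: "k \<in> carrier G" and r: "r \<in> Rg k" "r \<in> {r \<in> carrier R. r \<otimes> (t \<otimes> j) \<in> {\<zero>}}"
    have rc: "r \<in> carrier R" using r by blast
    have "r \<otimes> t = \<zero>"
    proof (rule ccontr)
      assume rt: "r \<otimes> t \<noteq> \<zero>"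
      have ks: "k \<otimes>\<^bsub>G\<^esub> \<sigma> \<in> carrier G" using k s_carrier by simp
      obtain c where c: "c \<in> Rg (\<sigma> \<otimes>\<^bsub>G\<^esub> inv\<^bsub>G\<^esub> (k \<otimes>\<^bsub>G\<^esub> \<sigma>))" "c \<otimes> (r \<otimes> t) \<noteq> \<zero>"
        using faithful_hom[OF lfaithful ks mult_mem[OF k s_carrier r(1) t] rt] by blast
      have "\<sigma> \<otimes>\<^bsub>G\<^esub> inv\<^bsub>G\<^esub> (k \<otimes>\<^bsub>G\<^esub> \<sigma>) = inv\<^bsub>G\<^esub> k"
        using k s_carrier by (simp add: G.inv_mult_group G.m_assoc[symmetric])
      then have ck: "c \<in> Rg (inv\<^bsub>G\<^esub> k)" using c by simp
      have ki: "inv\<^bsub>G\<^esub> k \<in> carrier G" using k by simp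
      have cc: "c \<in> carrier R" by (rule Rg_carrier[OF ki ck])
      have crE: "c \<otimes> r \<in> Rg E" using mult_mem[OF ki k ck r(1)] k by simp
      have "c \<otimes> r \<notin> {r \<in> Rg E. r \<otimes> t = \<zero>}" using c(2) cc rc tc by (simp add: m_assoc)
      then obtain q y where q: "q \<in> Rg E" "y \<in> Rg E" "y \<otimes> t = \<zero>" "\<one> = q \<otimes> (c \<otimes> r) \<oplus> y"
        using B.maximal_left_idealD(3)[OF m, of "c \<otimes> r"] crE by auto
      note qc = RgE[OF q(1)] RgE[OF q(2)]
      have "t \<otimes> j = (q \<otimes> (c \<otimes> r) \<oplus> y) \<otimes> (t \<otimes> j)" unfolding q(4)[symmetric] using tc jc by simp
      also have "\<dots> = q \<otimes> c \<otimes> (r \<otimes> (t \<otimes> j)) \<oplus> (y \<otimes> t) \<otimes> j"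
        using qc cc rc tc jc by (simp add: l_distr m_assoc)
      also have "\<dots> = \<zero>" using r(2) q(3) qc cc jc by simp
      finally show False using tj by blast
    qed
    then show "r \<in> {r \<in> carrier R. r \<otimes> t \<in> {\<zero>}}" using rc by blast
  qed
  then obtain d where d: "d \<in> Rg (inv\<^bsub>G\<^esub> \<sigma> \<otimes>\<^bsub>G\<^esub> \<sigma>)" "t \<otimes> j \<otimes> d = t"
    using extend_hom[OF gl_zero s_carrier s_carrier tjd t] by blast
  have dE: "d \<in> Rg E" using d(1) s_carrier by simp
  have jd: "j \<otimes> d \<in> JB" by (rule JB_r[OF j dE])
  obtain u where u: "u \<in> Rg E" "(\<one> \<ominus> j \<otimes> d) \<otimes> u = \<one>"
    using B.jacobson_unit[OF jd] unfolding Units_def by (auto simp: B_minus one_mem JB_E[OF jd])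
  note c = tc jc RgE[OF dE] RgE[OF u(1)]
  have "t = t \<otimes> ((\<one> \<ominus> j \<otimes> d) \<otimes> u)" using u(2) tc by simp
  also have "\<dots> = (t \<ominus> t \<otimes> j \<otimes> d) \<otimes> u" using c r_one[of t] by algebra
  also have "\<dots> = \<zero>" unfolding d(2) using c by (simp add: minus_eq r_neg)
  finally show False using tj jc by simp
qed

lemma LS_sub_RS: "LS \<subseteq> RS"
proof (rule LS_subsetI[OF _ RS_zero RS_add RS_l])
  show "RS \<subseteq> Rg \<sigma>" using RS_D(1) by blast
  fix t assume t: "t \<in> Rg \<sigma>" "maximal_left_ideal {r \<in> Rg E. r \<otimes> t = \<zero>} B"
  show "t \<in> RS" by (rule RS_I[OF t(1) simple_radical[OF t]])
qed

text \<open>The correspondence between \<open>a\<close> and \<open>c\<close> given by \<open>a s = s c\<close> induces a surjective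
  endomorphism of the Noetherian ring \<open>R\<^sub>\<epsilon> / J\<close>, which is injective by the usual Hopfian
  argument: the sets \<open>I n\<close> below are the preimages of its iterated kernels.\<close>

lemma s_ann_right: assumes c: "c \<in> Rg E" "s \<otimes> c = \<zero>" shows "c \<in> JB"
proof -
  define \<Phi> where "\<Phi> I = {c \<in> Rg E. \<exists>a\<in>I. s \<otimes> c = a \<otimes> s}" for I
  define I where "I n = (\<Phi> ^^ n) JB" for n
  have I0: "I 0 = JB" and IS: "I (Suc n) = \<Phi> (I n)" for n by (simp_all add: I_def)
  have mono: "\<Phi> K \<subseteq> \<Phi> K'" if "K \<subseteq> K'" for K K' unfolding \<Phi>_def using that by blast
  have left: "left_ideal B (\<Phi> K)" if K: "left_ideal B K" for K
  proof (rule left_ideal_BI)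
    note Kc = left_idealD[OF K, simplified]
    have Kcar: "a \<in> carrier R" if "a \<in> K" for a using Kc(5)[OF that] RgE by blast
    show "\<Phi> K \<subseteq> Rg E" unfolding \<Phi>_def by blast
    show "\<zero> \<in> \<Phi> K" unfolding \<Phi>_def using Kc(2) s_c summand_zero by (auto intro!: bexI[of _ \<zero>])
    show "x \<oplus> y \<in> \<Phi> K" if "x \<in> \<Phi> K" "y \<in> \<Phi> K" for x y
    proof -
      obtain a where a: "a \<in> K" "s \<otimes> x = a \<otimes> s" "x \<in> Rg E" using \<open>x \<in> \<Phi> K\<close> unfolding \<Phi>_def by blast
      obtain b where b: "b \<in> K" "s \<otimes> y = b \<otimes> s" "y \<in> Rg E" using \<open>y \<in> \<Phi> K\<close> unfolding \<Phi>_def by blast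
      have "s \<otimes> (x \<oplus> y) = (a \<oplus> b) \<otimes> s"
        using a b RgE[OF a(3)] RgE[OF b(3)] Kcar s_c by (simp add: r_distr l_distr)
      then show ?thesis unfolding \<Phi>_def using Kc(3)[OF a(1) b(1)] a(3) b(3) summand_add by blast
    qed
    show "r \<otimes> x \<in> \<Phi> K" if r: "r \<in> Rg E" and x: "x \<in> \<Phi> K" for r x
    proof -
      obtain a where a: "a \<in> K" "s \<otimes> x = a \<otimes> s" "x \<in> Rg E" using x unfolding \<Phi>_def by blast
      obtain b where b: "b \<in> Rg E" "s \<otimes> r = b \<otimes> s" using LS_r[OF s_LS r] LS_eq by blast
      have "s \<otimes> (r \<otimes> x) = (s \<otimes> r) \<otimes> x" using RgE[OF a(3)] RgE[OF r] s_c by (simp add: m_assoc)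
      also have "\<dots> = b \<otimes> (s \<otimes> x)" unfolding b(2) using RgE[OF a(3)] RgE[OF b(1)] s_c by (simp add: m_assoc)
      also have "\<dots> = (b \<otimes> a) \<otimes> s" unfolding a(2) using Kcar[OF a(1)] RgE[OF b(1)] s_c by (simp add: m_assoc)
      finally show ?thesis unfolding \<Phi>_def using Kc(4)[OF b(1) a(1)] E_mult[OF r a(3)] by blast
    qed
  qed
  have lI: "left_ideal B (I n)" for n
    by (induction n) (simp_all add: I0 IS left B.left_ideal_jacobson)
  have "JB \<subseteq> \<Phi> JB"
  proof
    fix j assume j: "j \<in> JB"
    have "s \<otimes> j = \<zero> \<otimes> s" using RS_D(3)[OF subsetD[OF LS_sub_RS s_LS] j] s_c by simp
    then show "j \<in> \<Phi> JB" unfolding \<Phi>_def using JB_E[OF j] JB_zero by blast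
  qed
  then have inc: "I n \<subseteq> I (Suc n)" for n
    by (induction n) (simp_all add: I0 IS mono)
  have JI: "JB \<subseteq> I n" for n
    by (induction n) (use I0 inc in blast)+
  obtain k where "\<And>n. n \<ge> k \<Longrightarrow> I n = I k"
    using B_acc[OF noetherian, unfolded ascending_chain_condition_def, rule_format, of I] lI inc by blast
  then have Ik: "I (Suc k) = I k" by (metis le_Suc_eq order_refl)
  \<comment> \<open>Surjectivity supplies a partner \<open>c\<close> of \<open>a\<close>.
    Stabilisation one level up gives \<open>c\<close> a partner \<open>a'\<close> in level
    \<open>n\<close>, and \<open>a\<close> differs from \<open>a'\<close> by an element of
    \<open>JB\<close>.\<close>
  have desc: "I (Suc n) = I n" if eq: "I (Suc (Suc n)) = I (Suc n)" for n
  proof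
    show "I (Suc n) \<subseteq> I n"
    proof
      fix a assume a: "a \<in> I (Suc n)"
      have aE: "a \<in> Rg E" using a unfolding IS \<Phi>_def by blast
      obtain c where c: "c \<in> Rg E" "a \<otimes> s = s \<otimes> c" using LS_s[OF LS_l[OF s_LS aE]] by metis
      have "s \<otimes> c = a \<otimes> s" using c(2) by simp
      then have "c \<in> I (Suc (Suc n))" unfolding IS[of "Suc n"] \<Phi>_def using a c(1) by blast
      then have "c \<in> \<Phi> (I n)" using eq IS by simp
      then obtain a' where a': "a' \<in> I n" "s \<otimes> c = a' \<otimes> s" unfolding \<Phi>_def by blast
      have a'E: "a' \<in> Rg E" using left_idealD(5)[OF lI a'(1)] by simp
      have "(a \<ominus> a') \<otimes> s = a \<otimes> s \<ominus> a' \<otimes> s" using RgE[OF aE] RgE[OF a'E] s_c by algebra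
      also have "\<dots> = \<zero>" using c(2) a'(2) RgE[OF a'E] s_c by (simp add: minus_eq r_neg)
      finally have "a \<ominus> a' \<in> I n" using s_ann_B[OF E_minus[OF aE a'E]] JI by blast
      then have "(a \<ominus> a') \<oplus> a' \<in> I n" using left_idealD(3)[OF lI _ a'(1)] by simp
      then show "a \<in> I n" using RgE[OF aE] RgE[OF a'E] by (simp add: minus_eq a_assoc l_neg)
    qed
  qed (rule inc)
  have "I (Suc 0) = I 0" if "I (Suc n) = I n" for n
    using that
  proof (induction n)
    case (Suc n)
    then show ?case using desc[of n] by simp
  qed simp
  from this[OF Ik] have "\<Phi> JB = JB" by (simp add: IS I0)
  \<comment> \<open>The zero element is a partner of \<open>c\<close>, so \<open>c\<close> lies in
    the first preimage, which has just been shown to be \<open>JB\<close>.\<close>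
  moreover have "s \<otimes> c = \<zero> \<otimes> s" using c(2) s_c by simp
  then have "c \<in> \<Phi> JB" unfolding \<Phi>_def using c(1) JB_zero by blast
  ultimately show ?thesis by blast
qed

text \<open>For \<open>x\<close> generating a simple right submodule, choose a nonzero
  \<open>a \<otimes> x\<close> in \<open>LS\<close>. If \<open>x\<close> were outside the left ideal
  of \<open>a \<otimes> x\<close>, separation would give \<open>c\<close> with
  \<open>a \<otimes> x \<otimes> c = \<zero>\<close> and \<open>x \<otimes> c\<close> nonzero, yet
  \<open>x\<close> is a right multiple of \<open>x \<otimes> c\<close>. So \<open>x\<close> is a
  left multiple of \<open>a \<otimes> x\<close> by an element of \<open>Rg E\<close>.\<close>

lemma RS_sub_LS: "RS \<subseteq> LS"
proof (rule RS_subsetI[OF _ LS_zero LS_add LS_r])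
  show "LS \<subseteq> Rg \<sigma>" using LS_D(1) by blast
  fix x assume x: "x \<in> Rg \<sigma>" and m: "maximal_left_ideal {r \<in> Rg E. x \<otimes> r = \<zero>} (opp_ring B)"
  have xc: "x \<in> carrier R" by (rule Rg_carrier[OF s_carrier x])
  interpret o: ring "opp_ring B" by (rule B.opp_ring_ring)
  have "x \<noteq> \<zero>" using o.maximal_left_idealD(2)[OF m] one_mem by auto
  then obtain a where a: "a \<in> Rg E" "a \<otimes> x \<in> LS" "a \<otimes> x \<noteq> \<zero>" using ex_LS[OF x] by metis
  have ac: "a \<in> carrier R" by (rule RgE[OF a(1)])
  have ax: "a \<otimes> x \<in> Rg \<sigma>" by (rule LS_D(1)[OF a(2)])
  let ?I = "{r \<otimes> (a \<otimes> x) | r. r \<in> carrier R}"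
  have I: "gl ?I" by (rule gl_principal[OF s_carrier ax])
  have "x \<in> ?I"
  proof (rule ccontr)
    assume xI: "x \<notin> ?I"
    obtain c where c: "c \<in> Rg (inv\<^bsub>G\<^esub> \<sigma> \<otimes>\<^bsub>G\<^esub> \<sigma>)" "\<And>z. z \<in> ?I \<Longrightarrow> z \<otimes> c = \<zero>" "x \<otimes> c \<noteq> \<zero>"
      using separate[OF I s_carrier x xI] by blast
    have cE: "c \<in> Rg E" using c(1) s_carrier by simp
    have "\<one> \<otimes> (a \<otimes> x) \<in> ?I" by blast
    then have axc: "a \<otimes> x \<otimes> c = \<zero>" using c(2) ac xc by simp
    obtain d y where d: "d \<in> Rg E" "y \<in> Rg E" "x \<otimes> y = \<zero>" "\<one> = c \<otimes> d \<oplus> y"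
      using o.maximal_left_idealD(3)[OF m, of c] cE c(3) by auto
    note cs = RgE[OF cE] RgE[OF d(1)] RgE[OF d(2)]
    have "a \<otimes> x = a \<otimes> x \<otimes> (c \<otimes> d \<oplus> y)" unfolding d(4)[symmetric] using ac xc by simp
    also have "\<dots> = (a \<otimes> x \<otimes> c) \<otimes> d \<oplus> a \<otimes> (x \<otimes> y)" using cs ac xc by (simp add: r_distr m_assoc)
    also have "\<dots> = \<zero>" unfolding axc d(3) using cs ac by simp
    finally show False using a(3) by blast
  qed
  then obtain r where "r \<in> Rg (\<sigma> \<otimes>\<^bsub>G\<^esub> inv\<^bsub>G\<^esub> \<sigma>)" "x = r \<otimes> (a \<otimes> x)"
    using principal_hom[OF s_carrier ax s_carrier x] by blast
  then show "x \<in> LS" using LS_l[OF a(2), of r] s_carrier by simp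
qed

lemma rgen_s: "rgen s"
  unfolding rgen_def
proof (intro conjI)
  show sR: "s \<in> RS" using LS_sub_RS s_LS by blast
  show "RS = {s \<otimes> b | b. b \<in> Rg E}"
    using RS_sub_LS LS_s RS_r[OF sR] by blast
  show "{b \<in> Rg E. s \<otimes> b = \<zero>} = JB"
    using RS_D(3)[OF sR] s_ann_right JB_E by blast
qed

end

theorem theorem7p8:
  fixes G :: "('g, 'e) monoid_scheme" and R :: "('a, 'b) ring_scheme"
    and Rg :: "'g \<Rightarrow> 'a set" and \<sigma> :: 'g
  assumes "graded_ring G R Rg"
    and "graded_artinian G R Rg"
    and "\<sigma> \<in> carrier G"
  shows "graded_frobenius TYPE('a + 'm) G R Rg \<sigma> \<longleftrightarrow>
    left_faithful_at G R Rg \<sigma> \<and> right_faithful_at G R Rg \<sigma> \<and>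
    module_isomorphic (neutral_component G R Rg)
      ((left_component R Rg \<sigma>)
         \<lparr>carrier := socle (neutral_component G R Rg) (left_component R Rg \<sigma>)\<rparr>)
      (quot_module (left_reg (neutral_component G R Rg))
         (jacobson_radical (neutral_component G R Rg))) \<and>
    module_isomorphic (opp_ring (neutral_component G R Rg))
      ((right_component R Rg \<sigma>)
         \<lparr>carrier := socle (opp_ring (neutral_component G R Rg)) (right_component R Rg \<sigma>)\<rparr>)
      (quot_module (right_reg (neutral_component G R Rg))
         (jacobson_radical (neutral_component G R Rg)))"
proof -
  interpret graded_artinian_ring G R Rg \<sigma>
    using assms by (intro graded_artinian_ring.intro graded_ring_components.intro graded_artinian_ring_axioms.intro)
  show ?thesis
    \<comment> \<open>Both isomorphisms become the existence of generators in the sense of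
      \<open>lgen\<close> and \<open>rgen\<close>.\<close>
    unfolding left_iso_iff right_iso_iff
  proof
    assume f: "graded_frobenius TYPE('a + 'm) G R Rg \<sigma>"
    then have inj: "graded_injective TYPE('a + 'm) G R Rg (left_reg R) Rg"
      unfolding graded_frobenius_def graded_quasi_frobenius_def by blast
    have "graded_frobenius_ring G R Rg \<sigma>"
    proof (intro graded_frobenius_ring.intro graded_frobenius_ring_axioms.intro graded_artinian_ring_axioms)
      show "ascending_chain_condition gl"
        using f unfolding graded_frobenius_def graded_quasi_frobenius_def graded_left_noetherian_def by blast
      show "graded_isomorphic G R ((left_reg R)\<lparr>carrier := graded_socle G R Rg\<rparr>)
         (shift G \<sigma> (\<lambda>g. graded_socle G R Rg \<inter> Rg g)) (quot_module (left_reg R) JG)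
         (quot_grading (left_reg R) Rg JG)"
        using f unfolding graded_frobenius_def by blast
    \<comment> \<open>The summand \<open>'a\<close> of the universe provides room for copies of
      \<open>R\<close> and of its graded left ideals as test modules.\<close>
    qed (rule baer_of_injective[OF inj])
    then interpret graded_frobenius_ring G R Rg \<sigma> .
    show "left_faithful_at G R Rg \<sigma> \<and> right_faithful_at G R Rg \<sigma> \<and> (\<exists>s. lgen s) \<and> (\<exists>s. rgen s)"
      using lfaithful rfaithful lgen_s rgen_s by blast
  next
    assume "left_faithful_at G R Rg \<sigma> \<and> right_faithful_at G R Rg \<sigma> \<and> (\<exists>s. lgen s) \<and> (\<exists>s. rgen s)"
    then obtain s s' where "cyclic_socles G R Rg \<sigma> s s'"
      using cyclic_socles.intro[OF graded_artinian_ring_axioms] cyclic_socles_axioms.intro[of G R Rg \<sigma>] by blast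
    then show "graded_frobenius TYPE('a + 'm) G R Rg \<sigma>" by (rule cyclic_socles.graded_frobenius)
  qed
qed

end
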